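(* Assume $\mathbb E K>1$ and $\mathbb E K^2<\infty$. Let $\sigma_K^2$ denote the variance of $K$, let $\theta\in(0,\infty)$ be the unique root of $\frac{1-e^{-\theta}}{\theta}=\frac{1}{\mathbb E K}$, and let $p=1-e^{-\theta}$. As $n\to\infty$, conditionally on $\mathrm{Surv}^{\rm GW}$, we have the convergence in law $$n^{-1/2}(\tau_n-n\theta)\longrightarrow\mathcal N(0,\sigma_\tau^2),\qquad \sigma_\tau^2=[(1-p)\mathbb E K-1]^{-2}\,[\,p\,\sigma_K^2+(\mathbb E K)^2\sigma_N(\theta)^2\,],$$ where $\sigma_N(s)^2=e^{-s}(1-e^{-s})-se^{-2s}$. Similarly, conditionally on $\mathrm{Surv}^{\rm GW}$, we have the convergence in law $$n^{-1/2}(N_n(\tau_n)-np)\longrightarrow\mathcal N(0,\sigma_p^2),\qquad \sigma_p^2=[(1-p)\mathbb E K-1]^{-2}\,[\,p\,\sigma_K^2e^{-2\theta}+\sigma_N(\theta)^2\,].$$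
   Context: $\mathbb N=\{0,1,2,\dots\}$, $\mathbb N^*=\{1,2,\dots\}$. $K$ is a generic random variable with law $\mu$ on $\mathbb N$. $\mathcal N(0,\sigma^2)$ is the centered Gaussian law with variance $\sigma^2$. Galton--Watson tree. $\mathcal W=\bigcup_{k\ge0}(\mathbb N^* )^k$ is the set of finite words, $|w|$ the length of $w$, $\varnothing$ the empty word (root). $(K(w))_{w\in\mathcal W}$ are i.i.d. with law $\mu$. The tree $\mathcal T^{\rm GW}$ is the set of words $w=w_1\cdots w_k$ ($k\ge 0$) with $w_i\le K(w_1\cdots w_{i-1})$ for all $1\le i\le k$. $Z^{\rm GW}_k=\mathrm{card}\{w\in\mathcal T^{\rm GW}:|w|=k\}$ and $\mathrm{Surv}^{\rm GW}=\{Z_k^{\rm GW}\ge1\ \forall k\}$. Words are ordered by: $w<w'$ if $|w|<|w'|$, or $|w|=|w'|$ and $w$ precedes $w'$ lexicographically. Coupon collector. For each $n\ge1$, independently of the tree, $\Delta_{i,n}$ ($1\le i\le n-1$) are independent, $\Delta_{i,n}$ geometric on $\mathbb N^*$ with success probability $1-i/n$; $T_{1,n}=0$, $T_{i,n}=\sum_{j=1}^{i-1}\Delta_{j,n}$, and $N_n(t)=\sum_{i=1}^n\mathbf 1_{\{T_{i,n}\le t\}}$, $t\in\mathbb N$. Transmission process. Start with $X(0)=\varnothing$, $\mathcal T^{\circ}(0)=\{\varnothing\}$, $\mathcal T^{\boxtimes}(0)=\{w\in\mathcal T^{\rm GW}:|w|=1\}$. Given the sets at time $t$: if $\mathcal T^{\boxtimes}(t)=\emptyset$,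 set $\tau_n=t$ and stop. Otherwise let $v=X(t+1)$ be the smallest element of $\mathcal T^{\boxtimes}(t)$ for the order $<$; if $N_n(t+1)=N_n(t)+1$, put $\mathcal T^\circ(t+1)=\mathcal T^\circ(t)\cup\{v\}$ and $\mathcal T^\boxtimes(t+1)=(\mathcal T^\boxtimes(t)\setminus\{v\})\cup\{v1,\dots,vK(v)\}$; if $N_n(t+1)=N_n(t)$, put $\mathcal T^\circ(t+1)=\mathcal T^\circ(t)$ and $\mathcal T^\boxtimes(t+1)=\mathcal T^\boxtimes(t)\setminus\{v\}$. Thus $\tau_n$ is the duration of the transmission and $N_n(\tau_n)=\mathrm{card}\,\mathcal T^\circ(\tau_n)$ the number of finally informed servers. *)

theory Defs
  imports "HOL-Probability.Probability"
begin

definition words :: "nat list set" where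
  "words = {w. \<forall>i\<in>set w. 1 \<le> i}"

definition gw_tree :: "(nat list \<Rightarrow> nat) \<Rightarrow> nat list set" where
  "gw_tree k = {w \<in> words. \<forall>i<length w. w ! i \<le> k (take i w)}"

definition gw_generation :: "(nat list \<Rightarrow> nat) \<Rightarrow> nat \<Rightarrow> nat" where
  "gw_generation k l = card {w \<in> gw_tree k. length w = l}"

definition surv :: "'a measure \<Rightarrow> (nat list \<Rightarrow> 'a \<Rightarrow> nat) \<Rightarrow> 'a set" where
  "surv M K = {\<omega> \<in> space M. \<forall>l. 1 \<le> gw_generation (\<lambda>w. K w \<omega>) l}"

text \<open>\<^const>\<open>lenlex\<close> compares lengths first and words of equal length lexicographically.\<close>

definition smallest_word :: "nat list set \<Rightarrow> nat list" where
  "smallest_word B = (THE v. v \<in> B \<and> (\<forall>w\<in>B. w \<noteq> v \<longrightarrow> (v, w) \<in> lenlex less_than))"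

text \<open>In the next two definitions \<open>d j\<close> is the realisation of the waiting time with indices
  \<open>j, n\<close>; only \<open>d 1, \<dots>, d (n - 1)\<close> are used.\<close>

definition coupon_time :: "(nat \<Rightarrow> nat) \<Rightarrow> nat \<Rightarrow> nat" where
  "coupon_time d i = (\<Sum>j\<in>{1..<i}. d j)"

definition coupon_count :: "nat \<Rightarrow> (nat \<Rightarrow> nat) \<Rightarrow> nat \<Rightarrow> nat" where
  "coupon_count n d t = (\<Sum>i\<in>{1..n}. if coupon_time d i \<le> t then 1 else 0)"

text \<open>The pair of sets (informed vertices, vertices waiting to be explored) at each time, for
  offspring numbers \<open>k\<close> and a counting path \<open>N\<close>. The pair is frozen once the second set is empty.\<close>

primrec transmission ::
  "(nat list \<Rightarrow> nat) \<Rightarrow> (nat \<Rightarrow> nat) \<Rightarrow> nat \<Rightarrow> nat list set \<times> nat list set" where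
  "transmission k N 0 = ({[]}, {w \<in> gw_tree k. length w = 1})"
| "transmission k N (Suc t) =
    (let (C, B) = transmission k N t; v = smallest_word B in
      if B = {} then (C, B)
      else if N (Suc t) = N t + 1 then (C \<union> {v}, (B - {v}) \<union> {v @ [j] |j. 1 \<le> j \<and> j \<le> k v})
      else (C, B - {v}))"

definition duration :: "(nat list \<Rightarrow> nat) \<Rightarrow> (nat \<Rightarrow> nat) \<Rightarrow> nat" where
  "duration k N = (LEAST t. snd (transmission k N t) = {})"

definition tau :: "(nat list \<Rightarrow> 'a \<Rightarrow> nat) \<Rightarrow> (nat \<Rightarrow> nat \<Rightarrow> 'a \<Rightarrow> nat) \<Rightarrow> nat \<Rightarrow> 'a \<Rightarrow> nat" where
  "tau K \<Delta> n \<omega> = duration (\<lambda>w. K w \<omega>) (coupon_count n (\<lambda>i. \<Delta> i n \<omega>))"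

definition informed :: "(nat list \<Rightarrow> 'a \<Rightarrow> nat) \<Rightarrow> (nat \<Rightarrow> nat \<Rightarrow> 'a \<Rightarrow> nat) \<Rightarrow> nat \<Rightarrow> 'a \<Rightarrow> nat" where
  "informed K \<Delta> n \<omega> = coupon_count n (\<lambda>i. \<Delta> i n \<omega>) (tau K \<Delta> n \<omega>)"

definition is_theta :: "real \<Rightarrow> real \<Rightarrow> bool" where
  "is_theta m \<theta> \<longleftrightarrow> 0 < \<theta> \<and> (1 - exp (- \<theta>)) / \<theta> = 1 / m"

definition sigma_N_sq :: "real \<Rightarrow> real" where
  "sigma_N_sq s = exp (- s) * (1 - exp (- s)) - s * exp (- 2 * s)"

text \<open>Centred Gaussian law with variance \<open>v > 0\<close>; the library's \<^const>\<open>normal_density\<close> takes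
  the standard deviation.\<close>

definition centred_gaussian :: "real \<Rightarrow> real measure" where
  "centred_gaussian v = density lborel (\<lambda>x. ennreal (normal_density 0 (sqrt v) x))"

definition cond_law :: "'a measure \<Rightarrow> 'a set \<Rightarrow> ('a \<Rightarrow> real) \<Rightarrow> real measure" where
  "cond_law M A Y = distr (uniform_measure M A) borel Y"

end

theory Submission
  imports Defs "HOL-Real_Asymp.Real_Asymp"
begin

text \<open>
  Let \<open>v\<^sub>1, v\<^sub>2, \<dots>\<close> be the informed vertices in the order of their discovery, \<open>\<kappa>\<^sub>i\<close> the
  offspring number of \<open>v\<^sub>i\<close> and \<open>\<Delta>\<^sub>i\<close> the coupon collector's waiting times. The queue of waiting
  vertices becomes empty after the first \<open>I\<close> with
  \<open>D\<^sub>I = (\<kappa>\<^sub>1 - \<Delta>\<^sub>1) + \<dots> + (\<kappa>\<^sub>I - \<Delta>\<^sub>I) < 0\<close>; then \<open>I\<close> servers are informed and the duration is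
  \<open>\<kappa>\<^sub>1 + \<dots> + \<kappa>\<^sub>I\<close>. Which vertex is queried next depends only on the waiting times and on the earlier
  answers, and no vertex is queried twice, so the \<open>\<kappa>\<^sub>i\<close> are independent with law \<open>\<mu>\<close> and independent
  of the waiting times.

  The walk \<open>D\<close> has independent increments, and its mean at \<open>x n\<close> is \<open>n (x EK + ln (1 - x))\<close> up to a
  bounded error, a concave function vanishing at \<open>0\<close> and at \<open>p\<close>. By the Hajek-Renyi inequality a walk
  that stays nonnegative for a long initial stretch hits the negative half line only within a window of
  size \<open>sqrt n\<close> around \<open>p n\<close>, where \<open>D\<close> and \<open>\<kappa>\<^sub>1 + \<dots> + \<kappa>\<^sub>i\<close> are affine up to \<open>o(sqrt n)\<close>. Hence \<open>I\<close>
  and the duration are, up to \<open>o(sqrt n)\<close>, linear functions of the centred sums at \<open>p n\<close>, to which the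
  central limit theorem for triangular arrays applies.

  For fixed \<open>A\<close>, no waiting time with index up to \<open>A\<close> exceeds \<open>1\<close> with probability tending to \<open>1\<close>,
  and then the walk is nonnegative up to \<open>A\<close> iff the tree has more than \<open>A\<close> vertices. So survival is
  approximated by an event of the first \<open>A\<close> increments, which are independent of the later ones and do
  not contribute to the limit.
\<close>

section \<open>Exploration of a fixed tree\<close>

text \<open>The order of limits shapes the proof: \<open>n\<close> tends to infinity for a fixed
  \<open>A\<close>, and \<open>A\<close> grows afterwards, so every estimate for the start must be
  uniform in \<open>n\<close>. A maximal inequality with one constant threshold would only confine
  the noise to order \<open>sqrt n\<close>, which exceeds the drift at all indices below that order.
  Thresholds proportional to the index match the drift and cost the sum of \<open>1 / i^2\<close>
  beyond \<open>A\<close>, about \<open>1 / A\<close>, whatever \<open>n\<close> is. Survival itself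
  is not a function of the walk: a failed query loses a vertex together with its whole subtree, so
  the exploration sees only part of the tree. The two are therefore compared on the first few
  vertices alone, where failures are improbable. All estimates and limits are obtained under the
  discrete law \<open>walk_pmf\<close>, where independence is explicit. The given probability space
  is needed for path identities, for measurability, and for the transfer through
  \<open>obs_law\<close>.\<close>

lemma coupon_time_1 [simp]: "coupon_time d (Suc 0) = 0"
  by (simp add: coupon_time_def)

lemma coupon_time_Suc: "1 \<le> i \<Longrightarrow> coupon_time d (Suc i) = coupon_time d i + d i"
  by (simp add: coupon_time_def sum.op_ivl_Suc)

lemma coupon_time_mono: "i \<le> j \<Longrightarrow> coupon_time d i \<le> coupon_time d j"
  unfolding coupon_time_def by (intro sum_mono2) auto

section \<open>Coupon times and their counting path, for one realisation\<close>

locale waiting_times =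
  fixes n :: nat and d :: "nat \<Rightarrow> nat"
  assumes n_pos: "1 \<le> n" and d_pos: "\<And>i. 1 \<le> i \<Longrightarrow> i < n \<Longrightarrow> 1 \<le> d i"
begin

abbreviation "T \<equiv> coupon_time d"
abbreviation "N \<equiv> coupon_count n d"

lemma T_less:
  assumes "1 \<le> i" "i < j" "j \<le> n"
  shows "T i < T j"
proof -
  have "T i < T (Suc i)"
    using assms d_pos[of i] by (simp add: coupon_time_Suc)
  also have "\<dots> \<le> T j"
    using assms by (intro coupon_time_mono) auto
  finally show ?thesis .
qed

lemma count_eq_card: "N t = card {i\<in>{1..n}. T i \<le> t}"
proof -
  have "{1..n} \<inter> {i. T i \<le> t} = {i\<in>{1..n}. T i \<le> t}" by blast
  then show ?thesis
    unfolding coupon_count_def by (simp add: sum.If_cases del: Int_Collect)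
qed

text \<open>For \<open>j = n\<close> no further coupon exists and the count stays at
  \<open>n\<close> for good; hence the upper bound on \<open>t\<close> is asked for only when
  \<open>j < n\<close>.\<close>

lemma count_eq:
  assumes "1 \<le> j" "j \<le> n" "T j \<le> t" "j < n \<Longrightarrow> t < T (Suc j)"
  shows "N t = j"
proof -
  have "{i\<in>{1..n}. T i \<le> t} = {1..j}"
  proof (intro equalityI subsetI)
    fix i assume i: "i \<in> {i\<in>{1..n}. T i \<le> t}"
    have "i \<le> j"
    proof (rule ccontr)
      assume "\<not> i \<le> j"
      then have "T (Suc j) \<le> T i" by (intro coupon_time_mono) auto
      moreover have "t < T (Suc j)"
        using i assms \<open>\<not> i \<le> j\<close> by auto
      ultimately show False using i by auto
    qed
    then show "i \<in> {1..j}" using i by auto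
  next
    fix i assume "i \<in> {1..j}"
    then show "i \<in> {i\<in>{1..n}. T i \<le> t}"
      using assms coupon_time_mono[of i j d] by auto
  qed
  then show ?thesis by (simp add: count_eq_card)
qed

lemma count_ex:
  "\<exists>j. 1 \<le> j \<and> j \<le> n \<and> T j \<le> t \<and> (j < n \<longrightarrow> t < T (Suc j)) \<and> N t = j"
proof -
  define A where "A = {i\<in>{1..n}. T i \<le> t}"
  define j where "j = Max A"
  have "1 \<in> A"
    using n_pos by (simp add: A_def)
  moreover have "finite A" by (simp add: A_def)
  ultimately have "j \<in> A"
    unfolding j_def by (intro Max_in) auto
  then have 1: "1 \<le> j" "j \<le> n" "T j \<le> t" by (simp_all add: A_def)
  have 2: "t < T (Suc j)" if "j < n"
  proof (rule ccontr)
    assume "\<not> t < T (Suc j)"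
    then have "Suc j \<in> A" using that by (simp add: A_def)
    then have "Suc j \<le> j"
      unfolding j_def using \<open>finite A\<close> by (intro Max_ge)
    then show False by simp
  qed
  have 3: "N t = j" using 1 2 by (rule count_eq)
  show ?thesis using 1 2 3 by blast
qed

lemma count_cases:
  obtains j where "1 \<le> j" "j \<le> n" "T j \<le> t" "j < n \<longrightarrow> t < T (Suc j)" "N t = j"
  using count_ex[of t] by blast

lemma count_bounds: "1 \<le> N t" "N t \<le> n" "T (N t) \<le> t"
  using count_ex[of t] by auto

text \<open>The first coupon time is 0, which matches the root being informed at time 0. So the root
  is vertex number 1, and \<open>N t\<close> is the number of informed vertices as long as the queue
  is alive.\<close>

lemma count_0: "N 0 = 1"
  using n_pos T_less[of 1 2] by (intro count_eq) (auto simp: numeral_2_eq_2)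

lemma count_le_iff:
  assumes "1 \<le> j" "j < n" 
  shows "N t \<le> j \<longleftrightarrow> t < T (Suc j)"
proof (cases rule: count_cases[of t])
  case (1 i)
  show ?thesis
  proof
    assume "N t \<le> j"
    then have "t < T (Suc i)" "T (Suc i) \<le> T (Suc j)"
      using 1 assms by (auto intro: coupon_time_mono)
    then show "t < T (Suc j)" by simp
  next
    assume *: "t < T (Suc j)"
    show "N t \<le> j"
    proof (rule ccontr)
      assume "\<not> N t \<le> j"
      then have "T (Suc j) \<le> T i" using 1 by (intro coupon_time_mono) auto
      then show False using * 1 by simp
    qed
  qed
qed

text \<open>Coupon times increase strictly, so the count moves by at most one per time unit.\<close>

lemma count_step: 
  obtains "N (Suc t) = N t" 
  | "N (Suc t) = Suc (N t)" "N t < n" "T (Suc (N t)) = Suc t"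
proof (cases rule: count_cases[of t])
  case (1 j)
  show ?thesis
  proof (cases "j < n \<and> T (Suc j) = Suc t")
    case True
    then have "N (Suc t) = Suc j"
      using 1 T_less[of "Suc j" "Suc (Suc j)"] by (intro count_eq) auto
    then show ?thesis using 1 True that(2) by auto
  next
    case False
    then have "N (Suc t) = j"
      using 1 by (intro count_eq) auto
    then show ?thesis using 1 that(1) by auto
  qed
qed

lemma count_jump_time: 
  assumes "1 \<le> j" "j < n" 
  shows "N (T (Suc j) - 1) = j" "1 \<le> T (Suc j)"
proof -
  have *: "T j < T (Suc j)" using assms by (intro T_less) auto
  show "N (T (Suc j) - 1) = j" using assms * by (intro count_eq) auto
  show "1 \<le> T (Suc j)" using * by simp
qed

end

section \<open>The queue order and a single transmission step\<close>

lemma smallest_word_in: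
  assumes "finite B" "B \<noteq> {}"
  shows "smallest_word B \<in> B"
proof -
  have wf: "wf (lenlex less_than)" by (rule wf_lenlex) simp
  have tot: "total (lenlex less_than)" by (rule total_lenlex) simp
  \<comment> \<open>Well-foundedness of \<open>lenlex\<close> gives a minimal element; totality
    makes it the strict least one, hence the only candidate for the description operator.\<close>
  obtain v where v: "v \<in> B" "\<And>w. (w, v) \<in> lenlex less_than \<Longrightarrow> w \<notin> B"
    using wf assms unfolding wf_eq_minimal by (metis ex_in_conv)
  have v': "(v, w) \<in> lenlex less_than" if "w \<in> B" "w \<noteq> v" for w
    using tot v that unfolding total_on_def by blast
  have "smallest_word B = v"
    unfolding smallest_word_def
  proof (rule the_equality)
    show "v \<in> B \<and> (\<forall>w\<in>B. w \<noteq> v \<longrightarrow> (v, w) \<in> lenlex less_than)"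
      by (intro conjI ballI impI v(1) v')
    fix u assume u: "u \<in> B \<and> (\<forall>w\<in>B. w \<noteq> u \<longrightarrow> (u, w) \<in> lenlex less_than)"
    show "u = v"
    proof (rule ccontr)
      assume "u \<noteq> v"
      then have "(u, v) \<in> lenlex less_than"
        using u[THEN conjunct2, THEN bspec, OF v(1)] by simp
      from v(2)[OF this] u show False by simp
    qed
  qed
  then show ?thesis using v by simp
qed

lemma gw_tree_words: "gw_tree k \<subseteq> words"
  by (auto simp: gw_tree_def)

lemma Nil_in_gw_tree [simp]: "[] \<in> gw_tree k"
  by (simp add: gw_tree_def words_def)

lemma gw_tree_snoc: "v @ [j] \<in> gw_tree k \<longleftrightarrow> v \<in> gw_tree k \<and> 1 \<le> j \<and> j \<le> k v"
  by (auto simp: gw_tree_def words_def nth_append less_Suc_eq)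

text \<open>Writing the initial queue as the children of the root lets time 0 follow the pattern of
  a successful query of the root.\<close>

lemma gw_tree_generation_1: "{w \<in> gw_tree k. length w = 1} = {[] @ [j] |j. 1 \<le> j \<and> j \<le> k []}"
proof (rule set_eqI)
  fix w
  show "w \<in> {w \<in> gw_tree k. length w = 1} \<longleftrightarrow> w \<in> {[] @ [j] |j. 1 \<le> j \<and> j \<le> k []}"
    unfolding mem_Collect_eq length_Suc_conv length_0_conv One_nat_def
    using gw_tree_snoc[of "[]" _ k] by (metis Nil_in_gw_tree append_Nil One_nat_def)
qed

abbreviation "exploring k N t \<equiv> snd (transmission k N t)"
abbreviation "explored k N t \<equiv> fst (transmission k N t)"

lemma children_card: "card {v @ [j] |j. 1 \<le> j \<and> j \<le> (m::nat)} = m" 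
  and children_finite: "finite {v @ [j] |j. 1 \<le> j \<and> j \<le> m}"
proof -
  have *: "{v @ [j] |j. 1 \<le> j \<and> j \<le> m} = (\<lambda>j. v @ [j]) ` {1..m}"
    unfolding image_def Bex_def atLeastAtMost_iff by blast
  show "card {v @ [j] |j. 1 \<le> j \<and> j \<le> m} = m"
    unfolding * by (simp add: card_image inj_on_def)
  show "finite {v @ [j] |j. 1 \<le> j \<and> j \<le> m}"
    unfolding * by simp
qed

lemma transmission_0 [simp]:
  "explored k N 0 = {[]}" "exploring k N 0 = {[] @ [j] |j. 1 \<le> j \<and> j \<le> k []}"
  unfolding transmission.simps(1) gw_tree_generation_1 by (rule fst_conv snd_conv)+

lemma transmission_dead: "exploring k N t = {} \<Longrightarrow> transmission k N (Suc t) = transmission k N t"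
  by (cases "transmission k N t") (simp add: Let_def)

lemma transmission_jump:
  "exploring k N t \<noteq> {} \<Longrightarrow> N (Suc t) = Suc (N t) \<Longrightarrow> v = smallest_word (exploring k N t) \<Longrightarrow>
    explored k N (Suc t) = explored k N t \<union> {v} \<and>
    exploring k N (Suc t) = (exploring k N t - {v}) \<union> {v @ [j] |j. 1 \<le> j \<and> j \<le> k v}"
  by (simp add: case_prod_beta Let_def)

lemma transmission_fail:
  "exploring k N t \<noteq> {} \<Longrightarrow> N (Suc t) \<noteq> Suc (N t) \<Longrightarrow> v = smallest_word (exploring k N t) \<Longrightarrow>
    explored k N (Suc t) = explored k N t \<and> exploring k N (Suc t) = exploring k N t - {v}"
  by (simp add: case_prod_beta Let_def)

declare transmission.simps [simp del]

text \<open>Finiteness of the queue is carried along by induction, so that the word selected is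
  known to belong to it.\<close>

lemma transmission_cases:
  obtains (dead) "exploring k N t = {}" "transmission k N (Suc t) = transmission k N t"
  | (jump) v where "v \<in> exploring k N t" "v = smallest_word (exploring k N t)" "N (Suc t) = Suc (N t)"
      "explored k N (Suc t) = explored k N t \<union> {v}"
      "exploring k N (Suc t) = (exploring k N t - {v}) \<union> {v @ [j] |j. 1 \<le> j \<and> j \<le> k v}"
  | (fail) v where "v \<in> exploring k N t" "v = smallest_word (exploring k N t)" "N (Suc t) \<noteq> Suc (N t)"
      "explored k N (Suc t) = explored k N t"
      "exploring k N (Suc t) = exploring k N t - {v}"
proof -
  have fin: "finite (exploring k N t)" for t
  proof (induction t)
    case (Suc t)
    consider "exploring k N t = {}" | "exploring k N t \<noteq> {}" "N (Suc t) = Suc (N t)"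
      | "exploring k N t \<noteq> {}" "N (Suc t) \<noteq> Suc (N t)" by blast
    then show ?case
    proof cases
      case 1
      then show ?thesis by (simp only: transmission_dead finite.emptyI)
    next
      case 2
      then have "exploring k N (Suc t) = (exploring k N t - {smallest_word (exploring k N t)}) \<union>
          {smallest_word (exploring k N t) @ [j] |j. 1 \<le> j \<and> j \<le> k (smallest_word (exploring k N t))}"
        using transmission_jump[where N = N, OF 2 refl] by blast
      then show ?thesis using Suc by (simp only: finite_Un finite_Diff children_finite)
    next
      case 3
      then have "exploring k N (Suc t) = exploring k N t - {smallest_word (exploring k N t)}"
        using transmission_fail[where N = N, OF 3 refl] by blast
      then show ?thesis using Suc by (simp only: finite_Diff)
    qed
  qed (simp only: transmission_0 children_finite)
  show ?thesis
  proof (cases "exploring k N t = {}")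
    case True
    then show ?thesis using dead transmission_dead by blast
  next
    case False
    note v = smallest_word_in[OF fin False]
    show ?thesis
    proof (cases "N (Suc t) = Suc (N t)")
      case True
      then show ?thesis
        using jump[OF v refl] transmission_jump[OF False True refl] by blast
    next
      case *: False
      then show ?thesis
        using fail[OF v refl] transmission_fail[where N = N, OF False * refl] by blast
    qed
  qed
qed

section \<open>Invariants of the informed set and the queue\<close>

abbreviation "children k v \<equiv> {v @ [j] |j. 1 \<le> j \<and> j \<le> (k v :: nat)}"

lemma children_gw_tree:
  assumes "v \<in> gw_tree k" "w \<in> children k v"
  shows "w \<in> gw_tree k" "w \<noteq> []" "butlast w = v" "w \<noteq> v" "length w = Suc (length v)"
proof -
  obtain j where j: "w = v @ [j]" "1 \<le> j" "j \<le> k v" using assms(2) by blast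
  show "w \<in> gw_tree k" unfolding j(1) gw_tree_snoc using j assms(1) by blast
  show "w \<noteq> []" "butlast w = v" "w \<noteq> v" "length w = Suc (length v)" by (simp_all add: j(1))
qed

text \<open>Informed parents of all informed and waiting vertices are what makes the children of a
  newly informed vertex new.\<close>

definition transmission_inv :: "(nat list \<Rightarrow> nat) \<Rightarrow> nat list set \<Rightarrow> nat list set \<Rightarrow> bool" where
  "transmission_inv k C B \<longleftrightarrow>
    finite C \<and> finite B \<and> C \<inter> B = {} \<and> [] \<in> C \<and> C \<union> B \<subseteq> gw_tree k \<and>
    (\<forall>w\<in>B. w \<noteq> [] \<and> butlast w \<in> C) \<and> (\<forall>w\<in>C. w \<noteq> [] \<longrightarrow> butlast w \<in> C)"

text \<open>A child of \<open>v\<close> that was already waiting or informed would have an informed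
  parent, whereas \<open>v\<close> is still waiting. So no child is counted twice and the queue
  gains exactly \<open>k v\<close> vertices for the one removed.\<close>

lemma transmission_inv_jump:
  assumes I: "transmission_inv k C B" and v: "v \<in> B"
  shows "transmission_inv k (C \<union> {v}) ((B - {v}) \<union> children k v)" "B \<inter> children k v = {}"
proof -
  have vt: "v \<in> gw_tree k" "v \<notin> C" "v \<noteq> []" "butlast v \<in> C"
    using I v unfolding transmission_inv_def by blast+
  note ch = children_gw_tree[OF vt(1)]
  have new: "w \<notin> C \<union> {v}" "w \<notin> B" if w: "w \<in> children k v" for w
    using I vt(2) ch(2-4)[OF w] unfolding transmission_inv_def by blast+
  show "B \<inter> children k v = {}" using new(2) by blast
  show "transmission_inv k (C \<union> {v}) ((B - {v}) \<union> children k v)"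
    unfolding transmission_inv_def
  proof (intro conjI ballI)
    show "finite (C \<union> {v})" using I unfolding transmission_inv_def by blast
    show "finite ((B - {v}) \<union> children k v)"
      using I children_finite[of v "k v"] unfolding transmission_inv_def by blast
    show "(C \<union> {v}) \<inter> ((B - {v}) \<union> children k v) = {}"
      using I new(1) unfolding transmission_inv_def disjoint_iff by auto
    show "[] \<in> C \<union> {v}" using I unfolding transmission_inv_def by blast
    show "C \<union> {v} \<union> ((B - {v}) \<union> children k v) \<subseteq> gw_tree k"
      using I vt(1) ch(1) unfolding transmission_inv_def subset_iff by auto
    fix w assume w: "w \<in> (B - {v}) \<union> children k v"
    show "w \<noteq> []" using w I ch(2) unfolding transmission_inv_def by blast
    have "butlast w \<in> C" if "w \<in> B" using that I unfolding transmission_inv_def by simp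
    then show "butlast w \<in> C \<union> {v}" using w ch(3)[of w] by auto
  next
    fix w assume "w \<in> C \<union> {v}"
    then show "w \<noteq> [] \<longrightarrow> butlast w \<in> C \<union> {v}"
      using I vt(4) unfolding transmission_inv_def by blast
  qed
qed

lemma transmission_inv_fail: "transmission_inv k C B \<Longrightarrow> transmission_inv k C (B - {v})"
  unfolding transmission_inv_def by auto

lemma transmission_invariant: "transmission_inv k (explored k N t) (exploring k N t)"
proof (induction t)
  case 0
  note ch = children_gw_tree[of "[]" k, OF Nil_in_gw_tree]
  show ?case
    unfolding transmission_0 transmission_inv_def
  proof (intro conjI ballI)
    show "finite {[] @ [j] |j. 1 \<le> j \<and> j \<le> k []}" by (rule children_finite)
    show "{[]} \<inter> children k [] = {}" using ch(2) by auto
    show "{[]} \<union> children k [] \<subseteq> gw_tree k" using ch(1) Nil_in_gw_tree by blast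
  next
    fix w assume "w \<in> children k []"
    then show "w \<noteq> []" "butlast w \<in> {[]}" using ch(2,3) by auto
  qed auto
next
  case (Suc t)
  show ?case
  proof (cases rule: transmission_cases[of k N t])
    case dead
    then show ?thesis using Suc by simp
  next
    case (jump v)
    show ?thesis unfolding jump(4,5) by (rule transmission_inv_jump(1)[OF Suc.IH jump(1)])
  next
    case (fail v)
    show ?thesis unfolding fail(4,5) by (rule transmission_inv_fail[OF Suc.IH])
  qed
qed

lemma exploring_alive_before:
  assumes "exploring k N t \<noteq> {}" "s \<le> t"
  shows "exploring k N s \<noteq> {}"
proof
  assume dead: "exploring k N s = {}"
  have "transmission k N (s + u) = transmission k N s" for u
  proof (induction u)
    case (Suc u)
    then show ?case using transmission_dead[of k N "s + u"] dead by simp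
  qed simp
  from this[of "t - s"] show False using assms dead by simp
qed

text \<open>The \<open>j\<close>-th informed vertex. Once the queue is empty, or if the waiting times are degenerate, the
  queries go on with unused words, so that there are always \<open>n\<close> of them: the \<open>i\<close>-th query has length
  less than \<open>i\<close>, hence a word of length \<open>j - 1\<close> differs from all queries before the \<open>j\<close>-th.\<close>

definition query :: "nat \<Rightarrow> (nat \<Rightarrow> nat) \<Rightarrow> (nat list \<Rightarrow> nat) \<Rightarrow> nat \<Rightarrow> nat list" where
  "query n d k j =
    (let B = exploring k (coupon_count n d) (coupon_time d j - 1) in
      if j = 1 then []
      else if (\<forall>i\<in>{1..<n}. 1 \<le> d i) \<and> B \<noteq> {} then smallest_word B
      else replicate (j - 1) 1)"

lemma query_1 [simp]: "query n d k (Suc 0) = []"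
  by (simp add: query_def)

lemma query_degenerate: 
  assumes "\<not> (\<forall>i\<in>{1..<n}. 1 \<le> d i)"
  shows "query n d k j = replicate (j - 1) 1"
  unfolding query_def Let_def using assms by auto

section \<open>Bookkeeping, distinctness and adaptedness of the queries\<close>

context waiting_times
begin

abbreviation "q \<equiv> query n d"

lemma query_eq:
  assumes "1 < j"
  shows "q k j = (let B = exploring k N (T j - 1) in if B \<noteq> {} then smallest_word B else replicate (j - 1) 1)"
proof -
  have "\<forall>i\<in>{1..<n}. 1 \<le> d i" using d_pos by simp
  then show ?thesis unfolding query_def Let_def using assms by simp
qed

lemma alive_state:
  assumes "\<And>s. s < t \<Longrightarrow> exploring k N s \<noteq> {}"
  shows "explored k N t = q k ` {1..N t} \<and>
    card (exploring k N t) + t = (\<Sum>j\<in>{1..N t}. k (q k j)) \<and>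
    (\<forall>w\<in>exploring k N t. length w \<le> N t)"
  using assms
proof (induction t)
  case 0
  have "length w \<le> 1" if "w \<in> children k []" for w
    using that by auto
  then show ?case 
    using children_card[of "[]" "k []"] unfolding transmission_0 count_0 by simp
next
  case (Suc t)
  have IH: "explored k N t = q k ` {1..N t}" 
    "card (exploring k N t) + t = (\<Sum>j\<in>{1..N t}. k (q k j))"
    "\<forall>w\<in>exploring k N t. length w \<le> N t"
    using Suc by simp_all
  have alive: "exploring k N t \<noteq> {}" using Suc.prems by simp
  note inv = transmission_invariant[of k N t]
  have fin: "finite (exploring k N t)" using inv by (simp add: transmission_inv_def)
  show ?case
  proof (cases rule: transmission_cases[of k N t])
    case dead
    then show ?thesis using alive by simp
  next
    case (jump v)
    \<comment> \<open>A jump at \<open>Suc t\<close> is the coupon time with index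
      \<open>Suc (N t)\<close>, and \<open>query\<close> looks at the queue one unit earlier, which
      is the present state.\<close>
    have t: "T (Suc (N t)) = Suc t" using count_step[of t] jump(3) by auto
    have v: "v = q k (Suc (N t))"
      unfolding jump(2) using alive count_bounds(1)[of t] by (subst query_eq) (simp_all add: t)
    have disj: "exploring k N t \<inter> children k v = {}"
      by (rule transmission_inv_jump(2)[OF inv jump(1)])
    have I: "{1..N (Suc t)} = insert (Suc (N t)) {1..N t}" using jump(3) by auto
    have "card (exploring k N t - {v} \<union> children k v) = card (exploring k N t - {v}) + k v"
      using fin disj children_finite[of v "k v"] children_card[of v "k v"]
      by (subst card_Un_disjoint) auto
    also have "card (exploring k N t - {v}) = card (exploring k N t) - 1"
      using jump(1) by simp
    finally have "card (exploring k N (Suc t)) + 1 = card (exploring k N t) + k v"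
      using jump(1) fin card_gt_0_iff[of "exploring k N t"] unfolding jump(5) by auto
    then have 2: "card (exploring k N (Suc t)) + Suc t = (\<Sum>j\<in>{1..N (Suc t)}. k (q k j))"
      unfolding I using IH(2) v by simp
    have "length v \<le> N t" using IH(3) jump(1) by blast
    moreover have "length w \<le> Suc (length v)" if "w \<in> children k v" for w
      using that by auto
    ultimately have 3: "\<forall>w\<in>exploring k N (Suc t). length w \<le> N (Suc t)"
      using IH(3) unfolding jump(3,5) by force
    have 1: "explored k N (Suc t) = q k ` {1..N (Suc t)}"
      unfolding I jump(4) IH(1) v by simp
    show ?thesis using 1 2 3 by blast
  next
    case (fail v)
    have "N (Suc t) = N t" using count_step[of t] fail(3) by auto
    moreover have "card (exploring k N (Suc t)) + 1 = card (exploring k N t)"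
      using fail(1) fin card_gt_0_iff[of "exploring k N t"] unfolding fail(5) by auto
    moreover have "\<forall>w\<in>exploring k N (Suc t). length w \<le> N t"
      using IH(3) unfolding fail(5) by simp
    ultimately show ?thesis using IH fail(4) by simp
  qed
qed

lemma query_cases:
  assumes "1 < j" "j \<le> n"
  obtains (alive) "q k j \<in> exploring k N (T j - 1)" "\<And>s. s \<le> T j - 1 \<Longrightarrow> exploring k N s \<noteq> {}"
      "N (T j - 1) = j - 1"
  | (dead) "exploring k N (T j - 1) = {}" "q k j = replicate (j - 1) 1"
proof (cases "exploring k N (T j - 1) = {}")
  case True
  then show ?thesis using dead assms by (simp add: query_eq)
next
  case False
  have fin: "finite (exploring k N (T j - 1))"
    using transmission_invariant[of k N "T j - 1"] by (simp add: transmission_inv_def)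
  have "q k j \<in> exploring k N (T j - 1)"
    using False assms smallest_word_in[OF fin False] by (simp add: query_eq)
  moreover have "N (T j - 1) = j - 1"
    using count_jump_time(1)[of "j - 1"] assms by simp
  ultimately show ?thesis using alive exploring_alive_before[OF False] by blast
qed

lemma query_length:
  assumes "1 \<le> j" "j \<le> n"
  shows "length (q k j) \<le> j - 1"
proof (cases "j = 1")
  case False
  with assms have j: "1 < j" "j \<le> n" by auto
  show ?thesis
  proof (rule query_cases[OF j, of k], goal_cases alive dead)
    case alive
    then show ?thesis using alive_state[of "T j - 1" k] by auto
  next
    case dead
    then show ?thesis by simp
  qed
qed simp

text \<open>A genuine query comes from the queue, which is disjoint from the informed set containing
  all earlier queries; a substitute word is longer than every earlier query.\<close>

lemma query_distinct:
  assumes "1 \<le> i" "i < j" "j \<le> n"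
  shows "q k j \<noteq> q k i"
proof -
  have j: "1 < j" "j \<le> n" using assms by auto
  show ?thesis
  proof (rule query_cases[OF j, of k], goal_cases alive dead)
    case alive
    have "q k i \<in> explored k N (T j - 1)"
      using alive_state[of "T j - 1" k] alive assms by auto
    moreover have "explored k N (T j - 1) \<inter> exploring k N (T j - 1) = {}"
      using transmission_invariant[of k N "T j - 1"] by (simp add: transmission_inv_def)
    ultimately show ?thesis using alive(1) by auto
  next
    case dead
    have "length (q k i) < length (q k j)"
      using dead query_length[of i k] assms by simp
    then show ?thesis by auto
  qed
qed

lemma query_inj: "inj_on (q k) {1..n}"
proof (rule inj_onI, rule ccontr)
  fix i j assume *: "i \<in> {1..n}" "j \<in> {1..n}" "q k i = q k j" "i \<noteq> j"
  then consider "i < j" | "j < i" by linarith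
  then show False
    using query_distinct[of i j k] query_distinct[of j i k] * by cases auto
qed

lemma query_words:
  assumes "1 \<le> j" "j \<le> n"
  shows "q k j \<in> words"
proof (cases "j = 1")
  case False
  with assms have j: "1 < j" "j \<le> n" by auto
  show ?thesis
  proof (rule query_cases[OF j, of k], goal_cases alive dead)
    case alive
    have "q k j \<in> gw_tree k"
      using alive(1) transmission_invariant[of k N "T j - 1"] by (auto simp: transmission_inv_def)
    then show ?thesis using gw_tree_words by blast
  next
    case dead
    then show ?thesis by (simp add: words_def)
  qed
qed (simp add: words_def)

text \<open>Adaptedness: until the next coupon time the process has read the offspring numbers at
  the first \<open>j\<close> queries only.\<close>

lemma transmission_cong:
  assumes "1 \<le> j" "j < n"
    and "\<And>i. 1 \<le> i \<Longrightarrow> i \<le> j \<Longrightarrow> q k i = q k' i \<and> k (q k i) = k' (q k i)"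
  shows "t < T (Suc j) \<Longrightarrow> transmission k N t = transmission k' N t"
proof (induction t)
  case 0
  have "k [] = k' []" using assms(1) assms(3)[of 1] by simp
  then have "explored k N 0 = explored k' N 0" "exploring k N 0 = exploring k' N 0"
    unfolding transmission_0 by simp_all
  then show ?case by (rule prod_eqI)
next
  case (Suc t)
  then have IH: "transmission k N t = transmission k' N t" by simp
  have le: "N (Suc t) \<le> j" using Suc.prems assms count_le_iff by blast
  show ?case
  proof (cases rule: transmission_cases[of k N t])
    case dead
    then show ?thesis using transmission_dead[of k' N t] IH by simp
  next
    case (jump v)
    have t: "T (Suc (N t)) = Suc t" using count_step[of t] jump(3) by auto
    have v: "v = q k (Suc (N t))"
      unfolding jump(2) using jump(1) count_bounds(1)[of t] by (subst query_eq) (auto simp: t Let_def)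
    have Nt: "Suc (N t) \<le> j" using le jump(3) by simp
    have kv: "k v = k' v" unfolding v by (rule assms(3)[OF _ Nt, THEN conjunct2]) simp
    have ne: "exploring k' N t \<noteq> {}" using jump(1) IH by auto
    have v': "v = smallest_word (exploring k' N t)" using jump(2) IH by simp
    have "explored k N (Suc t) = explored k' N (Suc t)" "exploring k N (Suc t) = exploring k' N (Suc t)"
      using transmission_jump[where N = N, OF ne jump(3) v'] unfolding jump(4,5) IH kv by simp_all
    then show ?thesis by (rule prod_eqI)
  next
    case (fail v)
    have ne: "exploring k' N t \<noteq> {}" using fail(1) IH by auto
    have v': "v = smallest_word (exploring k' N t)" using fail(2) IH by simp
    have "explored k N (Suc t) = explored k' N (Suc t)" "exploring k N (Suc t) = exploring k' N (Suc t)"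
      using transmission_fail[where N = N, OF ne fail(3) v'] unfolding fail(4,5) IH by simp_all
    then show ?thesis by (rule prod_eqI)
  qed
qed

lemma query_cong:
  assumes "1 \<le> j" "j \<le> n"
    and "\<And>i. 1 \<le> i \<Longrightarrow> i < j \<Longrightarrow> q k i = q k' i \<and> k (q k i) = k' (q k i)"
  shows "q k j = q k' j"
proof (cases "j = 1")
  case False
  then obtain i where j: "j = Suc i" "1 \<le> i" "i < n" using assms by (cases j) auto
  have "transmission k N (T j - 1) = transmission k' N (T j - 1)"
    unfolding j(1)
  proof (rule transmission_cong[OF j(2,3)])
    show "q k l = q k' l \<and> k (q k l) = k' (q k l)" if "1 \<le> l" "l \<le> i" for l
    proof -
      have "l < j" using that j by simp
      from assms(3)[OF that(1) this] show ?thesis .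
    qed
    show "T (Suc i) - 1 < T (Suc i)" using count_jump_time(2)[OF j(2,3)] by simp
  qed
  then show ?thesis using j by (simp add: query_eq)
qed simp

lemma exploration_alive:
  assumes "1 \<le> j" "j \<le> n" "t \<le> T j"
    and S: "\<And>i. 1 \<le> i \<Longrightarrow> i < j \<Longrightarrow> T (Suc i) \<le> (\<Sum>l\<in>{1..i}. k (q k l))"
    and "s < t"
  shows "exploring k N s \<noteq> {}"
  using \<open>s < t\<close>
proof (induction s rule: less_induct)
  case (less s)
  have alive: "exploring k N u \<noteq> {}" if "u < s" for u
    using less that by simp
  obtain i where i: "1 \<le> i" "i \<le> n" "T i \<le> s" "i < n \<longrightarrow> s < T (Suc i)" "N s = i"
    using count_cases[of s] by blast
  have "i < j"
  proof (rule ccontr)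
    assume "\<not> i < j"
    then have "T j \<le> T i" by (intro coupon_time_mono) simp
    then show False using i less.prems assms by simp
  qed
  \<comment> \<open>With \<open>i\<close> vertices informed, the queue length at time
    \<open>s\<close> is the offspring sum minus \<open>s\<close>; it is positive because
    \<open>s\<close> lies before the next coupon time.\<close>
  then have "s < T (Suc i)" "T (Suc i) \<le> (\<Sum>l\<in>{1..i}. k (q k l))"
    using i S assms by auto
  moreover have "card (exploring k N s) + s = (\<Sum>l\<in>{1..i}. k (q k l))"
    using alive_state[of s k, OF alive] i(5) by blast
  ultimately have "card (exploring k N s) \<noteq> 0" by linarith
  then show ?case by auto
qed

text \<open>From \<open>T j\<close> until the next coupon time the queue only loses vertices, one
  per time unit. If the total offspring is smaller than \<open>T (Suc j)\<close>, the queue is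
  exhausted exactly at the time equal to this total, with \<open>j\<close> vertices
  informed.\<close>

lemma exploration_dies:
  assumes j: "1 \<le> j" "j < n"
    and S: "\<And>i. 1 \<le> i \<Longrightarrow> i < j \<Longrightarrow> T (Suc i) \<le> (\<Sum>l\<in>{1..i}. k (q k l))"
    and D: "(\<Sum>l\<in>{1..j}. k (q k l)) < T (Suc j)"
  shows "duration k N = (\<Sum>l\<in>{1..j}. k (q k l))"
    and "N (\<Sum>l\<in>{1..j}. k (q k l)) = j" and "explored k N (\<Sum>l\<in>{1..j}. k (q k l)) = q k ` {1..j}" and "exploring k N (\<Sum>l\<in>{1..j}. k (q k l)) = {}"
proof -
  let ?S = "\<lambda>j. (\<Sum>l\<in>{1..j}. k (q k l))"
  \<comment> \<open>The total is not reached before the coupon time with index \<open>j\<close>,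
    because stage \<open>j - 1\<close> was survived; for \<open>j = 1\<close> that time is
    0.\<close>
  have Tj: "T j \<le> ?S j"
  proof (cases "j = 1")
    case False
    then obtain i where i: "j = Suc i" "1 \<le> i" using j by (cases j) auto
    then have "T j \<le> ?S i" using S[of i] by simp
    also have "\<dots> \<le> ?S j" using i by simp
    finally show ?thesis .
  qed simp
  have N: "N s = j" if "T j \<le> s" "s \<le> ?S j" for s
    using that D j by (intro count_eq) auto
  show NS: "N (?S j) = j" using N[OF Tj] by simp
  have alive: "exploring k N s \<noteq> {}" if "s < ?S j" for s
    using that
  proof (induction s rule: less_induct)
    case (less s)
    show ?case
    proof (cases "s < T j")
      case True
      show ?thesis using exploration_alive[OF j(1) _ order_refl S True] j by simp
    next
      case False
      have al: "exploring k N u \<noteq> {}" if "u < s" for u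
        using less that by simp
      have "card (exploring k N s) + s = ?S j"
        using alive_state[of s k, OF al] N[of s] False less.prems by simp
      then have "card (exploring k N s) \<noteq> 0" using less.prems by linarith
      then show ?thesis by auto
    qed
  qed
  note st = alive_state[of "?S j" k, OF alive, unfolded NS]
  show "explored k N (?S j) = q k ` {1..j}" using st by blast
  have "card (exploring k N (?S j)) = 0" using st by simp
  then show dead: "exploring k N (?S j) = {}"
    using transmission_invariant[of k N "?S j"] by (simp add: transmission_inv_def)
  show "duration k N = ?S j"
    unfolding duration_def using dead alive by (intro Least_equality) (auto simp: not_less[symmetric])
qed

section \<open>Survival of the start versus size of the tree\<close>

lemma gw_tree_closed:
  assumes "[] \<in> C" and "\<And>v. v \<in> C \<Longrightarrow> children k v \<subseteq> C"
  shows "gw_tree k \<subseteq> C"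
proof
  fix w assume "w \<in> gw_tree k"
  then show "w \<in> C"
  proof (induction w rule: rev_induct)
    case (snoc j w)
    then have "w \<in> C" "w @ [j] \<in> children k w" unfolding gw_tree_snoc by auto
    then show ?case using assms(2) by blast
  qed (simp add: assms)
qed

lemma no_failure_state:
  assumes "\<And>s. s < t \<Longrightarrow> N (Suc s) = Suc (N s)" "v \<in> explored k N t"
  shows "children k v \<subseteq> explored k N t \<union> exploring k N t"
  using assms
proof (induction t arbitrary: v)
  case 0
  then show ?case by (simp only: transmission_0) auto
next
  case (Suc t)
  note IH = Suc.IH[OF Suc.prems(1)]
  show ?case
  proof (cases rule: transmission_cases[of k N t])
    case dead
    then show ?thesis using IH Suc.prems by simp
  next
    case (jump u)
    show ?thesis
    proof (cases "v = u")
      case True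
      then show ?thesis unfolding jump(4,5) by blast
    next
      case False
      then have "children k v \<subseteq> explored k N t \<union> exploring k N t"
        using IH Suc.prems(2) unfolding jump(4) by simp
      then show ?thesis unfolding jump(4,5) by blast
    qed
  next
    case (fail u)
    then show ?thesis using Suc.prems(1)[of t] by simp
  qed
qed

text \<open>Waiting times equal to 1 mean that no early query fails, so the exploration is a
  breadth-first search of the tree. If it passes index \<open>A\<close>, it has found
  \<open>Suc A\<close> distinct vertices; if it dies at an index up to \<open>A\<close>, the
  informed set is closed under children and therefore is the whole tree.\<close>

lemma survives_iff_large_tree:
  assumes A: "A < n" and d1: "\<And>i. 1 \<le> i \<Longrightarrow> i \<le> A \<Longrightarrow> d i = 1"
  shows "(\<forall>j\<in>{1..A}. T (Suc j) \<le> (\<Sum>l\<in>{1..j}. k (q k l))) \<longleftrightarrow> \<not> (finite (gw_tree k) \<and> card (gw_tree k) \<le> A)"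
proof
  assume S: "\<forall>j\<in>{1..A}. T (Suc j) \<le> (\<Sum>l\<in>{1..j}. k (q k l))"
  have alive: "exploring k N s \<noteq> {}" if "s < T (Suc A)" for s
    using that S A by (intro exploration_alive[of "Suc A" "T (Suc A)"]) auto
  have NT: "N (T (Suc A)) = Suc A"
    using A T_less[of "Suc A" "Suc (Suc A)"] by (intro count_eq) auto
  have "explored k N (T (Suc A)) = q k ` {1..Suc A}"
    using alive_state[of "T (Suc A)" k, OF alive] unfolding NT by blast
  then have *: "q k ` {1..Suc A} \<subseteq> gw_tree k"
    using transmission_invariant[of k N "T (Suc A)"] by (auto simp: transmission_inv_def)
  have c: "card (q k ` {1..Suc A}) = Suc A"
    using inj_on_subset[OF query_inj, of "{1..Suc A}"] A by (simp add: card_image)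
  show "\<not> (finite (gw_tree k) \<and> card (gw_tree k) \<le> A)"
  proof
    assume "finite (gw_tree k) \<and> card (gw_tree k) \<le> A"
    then have "Suc A \<le> A" using card_mono[OF _ *] c by simp
    then show False by simp
  qed
next
  assume large: "\<not> (finite (gw_tree k) \<and> card (gw_tree k) \<le> A)"
  show "\<forall>j\<in>{1..A}. T (Suc j) \<le> (\<Sum>l\<in>{1..j}. k (q k l))"
  proof (rule ccontr)
    assume neg: "\<not> (\<forall>j\<in>{1..A}. T (Suc j) \<le> (\<Sum>l\<in>{1..j}. k (q k l)))"
    define P where "P j \<longleftrightarrow> 1 \<le> j \<and> j \<le> A \<and> (\<Sum>l\<in>{1..j}. k (q k l)) < T (Suc j)" for j
    define j where "j = (LEAST j. P j)"
    obtain j0 where "j0 \<in> {1..A}" "(\<Sum>l\<in>{1..j0}. k (q k l)) < T (Suc j0)"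
      using neg by (metis not_le)
    then have "P j0" by (simp add: P_def)
    then have "\<exists>j. P j" ..
    then have Pj: "P j" unfolding j_def by (rule LeastI_ex)
    have min: "\<not> P i" if "i < j" for i using that unfolding j_def by (rule not_less_Least)
    have j: "1 \<le> j" "j < n" "j \<le> A" using Pj A by (auto simp: P_def)
    have S: "T (Suc i) \<le> (\<Sum>l\<in>{1..i}. k (q k l))" if "1 \<le> i" "i < j" for i
      using min[of i] that j by (auto simp: P_def)
    have D: "(\<Sum>l\<in>{1..j}. k (q k l)) < T (Suc j)" using Pj by (simp add: P_def)
    note dies = exploration_dies[OF j(1,2) S D]
    define t where "t = (\<Sum>l\<in>{1..j}. k (q k l))"
    have Ti: "T (Suc i) = i" if "i \<le> A" for i
      using that by (induction i) (simp_all add: coupon_time_Suc d1)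
    have Ns: "N s = Suc s" if "s \<le> A" for s
      using that A Ti[of s] Ti[of "Suc s"] T_less[of "Suc s" "Suc (Suc s)"] by (intro count_eq) auto
    \<comment> \<open>Here \<open>T (Suc j) = j\<close>, so the total offspring \<open>t\<close> is
      less than \<open>j\<close>, and all steps before time \<open>t\<close> are successes.\<close>
    have "t < A" using D Ti[of j] j by (simp add: t_def)
    then have jumps: "N (Suc s) = Suc (N s)" if "s < t" for s
      using Ns[of s] Ns[of "Suc s"] that by simp
    have ex: "explored k N t = q k ` {1..j}" "exploring k N t = {}"
      using dies(3,4) by (simp_all only: t_def)
    have "gw_tree k \<subseteq> explored k N t"
    proof (rule gw_tree_closed)
      show "[] \<in> explored k N t"
        using transmission_invariant[of k N t] by (simp add: transmission_inv_def)
      show "children k v \<subseteq> explored k N t" if "v \<in> explored k N t" for v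
        using no_failure_state[OF jumps that] ex(2) by simp
    qed
    then have sub: "gw_tree k \<subseteq> q k ` {1..j}" using ex(1) by simp
    then have "finite (gw_tree k)" by (rule finite_subset) simp
    moreover have "card (gw_tree k) \<le> j"
      using card_mono[OF _ sub] card_image_le[of "{1..j}" "q k"] by simp
    ultimately show False using large j by simp
  qed
qed

end

section \<open>The Hajek-Renyi inequality\<close>

lemma greaterThanAtMost_Suc: "(l::nat) \<le> m \<Longrightarrow> {l<..Suc m} = insert (Suc m) {l<..m}"
  by auto

context prob_space
begin

text \<open>Kolmogorov's inequality with nondecreasing thresholds, the classical case being a
  constant \<open>b\<close>. Growing thresholds keep the bound finite however long the range of
  indices is.\<close>

lemma hajek_renyi:
  fixes X :: "nat \<Rightarrow> 'a \<Rightarrow> real" and b V :: "nat \<Rightarrow> real"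
  assumes indep: "indep_vars (\<lambda>_. borel) X {l<..u}" and "l \<le> u"
    and sq: "\<And>i. i \<in> {l<..u} \<Longrightarrow> integrable M (\<lambda>\<omega>. (X i \<omega>)\<^sup>2)"
    and mean: "\<And>i. i \<in> {l<..u} \<Longrightarrow> expectation (X i) = 0"
    and var: "\<And>i. i \<in> {l<..u} \<Longrightarrow> expectation (\<lambda>\<omega>. (X i \<omega>)\<^sup>2) \<le> V i"
    and b_pos: "\<And>i. i \<in> {l<..u} \<Longrightarrow> 0 < b i"
    and b_mono: "\<And>i. l < i \<Longrightarrow> i < u \<Longrightarrow> b i \<le> b (Suc i)"
  shows "prob {\<omega>\<in>space M. \<exists>i\<in>{l<..u}. b i \<le> \<bar>\<Sum>j\<in>{l<..i}. X j \<omega>\<bar>} \<le> (\<Sum>i\<in>{l<..u}. V i / (b i)\<^sup>2)"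
proof -
  have rv: "random_variable borel (X i)" if "i \<in> {l<..u}" for i
    using indep that unfolding indep_vars_def2 by blast
  have X_int: "integrable M (X i)" if "i \<in> {l<..u}" for i
    using rv[OF that] sq[OF that] by (rule square_integrable_imp_integrable)
  define S where "S m \<omega> = (\<Sum>j\<in>{l<..m}. X j \<omega>)" for m \<omega>
  define bad where "bad m \<omega> \<longleftrightarrow> (\<exists>i\<in>{l<..m}. b i \<le> \<bar>S i \<omega>\<bar>)" for m \<omega>
  \<comment> \<open>Factor that switches the walk off after the first crossing. It depends on the
    increments up to \<open>m\<close> only, so \<open>g m * S m\<close> is uncorrelated with the
    next centred increment.\<close>
  define g where "g m \<omega> = (if bad m \<omega> then 0 else 1 :: real)" for m \<omega>
  have S_meas: "random_variable borel (S m)" if "m \<le> u" for m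
    unfolding S_def using that rv by (intro borel_measurable_sum) auto
  have bad_meas: "Measurable.pred M (bad m)" if "m \<le> u" for m
  proof -
    have [measurable]: "random_variable borel (S i)" if "i \<in> {l<..m}" for i
      using that \<open>m \<le> u\<close> S_meas by auto
    show ?thesis unfolding bad_def by measurable
  qed
  have g_meas: "random_variable borel (g m)" if "m \<le> u" for m
    unfolding g_def using bad_meas[OF that] by measurable
  have g01: "0 \<le> g m \<omega>" "g m \<omega> \<le> 1" for m \<omega>
    by (auto simp: g_def)
  have S_sq: "integrable M (\<lambda>\<omega>. (S m \<omega>)\<^sup>2)" if "l \<le> m" "m \<le> u" for m
    using that
  proof (induction m rule: dec_induct)
    case (step m)
    have "integrable M (\<lambda>\<omega>. 2 * (S m \<omega>)\<^sup>2 + 2 * (X (Suc m) \<omega>)\<^sup>2)"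
      using step sq[of "Suc m"] by auto
    then show ?case
    proof (rule Bochner_Integration.integrable_bound)
      show "(\<lambda>\<omega>. (S (Suc m) \<omega>)\<^sup>2) \<in> borel_measurable M"
        using S_meas[of "Suc m"] step by measurable
      have "(x + y)\<^sup>2 \<le> 2 * x\<^sup>2 + 2 * y\<^sup>2" for x y :: real
        using sum_squares_bound[of x y] by (simp add: power2_sum)
      then show "AE \<omega> in M. norm ((S (Suc m) \<omega>)\<^sup>2) \<le> norm (2 * (S m \<omega>)\<^sup>2 + 2 * (X (Suc m) \<omega>)\<^sup>2)"
        using step by (intro always_eventually allI) (simp add: S_def greaterThanAtMost_Suc add.commute)
    qed
  qed (simp add: S_def)
  have gS: "integrable M (\<lambda>\<omega>. g m \<omega> * (S m \<omega>)\<^sup>2)" if "l \<le> m" "m \<le> u" for m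
    using S_sq[OF that]
    by (rule Bochner_Integration.integrable_bound)
       (use g_meas[OF that(2)] S_meas[OF that(2)] g01 in \<open>auto simp: mult_left_le_one_le\<close>)
  \<comment> \<open>The second summand is the second moment of the walk on the event that it has not crossed yet; it
    pays for the crossings at the next step.\<close>
  have main: "prob {\<omega>\<in>space M. bad m \<omega>} + expectation (\<lambda>\<omega>. g m \<omega> * (S m \<omega>)\<^sup>2) / (b m)\<^sup>2
      \<le> (\<Sum>i\<in>{l<..m}. V i / (b i)\<^sup>2)" if "l \<le> m" "m \<le> u" for m
    using that
  proof (induction m rule: dec_induct)
    case base
    then show ?case by (simp add: bad_def S_def)
  next
    case (step m)
    then have m: "l \<le> m" "m \<le> u" and Sm: "Suc m \<in> {l<..u}" by auto
    let ?X = "X (Suc m)"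
    have bp: "0 < b (Suc m)" using b_pos Sm by simp
    have indep_gS: "indep_var borel (\<lambda>\<omega>. g m \<omega> * S m \<omega>) borel ?X"
    proof -
      let ?P = "PiM {l<..m} (\<lambda>_. borel :: real measure)"
      \<comment> \<open>The switched walk as a function of a block of increments alone, so that
        independence of disjoint blocks applies.\<close>
      define F where "F h = (if \<exists>i\<in>{l<..m}. b i \<le> \<bar>\<Sum>j\<in>{l<..i}. h j\<bar> then 0 else 1) * (\<Sum>j\<in>{l<..m}. h j)" for h :: "nat \<Rightarrow> real"
      have s: "(\<lambda>h. \<Sum>j\<in>{l<..i}. h j) \<in> borel_measurable ?P" if "i \<le> m" for i
        using that by (intro borel_measurable_sum measurable_component_singleton) auto
      have p: "Measurable.pred ?P (\<lambda>h. \<exists>i\<in>{l<..m}. b i \<le> \<bar>\<Sum>j\<in>{l<..i}. h j\<bar>)"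
      proof -
        have [measurable]: "(\<lambda>h. \<Sum>j\<in>{l<..i}. h j) \<in> borel_measurable ?P" if "i \<in> {l<..m}" for i
          using that s by auto
        show ?thesis by measurable
      qed
      have F: "F \<in> borel_measurable ?P"
        unfolding F_def using p s[of m] by measurable
      have "indep_var ?P (\<lambda>\<omega>. restrict (\<lambda>i. X i \<omega>) {l<..m})
          (PiM {Suc m} (\<lambda>_. borel)) (\<lambda>\<omega>. restrict (\<lambda>i. X i \<omega>) {Suc m})"
        using Sm m by (intro indep_var_restrict[OF indep]) auto
      from indep_var_compose[OF this F measurable_component_singleton[of "Suc m"]]
      have *: "indep_var borel (F \<circ> (\<lambda>\<omega>. restrict (\<lambda>i. X i \<omega>) {l<..m})) borel
          ((\<lambda>h. h (Suc m)) \<circ> (\<lambda>\<omega>. restrict (\<lambda>i. X i \<omega>) {Suc m}))" by simp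
      have "F (restrict (\<lambda>i. X i \<omega>) {l<..m}) = g m \<omega> * S m \<omega>" for \<omega>
      proof -
        have eq: "(\<Sum>j\<in>{l<..i}. restrict (\<lambda>i. X i \<omega>) {l<..m} j) = S i \<omega>" if "i \<le> m" for i
          unfolding S_def using that by (intro sum.cong) auto
        have "(\<exists>i\<in>{l<..m}. b i \<le> \<bar>\<Sum>j\<in>{l<..i}. restrict (\<lambda>i. X i \<omega>) {l<..m} j\<bar>) \<longleftrightarrow> bad m \<omega>"
          unfolding bad_def by (intro bex_cong refl) (simp only: eq greaterThanAtMost_iff)
        then show ?thesis unfolding F_def g_def by (simp only: eq[OF order_refl])
      qed
      then have "F \<circ> (\<lambda>\<omega>. restrict (\<lambda>i. X i \<omega>) {l<..m}) = (\<lambda>\<omega>. g m \<omega> * S m \<omega>)"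
        by (simp add: comp_def)
      moreover have "(\<lambda>h. h (Suc m)) \<circ> (\<lambda>\<omega>. restrict (\<lambda>i. X i \<omega>) {Suc m}) = ?X"
        by (simp add: comp_def)
      ultimately show ?thesis using * by simp
    qed
    have gS1: "integrable M (\<lambda>\<omega>. g m \<omega> * S m \<omega>)"
    proof (rule square_integrable_imp_integrable)
      show "random_variable borel (\<lambda>\<omega>. g m \<omega> * S m \<omega>)"
        using g_meas[OF m(2)] S_meas[OF m(2)] by measurable
      have "(\<lambda>\<omega>. (g m \<omega> * S m \<omega>)\<^sup>2) = (\<lambda>\<omega>. g m \<omega> * (S m \<omega>)\<^sup>2)"
        by (auto simp: g_def)
      then show "integrable M (\<lambda>\<omega>. (g m \<omega> * S m \<omega>)\<^sup>2)" using gS[OF m] by simp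
    qed
    have cross_int: "integrable M (\<lambda>\<omega>. (g m \<omega> * S m \<omega>) * ?X \<omega>)"
      by (rule indep_var_integrable[OF indep_gS gS1 X_int[OF Sm]])
    have cross: "expectation (\<lambda>\<omega>. (g m \<omega> * S m \<omega>) * ?X \<omega>) = 0"
      using indep_var_lebesgue_integral[OF indep_gS gS1 X_int[OF Sm]] mean[OF Sm] by simp
    have gX_int: "integrable M (\<lambda>\<omega>. g m \<omega> * (?X \<omega>)\<^sup>2)"
      using sq[OF Sm]
      by (rule Bochner_Integration.integrable_bound)
         (use g_meas[OF m(2)] rv[OF Sm] g01 in \<open>auto simp: mult_left_le_one_le\<close>)
    have gX: "expectation (\<lambda>\<omega>. g m \<omega> * (?X \<omega>)\<^sup>2) \<le> V (Suc m)"
    proof -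
      have "expectation (\<lambda>\<omega>. g m \<omega> * (?X \<omega>)\<^sup>2) \<le> expectation (\<lambda>\<omega>. (?X \<omega>)\<^sup>2)"
        using gX_int sq[OF Sm] by (rule integral_mono) (simp add: g01 mult_left_le_one_le)
      also have "\<dots> \<le> V (Suc m)" by (rule var[OF Sm])
      finally show ?thesis .
    qed
    define R where "R \<omega> = g m \<omega> * (S m \<omega>)\<^sup>2 + 2 * ((g m \<omega> * S m \<omega>) * ?X \<omega>) + g m \<omega> * (?X \<omega>)\<^sup>2" for \<omega>
    have R_eq: "R \<omega> = g m \<omega> * (S (Suc m) \<omega>)\<^sup>2" for \<omega>
      using m by (simp add: R_def S_def greaterThanAtMost_Suc power2_sum algebra_simps)
    have R_int: "integrable M R"
      unfolding R_def using gS[OF m] cross_int gX_int by auto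
    have R: "expectation R \<le> expectation (\<lambda>\<omega>. g m \<omega> * (S m \<omega>)\<^sup>2) + V (Suc m)"
    proof -
      have "expectation R = expectation (\<lambda>\<omega>. g m \<omega> * (S m \<omega>)\<^sup>2) + expectation (\<lambda>\<omega>. g m \<omega> * (?X \<omega>)\<^sup>2)"
        unfolding R_def using gS[OF m] cross_int gX_int cross by simp
      then show ?thesis using gX by simp
    qed
    \<comment> \<open>Three cases: crossed before, crossing now, not crossed. Only the middle one
      changes the indicator, and there the square of the walk is at least the squared
      threshold.\<close>
    have pw: "indicator {\<omega>\<in>space M. bad (Suc m) \<omega>} \<omega> + g (Suc m) \<omega> * (S (Suc m) \<omega>)\<^sup>2 / (b (Suc m))\<^sup>2
        \<le> indicator {\<omega>\<in>space M. bad m \<omega>} \<omega> + R \<omega> / (b (Suc m))\<^sup>2" if \<omega>: "\<omega> \<in> space M" for \<omega>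
    proof -
      have bad: "bad (Suc m) \<omega> \<longleftrightarrow> bad m \<omega> \<or> b (Suc m) \<le> \<bar>S (Suc m) \<omega>\<bar>"
        using m by (auto simp: bad_def greaterThanAtMost_Suc)
      consider "bad m \<omega>" | "\<not> bad m \<omega>" "b (Suc m) \<le> \<bar>S (Suc m) \<omega>\<bar>" | "\<not> bad (Suc m) \<omega>" "\<not> bad m \<omega>"
        using bad by blast
      then show ?thesis
      proof cases
        case 2
        then have "(b (Suc m))\<^sup>2 \<le> (S (Suc m) \<omega>)\<^sup>2"
          using bp by (metis abs_le_square_iff abs_of_pos)
        then show ?thesis using 2 bad \<omega> bp by (simp add: R_eq g_def)
      qed (use bad \<omega> in \<open>simp_all add: R_eq g_def\<close>)
    qed
    have bm: "{\<omega>\<in>space M. bad i \<omega>} \<in> events" if "i \<le> u" for i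
      using bad_meas[OF that] by measurable
    have "prob {\<omega>\<in>space M. bad (Suc m) \<omega>} + expectation (\<lambda>\<omega>. g (Suc m) \<omega> * (S (Suc m) \<omega>)\<^sup>2) / (b (Suc m))\<^sup>2
        = expectation (\<lambda>\<omega>. indicator {\<omega>\<in>space M. bad (Suc m) \<omega>} \<omega> + g (Suc m) \<omega> * (S (Suc m) \<omega>)\<^sup>2 / (b (Suc m))\<^sup>2)"
      using gS[of "Suc m"] Sm bm[of "Suc m"] by (subst Bochner_Integration.integral_add) (auto simp: emeasure_eq_measure Int_absorb2)
    also have "\<dots> \<le> expectation (\<lambda>\<omega>. indicator {\<omega>\<in>space M. bad m \<omega>} \<omega> + R \<omega> / (b (Suc m))\<^sup>2)"
      using gS[of "Suc m"] Sm bm[of "Suc m"] bm[of m] m R_int pw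
      by (intro integral_mono) (auto simp: emeasure_eq_measure)
    also have "\<dots> = prob {\<omega>\<in>space M. bad m \<omega>} + expectation R / (b (Suc m))\<^sup>2"
      using bm[of m] m R_int by (subst Bochner_Integration.integral_add) (auto simp: emeasure_eq_measure Int_absorb2)
    also have "\<dots> \<le> prob {\<omega>\<in>space M. bad m \<omega>} + expectation (\<lambda>\<omega>. g m \<omega> * (S m \<omega>)\<^sup>2) / (b (Suc m))\<^sup>2 + V (Suc m) / (b (Suc m))\<^sup>2"
      using divide_right_mono[OF R, of "(b (Suc m))\<^sup>2"] by (simp add: add_divide_distrib)
    \<comment> \<open>Monotonicity of the thresholds enters here. At \<open>m = l\<close>, where
      nothing is assumed about \<open>b\<close>, the sum is empty.\<close>
    also have "expectation (\<lambda>\<omega>. g m \<omega> * (S m \<omega>)\<^sup>2) / (b (Suc m))\<^sup>2 \<le> expectation (\<lambda>\<omega>. g m \<omega> * (S m \<omega>)\<^sup>2) / (b m)\<^sup>2"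
    proof (cases "m = l")
      case True
      then show ?thesis by (simp add: S_def)
    next
      case False
      have "0 < b m" "b m \<le> b (Suc m)" using b_pos[of m] b_mono[of m] False m Sm by auto
      then have "0 < (b (Suc m))\<^sup>2 * (b m)\<^sup>2" "(b m)\<^sup>2 \<le> (b (Suc m))\<^sup>2"
        by (auto intro: power_mono)
      moreover have "0 \<le> expectation (\<lambda>\<omega>. g m \<omega> * (S m \<omega>)\<^sup>2)"
        by (rule Bochner_Integration.integral_nonneg) (simp add: g01)
      ultimately show ?thesis by (intro divide_left_mono)
    qed
    finally show ?case
      using step.IH m by (simp add: greaterThanAtMost_Suc)
  qed
  have "0 \<le> expectation (\<lambda>\<omega>. g u \<omega> * (S u \<omega>)\<^sup>2) / (b u)\<^sup>2"
    by (intro divide_nonneg_nonneg Bochner_Integration.integral_nonneg) (simp_all add: g01)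
  then have "prob {\<omega>\<in>space M. bad u \<omega>} \<le> (\<Sum>i\<in>{l<..u}. V i / (b i)\<^sup>2)"
    using main[of u] \<open>l \<le> u\<close> by simp
  then show ?thesis unfolding bad_def S_def .
qed

end

section \<open>The law of the observed offspring numbers\<close>

text \<open>Prescribing the answers \<open>ks\<close> also fixes the adaptively chosen places \<open>v\<close> that are queried.\<close>

lemma adaptive_query_cylinder:
  fixes v :: "nat \<Rightarrow> ('w \<Rightarrow> 'b) \<Rightarrow> 'w" and ks :: "nat \<Rightarrow> 'b"
  assumes dom: "\<And>j k. 1 \<le> j \<Longrightarrow> j \<le> m \<Longrightarrow> v j k \<in> W"
    and inj: "\<And>i j k. 1 \<le> i \<Longrightarrow> i < j \<Longrightarrow> j \<le> m \<Longrightarrow> v j k \<noteq> v i k"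
    and det: "\<And>j k k'. 1 \<le> j \<Longrightarrow> j \<le> m \<Longrightarrow>
      (\<And>i. 1 \<le> i \<Longrightarrow> i < j \<Longrightarrow> v i k = v i k' \<and> k (v i k) = k' (v i k)) \<Longrightarrow> v j k = v j k'"
  shows "\<exists>ws. ws ` {1..m} \<subseteq> W \<and> inj_on ws {1..m} \<and>
    (\<forall>k. (\<forall>i\<in>{1..m}. k (v i k) = ks i) \<longleftrightarrow> (\<forall>i\<in>{1..m}. k (ws i) = ks i))"
proof -
  have "\<exists>ws. ws ` {1..l} \<subseteq> W \<and> inj_on ws {1..l} \<and>
    (\<forall>k. (\<forall>i\<in>{1..l}. k (v i k) = ks i) \<longleftrightarrow> (\<forall>i\<in>{1..l}. k (ws i) = ks i)) \<and>
    (\<forall>k. (\<forall>i\<in>{1..l}. k (v i k) = ks i) \<longrightarrow> (\<forall>i\<in>{1..l}. v i k = ws i))" if "l \<le> m" for l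
    using that
  proof (induction l)
    case (Suc l)
    then obtain ws where ws: "ws ` {1..l} \<subseteq> W" "inj_on ws {1..l}"
      and iff: "\<And>k. (\<forall>i\<in>{1..l}. k (v i k) = ks i) \<longleftrightarrow> (\<forall>i\<in>{1..l}. k (ws i) = ks i)"
      and eq: "\<And>k i. (\<forall>i\<in>{1..l}. k (v i k) = ks i) \<Longrightarrow> i \<in> {1..l} \<Longrightarrow> v i k = ws i"
      by auto
    \<comment> \<open>One answer function that realises the prescribed answers. By
      \<open>det\<close> every \<open>k\<close> with these answers makes the same next query, so it
      can be read off from \<open>k0\<close>.\<close>
    define k0 where "k0 = ks \<circ> inv_into {1..l} ws"
    have k0: "k0 (ws i) = ks i" if "i \<in> {1..l}" for i
      using inv_into_f_f[OF ws(2) that] by (simp add: k0_def)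
    then have k0': "\<forall>i\<in>{1..l}. k0 (v i k0) = ks i" using iff by blast
    define w where "w = v (Suc l) k0"
    have w: "v (Suc l) k = w" if k: "\<forall>i\<in>{1..l}. k (v i k) = ks i" for k
      unfolding w_def
    proof (rule det)
      fix i assume "1 \<le> i" "i < Suc l"
      then have i: "i \<in> {1..l}" by simp
      show "v i k = v i k0 \<and> k (v i k) = k0 (v i k)"
        using eq[OF k i] eq[OF k0' i] k k0' i by metis
    qed (use Suc.prems in auto)
    have new: "w \<noteq> ws i" if "i \<in> {1..l}" for i
      using inj[of i "Suc l" k0] eq[OF k0' that] that Suc.prems by (simp add: w_def)
    have I: "{1..Suc l} = insert (Suc l) {1..l}" by auto
    define ws' where "ws' = ws(Suc l := w)"
    have ws'S: "ws' (Suc l) = w" by (simp add: ws'_def)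
    have ws'l: "ws' i = ws i" if "i \<in> {1..l}" for i using that by (auto simp: ws'_def)
    have im: "ws' ` {1..l} = ws ` {1..l}" using ws'l by (intro image_cong refl)
    have wW: "w \<in> W" unfolding w_def using dom[of "Suc l" k0] Suc.prems by simp
    have "inj_on ws' {1..l}" using ws(2) ws'l inj_on_cong[of "{1..l}" ws' ws] by blast
    moreover have "w \<notin> ws ` {1..l}" using new by blast
    moreover have "{1..l} - {Suc l} = {1..l}" by auto
    ultimately have "inj_on ws' {1..Suc l}"
      unfolding I inj_on_insert ws'S by (simp only: im) simp
    moreover have "ws' ` {1..Suc l} \<subseteq> W"
      unfolding I image_insert ws'S im using wW ws(1) by blast
    moreover have "(\<forall>i\<in>{1..Suc l}. k (v i k) = ks i) \<longleftrightarrow> (\<forall>i\<in>{1..Suc l}. k (ws' i) = ks i)" for k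
    proof -
      have "(\<forall>i\<in>{1..Suc l}. k (v i k) = ks i) \<longleftrightarrow>
          (\<forall>i\<in>{1..l}. k (v i k) = ks i) \<and> k (v (Suc l) k) = ks (Suc l)"
        unfolding I by auto
      also have "\<dots> \<longleftrightarrow> (\<forall>i\<in>{1..l}. k (v i k) = ks i) \<and> k w = ks (Suc l)"
        using w[of k] by auto
      also have "\<dots> \<longleftrightarrow> (\<forall>i\<in>{1..l}. k (ws i) = ks i) \<and> k w = ks (Suc l)"
        by (simp only: iff)
      also have "\<dots> \<longleftrightarrow> (\<forall>i\<in>{1..Suc l}. k (ws' i) = ks i)"
        unfolding I by (simp add: ws'l ws'S conj_commute)
      finally show ?thesis .
    qed
    moreover have "\<forall>i\<in>{1..Suc l}. v i k = ws' i" if "\<forall>i\<in>{1..Suc l}. k (v i k) = ks i" for k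
    proof -
      have *: "\<forall>i\<in>{1..l}. k (v i k) = ks i" using that unfolding I by simp
      show ?thesis unfolding I using w[OF *] eq[OF *] by (simp add: ws'l ws'S)
    qed
    ultimately show ?case by blast
  qed simp
  from this[of m] show ?thesis by auto
qed

text \<open>For degenerate waiting times the queries are fixed words of distinct lengths, so the
  adaptive scheme is valid for every \<open>d\<close>, without an exceptional set.\<close>

lemma query_cylinder:
  fixes d :: "nat \<Rightarrow> nat"
  assumes "1 \<le> n" "m \<le> n"
  shows "\<exists>ws. ws ` {1..m} \<subseteq> words \<and> inj_on ws {1..m} \<and>
    (\<forall>k. (\<forall>i\<in>{1..m}. k (query n d k i) = ks i) \<longleftrightarrow> (\<forall>i\<in>{1..m}. k (ws i) = ks i))"
proof (rule adaptive_query_cylinder)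
  consider "waiting_times n d" | "\<not> (\<forall>i\<in>{1..<n}. 1 \<le> d i)"
    using assms unfolding waiting_times_def by fastforce
  note * = this
  show "query n d k j \<in> words" if "1 \<le> j" "j \<le> m" for j k
    using * 
  proof cases
    case 1
    then show ?thesis using that waiting_times.query_words assms(2) le_trans by blast
  qed (simp add: query_degenerate words_def)
  show "query n d k j \<noteq> query n d k i" if "1 \<le> i" "i < j" "j \<le> m" for i j k
    using * 
  proof cases
    case 1
    then show ?thesis using that waiting_times.query_distinct assms(2) le_trans by metis
  next
    case 2
    have "length (query n d k j) \<noteq> length (query n d k i)"
      using that unfolding query_degenerate[OF 2] by simp
    then show ?thesis by auto
  qed
  show "query n d k j = query n d k' j"
    if "1 \<le> j" "j \<le> m" "\<And>i. 1 \<le> i \<Longrightarrow> i < j \<Longrightarrow>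
        query n d k i = query n d k' i \<and> k (query n d k i) = k' (query n d k i)" for j k k'
    using * 
  proof cases
    case 1
    show ?thesis by (rule waiting_times.query_cong[OF 1 that(1) _ that(3)]) (use that assms in auto)
  qed (simp add: query_degenerate)
qed

text \<open>Allows the random waiting times to be replaced by prescribed values on an event that
  fixes those with index below \<open>n\<close>.\<close>

lemma query_cong_delay:
  assumes d: "\<And>i. 1 \<le> i \<Longrightarrow> i < n \<Longrightarrow> d i = d' i" and j: "j \<le> n"
  shows "query n d k j = query n d' k j"
proof -
  have T: "coupon_time d i = coupon_time d' i" if "i \<le> n" for i
    unfolding coupon_time_def using that d by (intro sum.cong) auto
  then have "coupon_count n d = coupon_count n d'"
    unfolding coupon_count_def by (intro ext sum.cong) auto
  moreover have "(\<forall>i\<in>{1..<n}. 1 \<le> d i) \<longleftrightarrow> (\<forall>i\<in>{1..<n}. 1 \<le> d' i)"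
    using d by (intro ball_cong) auto
  ultimately show ?thesis unfolding query_def Let_def using T[OF j] by (simp only:)
qed

section \<open>The product law of the walk and its transfer to the model\<close>

definition geo_delay :: "nat \<Rightarrow> nat \<Rightarrow> nat pmf" where
  "geo_delay n i = map_pmf Suc (geometric_pmf (1 - real i / real n))"

text \<open>Coordinate \<open>i\<close> holds the offspring number of the query with index
  \<open>i\<close> and the waiting time with index \<open>i\<close>. The value \<open>(0, 0)\<close>
  outside the range is the default required by \<open>Pi_pmf\<close>; \<open>walk_obs\<close> copies
  it.\<close>

definition walk_pmf :: "nat pmf \<Rightarrow> nat \<Rightarrow> (nat \<Rightarrow> nat \<times> nat) pmf" where
  "walk_pmf \<mu> n = Pi_pmf {1..<n} (0, 0) (\<lambda>i. pair_pmf \<mu> (geo_delay n i))"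

lemma pmf_pair_pmf: "pmf (pair_pmf p q) x = pmf p (fst x) * pmf q (snd x)"
  by (cases x) (simp add: pmf_pair)

definition walk_obs :: "nat \<Rightarrow> (nat \<Rightarrow> nat) \<Rightarrow> (nat list \<Rightarrow> nat) \<Rightarrow> nat \<Rightarrow> nat \<times> nat" where
  "walk_obs n d k i = (if i \<in> {1..<n} then (k (query n d k i), d i) else (0, 0))"

text \<open>Makes the range of the observation countable, so that measurability and law can be
  checked on single points.\<close>

lemma countable_finite_support: "finite A \<Longrightarrow> countable {f :: 'b \<Rightarrow> 'c :: countable. \<forall>i. i \<notin> A \<longrightarrow> f i = c}"
proof -
  assume "finite A"
  have "countable ((\<lambda>h i. if i \<in> A then h i else c) ` (PiE A (\<lambda>_. UNIV)))"
    using \<open>finite A\<close> by (intro countable_image countable_PiE) auto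
  moreover have "{f. \<forall>i. i \<notin> A \<longrightarrow> f i = c} \<subseteq> (\<lambda>h i. if i \<in> A then h i else c) ` (PiE A (\<lambda>_. UNIV :: 'c set))"
  proof
    fix f :: "'b \<Rightarrow> 'c" assume "f \<in> {f. \<forall>i. i \<notin> A \<longrightarrow> f i = c}"
    then have "f = (\<lambda>i. if i \<in> A then restrict f A i else c)" by auto
    then show "f \<in> (\<lambda>h i. if i \<in> A then h i else c) ` (PiE A (\<lambda>_. UNIV :: 'c set))"
      by (intro image_eqI[of _ _ "restrict f A"]) auto
  qed
  ultimately show ?thesis by (rule countable_subset[rotated])
qed

locale transmission_model = prob_space M
  for M :: "'a measure" +
  fixes \<mu> :: "nat pmf" and K :: "nat list \<Rightarrow> 'a \<Rightarrow> nat" and \<Delta> :: "nat \<Rightarrow> nat \<Rightarrow> 'a \<Rightarrow> nat"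
  assumes K_indep: "indep_vars (\<lambda>_. count_space UNIV) K words"
    and K_law: "\<And>w. w \<in> words \<Longrightarrow> distr M (count_space UNIV) (K w) = measure_pmf \<mu>"
    and Delta_indep: "\<And>n. 1 \<le> n \<Longrightarrow> indep_vars (\<lambda>_. count_space UNIV) (\<lambda>i. \<Delta> i n) {1..<n}"
    and Delta_law: "\<And>n i. 1 \<le> i \<Longrightarrow> i < n \<Longrightarrow>
          distr M (count_space UNIV) (\<Delta> i n) = measure_pmf (geo_delay n i)"
    and K_Delta_indep: "\<And>n. 1 \<le> n \<Longrightarrow> indep_set
            (sets (vimage_algebra (space M) (\<lambda>\<omega>. \<lambda>w\<in>words. K w \<omega>)
              (PiM words (\<lambda>_. count_space UNIV))))
            (sets (vimage_algebra (space M) (\<lambda>\<omega>. \<lambda>i\<in>{1..<n}. \<Delta> i n \<omega>)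
              (PiM {1..<n} (\<lambda>_. count_space UNIV))))"
begin

definition obs :: "nat \<Rightarrow> 'a \<Rightarrow> nat \<Rightarrow> nat \<times> nat" where
  "obs n \<omega> = walk_obs n (\<lambda>i. \<Delta> i n \<omega>) (\<lambda>w. K w \<omega>)"

lemma K_meas [measurable (raw)]: "w \<in> words \<Longrightarrow> K w \<in> measurable M (count_space UNIV)"
  using K_indep unfolding indep_vars_def2 by blast

lemma Delta_meas [measurable (raw)]: "1 \<le> i \<Longrightarrow> i < n \<Longrightarrow> \<Delta> i n \<in> measurable M (count_space UNIV)"
  using Delta_indep[of n] unfolding indep_vars_def2 by auto

lemma prob_K: "w \<in> words \<Longrightarrow> prob (K w -` {x} \<inter> space M) = pmf \<mu> x"
  using measure_distr[OF K_meas, of w "{x}"] K_law[of w] by (simp add: pmf.rep_eq)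

lemma prob_Delta: "1 \<le> i \<Longrightarrow> i < n \<Longrightarrow> prob (\<Delta> i n -` {x} \<inter> space M) = pmf (geo_delay n i) x"
  using measure_distr[OF Delta_meas, of i n "{x}"] Delta_law[of i n] by (simp add: pmf.rep_eq)

lemma prob_cylinder:
  fixes n :: nat
  assumes n: "1 \<le> n" and ws: "ws ` I \<subseteq> words" "inj_on ws I" "finite I"
  shows "prob {\<omega>\<in>space M. (\<forall>i\<in>I. K (ws i) \<omega> = ks i) \<and> (\<forall>i\<in>{1..<n}. \<Delta> i n \<omega> = ds i)} =
    (\<Prod>i\<in>I. pmf \<mu> (ks i)) * (\<Prod>i\<in>{1..<n}. pmf (geo_delay n i) (ds i))"
proof -
  let ?A = "{\<omega>\<in>space M. \<forall>i\<in>I. K (ws i) \<omega> = ks i}" and ?B = "{\<omega>\<in>space M. \<forall>i\<in>{1..<n}. \<Delta> i n \<omega> = ds i}"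
  let ?FA = "vimage_algebra (space M) (\<lambda>\<omega>. \<lambda>w\<in>words. K w \<omega>) (PiM words (\<lambda>_. count_space UNIV))"
  let ?FB = "vimage_algebra (space M) (\<lambda>\<omega>. \<lambda>i\<in>{1..<n}. \<Delta> i n \<omega>) (PiM {1..<n} (\<lambda>_. count_space UNIV))"
  have A: "?A \<in> sets ?FA"
  proof -
    let ?C = "{h \<in> space (PiM words (\<lambda>_. count_space UNIV)). \<forall>i\<in>I. h (ws i) = ks i}"
    have [measurable]: "(\<lambda>h. h (ws i)) \<in> measurable (PiM words (\<lambda>_. count_space UNIV)) (count_space UNIV)" if "i \<in> I" for i
      using ws(1) that by (intro measurable_component_singleton) auto
    have "?C \<in> sets (PiM words (\<lambda>_. count_space (UNIV :: nat set)))"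
      using ws(3) by measurable
    moreover have "?A = (\<lambda>\<omega>. \<lambda>w\<in>words. K w \<omega>) -` ?C \<inter> space M"
      using ws(1) by (auto simp: space_PiM image_subset_iff)
    ultimately show ?thesis by (simp only: in_vimage_algebra)
  qed
  have B: "?B \<in> sets ?FB"
  proof -
    let ?C = "{h \<in> space (PiM {1..<n} (\<lambda>_. count_space UNIV)). \<forall>i\<in>{1..<n}. h i = ds i}"
    have [measurable]: "(\<lambda>h. h i) \<in> measurable (PiM {1..<n} (\<lambda>_. count_space UNIV)) (count_space UNIV)" if "i \<in> {1..<n}" for i
      using that by (intro measurable_component_singleton) auto
    have "?C \<in> sets (PiM {1..<n} (\<lambda>_. count_space (UNIV :: nat set)))"
      by measurable
    moreover have "?B = (\<lambda>\<omega>. \<lambda>i\<in>{1..<n}. \<Delta> i n \<omega>) -` ?C \<inter> space M"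
      by (auto simp: space_PiM)
    ultimately show ?thesis by (simp only: in_vimage_algebra)
  qed
  have "prob (?A \<inter> ?B) = prob ?A * prob ?B"
    using K_Delta_indep[OF n] A B by (rule indep_setD)
  moreover have "?A \<inter> ?B = {\<omega>\<in>space M. (\<forall>i\<in>I. K (ws i) \<omega> = ks i) \<and> (\<forall>i\<in>{1..<n}. \<Delta> i n \<omega> = ds i)}"
    by auto
  moreover have "prob ?A = (\<Prod>i\<in>I. pmf \<mu> (ks i))"
  proof (cases "I = {}")
    case True
    then show ?thesis by (simp add: prob_space)
  next
    case False
    let ?inv = "inv_into I ws"
    have inv: "?inv (ws i) = i" if "i \<in> I" for i using ws(2) that by simp
    have "?A = (\<Inter>w\<in>ws ` I. K w -` {ks (?inv w)} \<inter> space M)"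
      using False inv by auto
    also have "prob \<dots> = (\<Prod>w\<in>ws ` I. prob (K w -` {ks (?inv w)} \<inter> space M))"
      using False ws by (intro indep_varsD[OF K_indep]) auto
    also have "\<dots> = (\<Prod>i\<in>I. prob (K (ws i) -` {ks i} \<inter> space M))"
      using ws(2) inv by (subst prod.reindex) auto
    also have "\<dots> = (\<Prod>i\<in>I. pmf \<mu> (ks i))"
      using ws(1) by (intro prod.cong refl prob_K) auto
    finally show ?thesis .
  qed
  moreover have "prob ?B = (\<Prod>i\<in>{1..<n}. pmf (geo_delay n i) (ds i))"
  proof (cases "{1..<n} = {}")
    case True
    then show ?thesis by (simp add: prob_space)
  next
    case False
    have "?B = (\<Inter>i\<in>{1..<n}. \<Delta> i n -` {ds i} \<inter> space M)"
      using False by auto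
    also have "prob \<dots> = (\<Prod>i\<in>{1..<n}. prob (\<Delta> i n -` {ds i} \<inter> space M))"
      using False by (intro indep_varsD[OF Delta_indep[OF n]]) auto
    also have "\<dots> = (\<Prod>i\<in>{1..<n}. pmf (geo_delay n i) (ds i))"
      by (intro prod.cong refl prob_Delta) auto
    finally show ?thesis .
  qed
  ultimately show ?thesis by simp
qed

text \<open>The prescribed value \<open>f\<close> fixes the waiting times; with these inserted the
  queries depend on the offspring numbers only, and \<open>query_cylinder\<close> trades them for
  fixed words.\<close>

lemma obs_event:
  assumes n: "1 \<le> n" and f: "\<forall>i. i \<notin> {1..<n} \<longrightarrow> f i = (0, 0)"
  shows "\<exists>ws. ws ` {1..<n} \<subseteq> words \<and> inj_on ws {1..<n} \<and>
    obs n -` {f} \<inter> space M =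
      {\<omega>\<in>space M. (\<forall>i\<in>{1..<n}. K (ws i) \<omega> = fst (f i)) \<and> (\<forall>i\<in>{1..<n}. \<Delta> i n \<omega> = snd (f i))}"
proof -
  define d where "d i = snd (f i)" for i
  have I: "{1..n - 1} = {1..<n}" using n by auto
  obtain ws where ws: "ws ` {1..<n} \<subseteq> words" "inj_on ws {1..<n}"
    "\<And>k. (\<forall>i\<in>{1..<n}. k (query n d k i) = fst (f i)) \<longleftrightarrow> (\<forall>i\<in>{1..<n}. k (ws i) = fst (f i))"
    using query_cylinder[OF n, of "n - 1" d "\<lambda>i. fst (f i)"] unfolding I by auto
  have "obs n \<omega> = f \<longleftrightarrow>
      (\<forall>i\<in>{1..<n}. K (ws i) \<omega> = fst (f i)) \<and> (\<forall>i\<in>{1..<n}. \<Delta> i n \<omega> = snd (f i))" for \<omega>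
  proof -
    let ?k = "\<lambda>w. K w \<omega>" and ?d = "\<lambda>i. \<Delta> i n \<omega>"
    have "obs n \<omega> = f \<longleftrightarrow> (\<forall>i\<in>{1..<n}. ?k (query n ?d ?k i) = fst (f i) \<and> ?d i = snd (f i))"
      unfolding obs_def walk_obs_def fun_eq_iff prod_eq_iff using f by auto
    also have "\<dots> \<longleftrightarrow> (\<forall>i\<in>{1..<n}. ?d i = snd (f i)) \<and> (\<forall>i\<in>{1..<n}. ?k (query n ?d ?k i) = fst (f i))"
      by blast
    also have "\<dots> \<longleftrightarrow> (\<forall>i\<in>{1..<n}. ?d i = snd (f i)) \<and> (\<forall>i\<in>{1..<n}. ?k (query n d ?k i) = fst (f i))"
    proof (rule conj_cong[OF refl], rule ball_cong[OF refl])
      fix i assume *: "\<forall>i\<in>{1..<n}. ?d i = snd (f i)" and i: "i \<in> {1..<n}"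
      have "query n ?d ?k i = query n d ?k i"
        using * i by (intro query_cong_delay) (auto simp: d_def)
      then show "?k (query n ?d ?k i) = fst (f i) \<longleftrightarrow> ?k (query n d ?k i) = fst (f i)"
        by (simp only:)
    qed
    also have "\<dots> \<longleftrightarrow> (\<forall>i\<in>{1..<n}. ?d i = snd (f i)) \<and> (\<forall>i\<in>{1..<n}. ?k (ws i) = fst (f i))"
      using ws(3)[of ?k] by blast
    finally show ?thesis by blast
  qed
  then have "obs n -` {f} \<inter> space M =
      {\<omega>\<in>space M. (\<forall>i\<in>{1..<n}. K (ws i) \<omega> = fst (f i)) \<and> (\<forall>i\<in>{1..<n}. \<Delta> i n \<omega> = snd (f i))}"
    by blast
  with ws(1,2) show ?thesis by blast
qed

lemma obs_support: "obs n \<omega> \<in> {f. \<forall>i. i \<notin> {1..<n} \<longrightarrow> f i = (0, 0)}"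
  by (auto simp: obs_def walk_obs_def)

lemma obs_singleton_meas:
  assumes n: "1 \<le> n" 
  shows "obs n -` {f} \<inter> space M \<in> sets M"
proof (cases "\<forall>i. i \<notin> {1..<n} \<longrightarrow> f i = (0, 0)")
  case True
  obtain ws where ws: "ws ` {1..<n} \<subseteq> words" "inj_on ws {1..<n}"
    and eq: "obs n -` {f} \<inter> space M =
      {\<omega>\<in>space M. (\<forall>i\<in>{1..<n}. K (ws i) \<omega> = fst (f i)) \<and> (\<forall>i\<in>{1..<n}. \<Delta> i n \<omega> = snd (f i))}"
    using obs_event[OF n True] by blast
  have [measurable]: "K (ws i) \<in> measurable M (count_space UNIV)" "\<Delta> i n \<in> measurable M (count_space UNIV)"
    if "i \<in> {1..<n}" for i
    using that ws(1) by (auto intro!: K_meas Delta_meas)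
  show ?thesis unfolding eq by measurable
next
  case False
  then have "obs n \<omega> \<noteq> f" for \<omega> using obs_support[of n \<omega>] by auto
  then have "obs n -` {f} \<inter> space M = {}" by auto
  then show ?thesis by simp
qed

lemma obs_meas [measurable]:
  assumes n: "1 \<le> n"
  shows "obs n \<in> measurable M (count_space UNIV)"
proof (rule measurableI)
  fix A :: "(nat \<Rightarrow> nat \<times> nat) set"
  let ?F = "{f :: nat \<Rightarrow> nat \<times> nat. \<forall>i. i \<notin> {1..<n} \<longrightarrow> f i = (0, 0)}"
  have "obs n -` A \<inter> space M = (\<Union>f\<in>A \<inter> ?F. obs n -` {f} \<inter> space M)"
  proof (intro equalityI subsetI)
    fix \<omega> assume "\<omega> \<in> obs n -` A \<inter> space M"
    then show "\<omega> \<in> (\<Union>f\<in>A \<inter> ?F. obs n -` {f} \<inter> space M)"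
      using obs_support[of n \<omega>] by (intro UN_I[of "obs n \<omega>"]) simp_all
  qed auto
  also have "\<dots> \<in> sets M"
  proof (rule sets.countable_UN'')
    show "countable (A \<inter> ?F)"
      by (rule countable_subset[OF _ countable_finite_support[of "{1..<n}" "(0 :: nat, 0 :: nat)"]]) auto
  qed (rule obs_singleton_meas[OF n])
  finally show "obs n -` A \<inter> space M \<in> sets M" .
qed simp

text \<open>Point masses suffice on a countable set. They factorise although the queried words
  depend on the outcome, because each single event \<open>obs n = f\<close> is a cylinder over fixed
  distinct words.\<close>

lemma obs_law:
  assumes n: "1 \<le> n"
  shows "distr M (count_space UNIV) (obs n) = measure_pmf (walk_pmf \<mu> n)"
proof (rule measure_eqI_countable_AE)
  let ?F = "{f :: nat \<Rightarrow> nat \<times> nat. \<forall>i. i \<notin> {1..<n} \<longrightarrow> f i = (0, 0)}"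
  show "countable ?F" by (rule countable_finite_support) simp
  show "AE f in distr M (count_space UNIV) (obs n). f \<in> ?F"
    using n obs_support[of n] by (subst AE_distr_iff) auto
  show "AE f in measure_pmf (walk_pmf \<mu> n). f \<in> ?F"
    unfolding AE_measure_pmf_iff walk_pmf_def
    by (intro ballI) (rule subsetD[OF set_Pi_pmf_subset], simp_all)
  fix f assume f: "f \<in> ?F"
  obtain ws where ws: "ws ` {1..<n} \<subseteq> words" "inj_on ws {1..<n}"
    and eq: "obs n -` {f} \<inter> space M =
      {\<omega>\<in>space M. (\<forall>i\<in>{1..<n}. K (ws i) \<omega> = fst (f i)) \<and> (\<forall>i\<in>{1..<n}. \<Delta> i n \<omega> = snd (f i))}"
    using obs_event[OF n, of f] f by blast
  have "emeasure (distr M (count_space UNIV) (obs n)) {f} = ennreal (prob (obs n -` {f} \<inter> space M))"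
    using n by (simp add: emeasure_distr emeasure_eq_measure)
  also have "prob (obs n -` {f} \<inter> space M) =
      (\<Prod>i\<in>{1..<n}. pmf \<mu> (fst (f i))) * (\<Prod>i\<in>{1..<n}. pmf (geo_delay n i) (snd (f i)))"
    unfolding eq by (rule prob_cylinder[OF n ws]) simp
  also have "\<dots> = pmf (walk_pmf \<mu> n) f"
    using f unfolding walk_pmf_def
    by (subst pmf_Pi') (auto simp: prod.distrib[symmetric] pmf_pair_pmf)
  finally show "emeasure (distr M (count_space UNIV) (obs n)) {f} = emeasure (measure_pmf (walk_pmf \<mu> n)) {f}"
    by (simp add: emeasure_pmf_single)
qed simp_all

lemma prob_obs:
  assumes n: "1 \<le> n"
  shows "prob {\<omega>\<in>space M. P (obs n \<omega>)} = measure_pmf.prob (walk_pmf \<mu> n) {f. P f}"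
proof -
  have "measure_pmf.prob (walk_pmf \<mu> n) {f. P f} = measure (distr M (count_space UNIV) (obs n)) {f. P f}"
    by (simp add: obs_law[OF n])
  also have "\<dots> = prob (obs n -` {f. P f} \<inter> space M)"
    using n by (subst measure_distr) auto
  also have "obs n -` {f. P f} \<inter> space M = {\<omega>\<in>space M. P (obs n \<omega>)}" by auto
  finally show ?thesis by simp
qed

end

section \<open>A central limit theorem for triangular arrays\<close>

lemma exp_minus_bound:
  fixes x :: real
  assumes "0 \<le> x"
  shows "\<bar>exp (- x) - (1 - x)\<bar> \<le> x\<^sup>2"
proof -
  have "1 - x \<le> exp (- x)" using exp_ge_add_one_self[of "- x"] by simp
  moreover have "exp (- x) \<le> 1 - x + x\<^sup>2"
  proof -
    \<comment> \<open>Multiplying this lower bound by \<open>1 - x + x^2\<close> gives at least 1,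
      which is the wanted upper bound for \<open>exp (- x)\<close>.\<close>
    have 1: "1 + x + x\<^sup>2 / 2 \<le> exp x" using exp_lower_Taylor_quadratic[OF assms] .
    have 2: "0 \<le> 1 - x + x\<^sup>2"
      using sum_power2_ge_zero[of "x - 1" x] zero_le_power2[of x] by (simp add: power2_diff)
    have "1 \<le> 1 + x\<^sup>2 / 2 + x ^ 3 / 2 + x ^ 4 / 2" using assms by simp
    also have "\<dots> = (1 - x + x\<^sup>2) * (1 + x + x\<^sup>2 / 2)" by (simp add: field_simps power_numeral_reduce)
    also have "\<dots> \<le> (1 - x + x\<^sup>2) * exp x" by (rule mult_left_mono[OF 1 2])
    finally show ?thesis by (simp add: exp_minus inverse_eq_divide divide_le_eq)
  qed
  ultimately show ?thesis by (simp add: abs_le_iff)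
qed

text \<open>Each factor is compared with the Gaussian factor of the same variance. Products of
  numbers of modulus at most 1 differ by at most the sum of the differences of their factors, and
  each difference is a Taylor remainder of the characteristic function, collected in
  \<open>lind\<close>, plus an error of order \<open>1 / n^2\<close> from expanding
  \<open>exp\<close>. Stating the limit for the product of characteristic functions requires no
  common probability space.\<close>

lemma char_triangular_array:
  fixes \<nu> :: "nat \<Rightarrow> nat \<Rightarrow> 'b pmf" and h :: "nat \<Rightarrow> nat \<Rightarrow> 'b \<Rightarrow> real" and I :: "nat \<Rightarrow> nat set"
  assumes fin: "\<And>n. finite (I n)" and card: "\<And>n. card (I n) \<le> n"
    and sq: "\<And>n i. i \<in> I n \<Longrightarrow> integrable (measure_pmf (\<nu> n i)) (\<lambda>x. (h n i x)\<^sup>2)"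
    and mean: "\<And>n i. i \<in> I n \<Longrightarrow> measure_pmf.expectation (\<nu> n i) (h n i) = 0"
    and var: "\<And>n i. i \<in> I n \<Longrightarrow> measure_pmf.expectation (\<nu> n i) (\<lambda>x. (h n i x)\<^sup>2) = v n i"
    and bound: "\<And>n i. i \<in> I n \<Longrightarrow> v n i \<le> V"
    and lim: "(\<lambda>n. (\<Sum>i\<in>I n. v n i) / n) \<longlonglongrightarrow> s"
    and lind: "(\<lambda>n. (\<Sum>i\<in>I n. measure_pmf.expectation (\<nu> n i)
        (\<lambda>x. min (6 * (h n i x)\<^sup>2) (\<bar>t / sqrt n\<bar> * \<bar>h n i x\<bar> ^ 3))) / n) \<longlonglongrightarrow> 0"
  shows "(\<lambda>n. \<Prod>i\<in>I n. char (distr (\<nu> n i) borel (h n i)) (t / sqrt n))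
    \<longlonglongrightarrow> complex_of_real (exp (- (t\<^sup>2 * s / 2)))"
proof -
  define \<phi> where "\<phi> n i = char (distr (\<nu> n i) borel (h n i)) (t / sqrt n)" for n i
  define w where "w n i = complex_of_real (exp (- (t\<^sup>2 / n * v n i / 2)))" for n i
  define L where "L n i = measure_pmf.expectation (\<nu> n i)
        (\<lambda>x. min (6 * (h n i x)\<^sup>2) (\<bar>t / sqrt n\<bar> * \<bar>h n i x\<bar> ^ 3))" for n i
  have v0: "0 \<le> v n i" if "i \<in> I n" for n i
    unfolding var[OF that, symmetric] by simp
  have step: "norm (\<phi> n i - w n i) \<le> t\<^sup>2 / n / 6 * L n i + (t\<^sup>2 * V / (2 * n))\<^sup>2" if i: "i \<in> I n" for n i
  proof -
    have n: "0 < n" using card[of n] i fin[of n] by (cases n) (auto simp: card_eq_0_iff)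
    have int: "integrable (measure_pmf (\<nu> n i)) (h n i)"
      using sq[OF i] by (rule measure_pmf.square_integrable_imp_integrable[rotated]) simp
    have "norm (\<phi> n i - (1 - (t / sqrt n)\<^sup>2 * v n i / 2)) \<le> (t / sqrt n)\<^sup>2 / 6 * L n i"
      unfolding \<phi>_def L_def
      using int sq[OF i] mean[OF i] var[OF i] by (intro prob_space.char_approx3'[OF measure_pmf.prob_space_axioms]) auto
    then have 1: "norm (\<phi> n i - (1 - t\<^sup>2 / n * v n i / 2)) \<le> t\<^sup>2 / n / 6 * L n i"
      by (simp add: power_divide)
    define x where "x = t\<^sup>2 / n * v n i / 2"
    have x: "0 \<le> x" "x \<le> t\<^sup>2 * V / (2 * n)"
      using v0[OF i] bound[OF i] n mult_left_mono[of "v n i" V "t\<^sup>2"] by (auto simp: x_def field_simps)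
    have "norm ((1 - t\<^sup>2 / n * v n i / 2) - w n i) = \<bar>exp (- x) - (1 - x)\<bar>"
      unfolding w_def x_def norm_of_real[symmetric, where 'a = complex] by (simp add: norm_minus_commute)
    also have "\<dots> \<le> x\<^sup>2" by (rule exp_minus_bound[OF x(1)])
    also have "\<dots> \<le> (t\<^sup>2 * V / (2 * n))\<^sup>2" using x by (intro power_mono)
    finally have 2: "norm ((1 - t\<^sup>2 / n * v n i / 2) - w n i) \<le> (t\<^sup>2 * V / (2 * n))\<^sup>2" .
    show ?thesis
      using norm_triangle_le[OF add_mono[OF 1 2]] by simp
  qed
  have V0: "(t\<^sup>2 * V / (2 * n))\<^sup>2 \<ge> 0" for n :: nat by simp
  have diff: "norm ((\<Prod>i\<in>I n. \<phi> n i) - (\<Prod>i\<in>I n. w n i)) \<le>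
      t\<^sup>2 / 6 * ((\<Sum>i\<in>I n. L n i) / n) + (t\<^sup>2 * V / 2)\<^sup>2 / n" for n
  proof -
    have "norm ((\<Prod>i\<in>I n. \<phi> n i) - (\<Prod>i\<in>I n. w n i)) \<le> (\<Sum>i\<in>I n. norm (\<phi> n i - w n i))"
    proof (rule norm_prod_diff)
      show "norm (\<phi> n i) \<le> 1" for i
      proof -
        interpret real_distribution "distr (\<nu> n i) borel (h n i)"
          by (rule prob_space.real_distribution_distr[OF measure_pmf.prob_space_axioms]) simp
        show ?thesis unfolding \<phi>_def by (rule cmod_char_le_1)
      qed
      show "norm (w n i) \<le> 1" if "i \<in> I n" for i
        using v0[OF that] by (simp add: w_def)
    qed
    also have "\<dots> \<le> (\<Sum>i\<in>I n. t\<^sup>2 / n / 6 * L n i + (t\<^sup>2 * V / (2 * n))\<^sup>2)"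
      by (intro sum_mono step)
    also have "\<dots> = t\<^sup>2 / 6 * ((\<Sum>i\<in>I n. L n i) / n) + card (I n) * (t\<^sup>2 * V / (2 * n))\<^sup>2"
      by (simp add: sum.distrib sum_distrib_left sum_divide_distrib mult_ac)
    also have "card (I n) * (t\<^sup>2 * V / (2 * n))\<^sup>2 \<le> n * (t\<^sup>2 * V / (2 * n))\<^sup>2"
      using card[of n] by (intro mult_right_mono V0) simp
    also have "n * (t\<^sup>2 * V / (2 * n))\<^sup>2 = (t\<^sup>2 * V / 2)\<^sup>2 / n"
      by (simp add: power2_eq_square field_simps)
    finally show ?thesis by simp
  qed
  have "(\<lambda>n. t\<^sup>2 / 6 * ((\<Sum>i\<in>I n. L n i) / n) + (t\<^sup>2 * V / 2)\<^sup>2 / n) \<longlonglongrightarrow> t\<^sup>2 / 6 * 0 + 0"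
    using lind unfolding L_def by (intro tendsto_intros lim_const_over_n)
  then have lim0: "(\<lambda>n. t\<^sup>2 / 6 * ((\<Sum>i\<in>I n. L n i) / n) + (t\<^sup>2 * V / 2)\<^sup>2 / n) \<longlonglongrightarrow> 0"
    by (simp only: mult_zero_right add_0_right)
  have null: "(\<lambda>n. (\<Prod>i\<in>I n. \<phi> n i) - (\<Prod>i\<in>I n. w n i)) \<longlonglongrightarrow> 0"
    by (rule Lim_null_comparison[OF always_eventually lim0]) (intro allI diff)
  have "(\<Prod>i\<in>I n. w n i) = complex_of_real (exp (- (t\<^sup>2 * ((\<Sum>i\<in>I n. v n i) / n) / 2)))" for n
    unfolding w_def of_real_prod[symmetric] exp_sum[OF fin, symmetric]
    by (simp add: sum_negf sum_distrib_left sum_divide_distrib mult.commute)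
  moreover have "(\<lambda>n. complex_of_real (exp (- (t\<^sup>2 * ((\<Sum>i\<in>I n. v n i) / n) / 2))))
      \<longlonglongrightarrow> complex_of_real (exp (- (t\<^sup>2 * s / 2)))"
    by (intro tendsto_intros lim) simp
  ultimately have "(\<lambda>n. \<Prod>i\<in>I n. w n i) \<longlonglongrightarrow> complex_of_real (exp (- (t\<^sup>2 * s / 2)))" by simp
  from tendsto_add[OF null this] show ?thesis by (simp add: \<phi>_def)
qed

text \<open>Meant for the offspring numbers, where only a second moment is assumed: dominated
  convergence under their single law makes the remainder vanish.\<close>

lemma lindeberg_identical:
  fixes \<nu> :: "'b pmf" and h :: "'b \<Rightarrow> real" and I :: "nat \<Rightarrow> nat set"
  assumes fin: "\<And>n. finite (I n)" and card: "\<And>n. card (I n) \<le> n"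
    and sq: "integrable (measure_pmf \<nu>) (\<lambda>x. (h x)\<^sup>2)"
  shows "(\<lambda>n. (\<Sum>i\<in>I n. measure_pmf.expectation \<nu>
        (\<lambda>x. min (6 * (h x)\<^sup>2) (\<bar>t / sqrt n\<bar> * \<bar>h x\<bar> ^ 3))) / n) \<longlonglongrightarrow> 0"
proof -
  let ?L = "\<lambda>n::nat. measure_pmf.expectation \<nu> (\<lambda>x. min (6 * (h x)\<^sup>2) (\<bar>t / sqrt n\<bar> * \<bar>h x\<bar> ^ 3))"
  have L0: "0 \<le> ?L n" for n by (intro integral_nonneg_AE) auto
  have "?L \<longlonglongrightarrow> measure_pmf.expectation \<nu> (\<lambda>x. 0)"
  proof (rule integral_dominated_convergence[where w = "\<lambda>x. 6 * (h x)\<^sup>2"])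
    have "(\<lambda>n. min (6 * (h x)\<^sup>2) (\<bar>t / sqrt (real n)\<bar> * \<bar>h x\<bar> ^ 3)) \<longlonglongrightarrow> min (6 * (h x)\<^sup>2) (\<bar>0\<bar> * \<bar>h x\<bar> ^ 3)" for x
    proof -
      have "(\<lambda>n. t / sqrt (real n)) \<longlonglongrightarrow> 0" by real_asymp
      then show ?thesis by (intro tendsto_intros)
    qed
    moreover have "min (6 * (h x)\<^sup>2) (\<bar>0\<bar> * \<bar>h x\<bar> ^ 3) = 0" for x by simp
    ultimately show "AE x in measure_pmf \<nu>. (\<lambda>n. min (6 * (h x)\<^sup>2) (\<bar>t / sqrt (real n)\<bar> * \<bar>h x\<bar> ^ 3)) \<longlonglongrightarrow> 0"
      by simp
  qed (use sq in auto)
  then have L: "?L \<longlonglongrightarrow> 0" by simp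
  show ?thesis
  proof (rule Lim_null_comparison[OF always_eventually L], intro allI)
    fix n
    have "(\<Sum>i\<in>I n. ?L n) / n = card (I n) / n * ?L n" by simp
    also have "\<dots> \<le> 1 * ?L n"
      using card[of n] L0[of n] by (intro mult_right_mono) (auto simp: divide_le_eq)
    finally show "norm ((\<Sum>i\<in>I n. ?L n) / n) \<le> ?L n"
      using L0[of n] by simp
  qed
qed

text \<open>Meant for the waiting times, whose laws vary with \<open>n\<close> and \<open>i\<close>:
  a uniform third moment replaces dominated convergence and gives the rate
  \<open>1 / sqrt n\<close>.\<close>

lemma lindeberg_third_moment:
  fixes \<nu> :: "nat \<Rightarrow> nat \<Rightarrow> 'b pmf" and h :: "nat \<Rightarrow> nat \<Rightarrow> 'b \<Rightarrow> real" and I :: "nat \<Rightarrow> nat set"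
  assumes fin: "\<And>n. finite (I n)" and card: "\<And>n. card (I n) \<le> n"
    and int: "\<And>n i. i \<in> I n \<Longrightarrow> integrable (measure_pmf (\<nu> n i)) (\<lambda>x. \<bar>h n i x\<bar> ^ 3)"
    and bd: "\<And>n i. i \<in> I n \<Longrightarrow> measure_pmf.expectation (\<nu> n i) (\<lambda>x. \<bar>h n i x\<bar> ^ 3) \<le> C"
  shows "(\<lambda>n. (\<Sum>i\<in>I n. measure_pmf.expectation (\<nu> n i)
        (\<lambda>x. min (6 * (h n i x)\<^sup>2) (\<bar>t / sqrt n\<bar> * \<bar>h n i x\<bar> ^ 3))) / n) \<longlonglongrightarrow> 0"
proof -
  let ?L = "\<lambda>n i. measure_pmf.expectation (\<nu> n i)
        (\<lambda>x. min (6 * (h n i x)\<^sup>2) (\<bar>t / sqrt (real n)\<bar> * \<bar>h n i x\<bar> ^ 3))"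
  have L0: "0 \<le> ?L n i" for n i by (intro integral_nonneg_AE) auto
  have L1: "?L n i \<le> \<bar>t / sqrt n\<bar> * \<bar>C\<bar>" if "i \<in> I n" for n i
  proof -
    have "?L n i \<le> measure_pmf.expectation (\<nu> n i) (\<lambda>x. \<bar>t / sqrt n\<bar> * \<bar>h n i x\<bar> ^ 3)"
    proof (rule integral_mono)
      show *: "integrable (measure_pmf (\<nu> n i)) (\<lambda>x. \<bar>t / sqrt n\<bar> * \<bar>h n i x\<bar> ^ 3)"
        using int[OF that] by (rule integrable_mult_right)
      show "integrable (measure_pmf (\<nu> n i)) (\<lambda>x. min (6 * (h n i x)\<^sup>2) (\<bar>t / sqrt n\<bar> * \<bar>h n i x\<bar> ^ 3))"
        using * by (rule Bochner_Integration.integrable_bound) (auto intro!: always_eventually)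
    qed auto
    also have "\<dots> \<le> \<bar>t / sqrt n\<bar> * \<bar>C\<bar>"
      unfolding Bochner_Integration.integral_mult_right_zero using bd[OF that]
      by (intro mult_left_mono) auto
    finally show ?thesis .
  qed
  have "(\<lambda>n. \<bar>t / sqrt n\<bar> * \<bar>C\<bar>) \<longlonglongrightarrow> \<bar>0\<bar> * \<bar>C\<bar>"
    by (intro tendsto_intros) real_asymp
  then have lim: "(\<lambda>n. \<bar>t / sqrt n\<bar> * \<bar>C\<bar>) \<longlonglongrightarrow> 0" by simp
  show ?thesis
  proof (rule Lim_null_comparison[OF always_eventually lim], intro allI)
    fix n
    have "(\<Sum>i\<in>I n. ?L n i) \<le> card (I n) * (\<bar>t / sqrt n\<bar> * \<bar>C\<bar>)"
      using L1 by (rule sum_bounded_above)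
    also have "\<dots> \<le> n * (\<bar>t / sqrt n\<bar> * \<bar>C\<bar>)"
      using card[of n] by (intro mult_right_mono) auto
    finally have *: "(\<Sum>i\<in>I n. ?L n i) \<le> n * (\<bar>t / sqrt n\<bar> * \<bar>C\<bar>)" .
    have "norm ((\<Sum>i\<in>I n. ?L n i) / n) = (\<Sum>i\<in>I n. ?L n i) / n"
      using L0 by (simp add: sum_nonneg)
    also have "\<dots> \<le> \<bar>t / sqrt n\<bar> * \<bar>C\<bar>"
      using * by (cases "n = 0") (auto simp: divide_le_eq mult.commute)
    finally show "norm ((\<Sum>i\<in>I n. ?L n i) / n) \<le> \<bar>t / sqrt n\<bar> * \<bar>C\<bar>" .
  qed
qed

section \<open>Riemann sums and power series with polynomial weights\<close>

lemma riemann_sum_mono: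
  fixes G g :: "real \<Rightarrow> real" and n j :: nat
  assumes n: "0 < n"
    and deriv: "\<And>x. 0 \<le> x \<Longrightarrow> x \<le> real j / real n \<Longrightarrow> (G has_real_derivative g x) (at x)"
    and mono: "\<And>x y. 0 \<le> x \<Longrightarrow> x \<le> y \<Longrightarrow> y \<le> real j / real n \<Longrightarrow> g x \<le> g y"
  shows "n * (G (j / n) - G 0) \<le> (\<Sum>i\<in>{1..j}. g (real i / real n))"
    and "(\<Sum>i\<in>{1..j}. g (real i / real n)) \<le> n * (G (j / n) - G 0) + (g (j / n) - g 0)"
proof -
  have "n * (G (real l / real n) - G 0) \<le> (\<Sum>i\<in>{1..l}. g (real i / real n)) \<and>
      (\<Sum>i\<in>{1..l}. g (real i / real n)) \<le> n * (G (real l / real n) - G 0) + (g (real l / real n) - g 0)" if "l \<le> j" for l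
    using that
  proof (induction l)
    case (Suc l)
    have le: "real (Suc l) / n \<le> j / n" "real l / n \<le> j / n" using Suc.prems n by (auto intro!: divide_right_mono)
    have lt: "real l / n < real (Suc l) / n" using n by (auto intro!: divide_strict_right_mono)
    \<comment> \<open>The increment of \<open>G\<close> over a cell is \<open>g z / n\<close> for
      some \<open>z\<close> in it. By monotonicity the value at the right endpoint exceeds
      \<open>g z\<close> by at most the increment of \<open>g\<close>, and these increments
      telescope.\<close>
    have "\<exists>z. real l / n < z \<and> z < real (Suc l) / n \<and>
        G (real (Suc l) / n) - G (real l / n) = (real (Suc l) / n - real l / n) * g z"
    proof (rule MVT2[OF lt])
      fix x assume x: "real l / n \<le> x" "x \<le> real (Suc l) / n"
      have "0 \<le> real l / n" by simp
      with x le show "(G has_real_derivative g x) (at x)" by (intro deriv) linarith+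
    qed
    then obtain z where z: "real l / n < z" "z < real (Suc l) / n"
        "G (real (Suc l) / n) - G (real l / n) = (real (Suc l) / n - real l / n) * g z" by blast
    have "real (Suc l) / n - real l / n = 1 / n" by (simp add: diff_divide_distrib[symmetric])
    then have eq: "n * (G (real (Suc l) / n) - G (real l / n)) = g z" using n z(3) by simp
    have z0: "0 \<le> z" using z(1) order_trans[of 0 "real l / n" z] by simp
    have "g z \<le> g (real (Suc l) / n)" "g (real l / n) \<le> g z"
      using z z0 le by (auto intro!: mono)
    moreover have "(\<Sum>i\<in>{1..Suc l}. g (real i / n)) = (\<Sum>i\<in>{1..l}. g (real i / n)) + g (real (Suc l) / n)"
      by simp
    moreover have "n * (G (real (Suc l) / n) - G 0) = n * (G (real l / n) - G 0) + g z"
      using eq by (simp add: right_diff_distrib)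
    ultimately show ?case using Suc by linarith
  qed simp
  from this[of j] show "n * (G (j / n) - G 0) \<le> (\<Sum>i\<in>{1..j}. g (real i / real n))"
    and "(\<Sum>i\<in>{1..j}. g (real i / real n)) \<le> n * (G (j / n) - G 0) + (g (j / n) - g 0)" by auto
qed

lemma summable_cube_times_power:
  fixes c r :: real
  assumes "0 \<le> r" "r < 1"
  shows "summable (\<lambda>k. (real k + c) ^ 3 * r ^ k)"
proof (cases "r = 0")
  case True
  have "(\<lambda>k. (real k + c) ^ 3 * r ^ k) = (\<lambda>k. if k = 0 then c ^ 3 else 0)"
    using True by auto
  then show ?thesis by simp
next
  case False
  then have r: "0 < r" "r < 1" using assms by auto
  \<comment> \<open>Half of the geometric decay absorbs the polynomial, the other half remains
    summable.\<close>
  define s where "s = sqrt r"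
  have s: "0 < s" "s < 1" "r = s * s" using r by (auto simp: s_def)
  define a where "a = - ln s"
  have a: "0 < a" "s = exp (- a)" using s by (auto simp: a_def)
  have "(\<lambda>k. (real k + c) ^ 3 * exp (- a * real k)) \<longlonglongrightarrow> 0"
    using a(1) by real_asymp
  moreover have "exp (- a * real k) = s ^ k" for k
    by (simp add: a(2) exp_of_nat_mult[symmetric] mult.commute)
  ultimately have "(\<lambda>k. (real k + c) ^ 3 * s ^ k) \<longlonglongrightarrow> 0" by simp
  then have "eventually (\<lambda>k. norm ((real k + c) ^ 3 * s ^ k) < 1) sequentially"
    using tendsto_norm_zero order_tendstoD(2) zero_less_one by blast
  then have "eventually (\<lambda>k. norm ((real k + c) ^ 3 * r ^ k) \<le> s ^ k) sequentially"
  proof eventually_elim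
    case (elim k)
    have "norm ((real k + c) ^ 3 * r ^ k) = norm ((real k + c) ^ 3 * s ^ k) * s ^ k"
      using s(1) by (simp add: s(3) power_mult_distrib abs_mult)
    also have "\<dots> \<le> 1 * s ^ k" using elim s(1) by (intro mult_right_mono) auto
    finally show ?case by simp
  qed
  moreover have "summable (\<lambda>k. s ^ k)" using s by (simp add: summable_geometric)
  ultimately show ?thesis by (rule summable_comparison_test_ev)
qed

section \<open>Moments of the waiting times\<close>

lemma geo_delay_expectation_sums:
  fixes f :: "nat \<Rightarrow> real"
  assumes i: "1 \<le> i" "i < n" and S: "summable (\<lambda>k. \<bar>f (Suc k)\<bar> * (real i / real n) ^ k)"
  shows "integrable (measure_pmf (geo_delay n i)) f"
    and "measure_pmf.expectation (geo_delay n i) f =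
      (1 - real i / real n) * (\<Sum>k. f (Suc k) * (real i / real n) ^ k)"
proof -
  define r where "r = real i / real n"
  have r: "0 < r" "r < 1" using i by (auto simp: r_def)
  have *: "norm (pmf (geometric_pmf (1 - r)) k * f (Suc k)) = (1 - r) * (\<bar>f (Suc k)\<bar> * r ^ k)" for k
    using r by (simp add: abs_mult)
  have int: "integrable (count_space UNIV) (\<lambda>k. pmf (geometric_pmf (1 - r)) k * f (Suc k))"
    unfolding integrable_count_space_nat_iff * using S unfolding r_def by (rule summable_mult)
  have int': "integrable (measure_pmf (geometric_pmf (1 - r))) (\<lambda>k. f (Suc k))"
    unfolding measure_pmf_eq_density using int by (subst integrable_density) auto
  show "integrable (measure_pmf (geo_delay n i)) f"
    unfolding geo_delay_def r_def[symmetric] using int' by simp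
  have "measure_pmf.expectation (geo_delay n i) f = measure_pmf.expectation (geometric_pmf (1 - r)) (\<lambda>k. f (Suc k))"
    unfolding geo_delay_def r_def[symmetric] by simp
  also have "\<dots> = (LINT k|count_space UNIV. pmf (geometric_pmf (1 - r)) k * f (Suc k))"
    unfolding measure_pmf_eq_density by (subst integral_density) auto
  also have "\<dots> = (\<Sum>k. pmf (geometric_pmf (1 - r)) k * f (Suc k))"
    by (rule integral_count_space_nat[OF int])
  also have "(\<lambda>k. pmf (geometric_pmf (1 - r)) k * f (Suc k)) = (\<lambda>k. (1 - r) * (f (Suc k) * r ^ k))"
    using r by (auto simp: mult_ac)
  also have "(\<Sum>k. (1 - r) * (f (Suc k) * r ^ k)) = (1 - r) * (\<Sum>k. f (Suc k) * r ^ k)"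
  proof (rule suminf_mult)
    have "summable (\<lambda>k. norm (f (Suc k) * r ^ k))"
      using S r by (simp add: abs_mult r_def)
    then show "summable (\<lambda>k. f (Suc k) * r ^ k)" by (rule summable_norm_cancel)
  qed
  finally show "measure_pmf.expectation (geo_delay n i) f =
      (1 - real i / real n) * (\<Sum>k. f (Suc k) * (real i / real n) ^ k)"
    unfolding r_def .
qed

definition geo_mean :: "nat \<Rightarrow> nat \<Rightarrow> real" where
  "geo_mean n i = 1 / (1 - real i / real n)"

definition geo_var :: "nat \<Rightarrow> nat \<Rightarrow> real" where
  "geo_var n i = (real i / real n) / (1 - real i / real n)\<^sup>2"

lemma power_series_moments:
  fixes r :: real
  assumes "0 \<le> r" "r < 1"
  shows "(\<lambda>k. real (Suc k) * r ^ k) sums (1 / (1 - r)\<^sup>2)"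
    and "(\<lambda>k. (real (Suc k))\<^sup>2 * r ^ k) sums ((1 + r) / (1 - r) ^ 3)"
proof -
  show 1: "(\<lambda>k. real (Suc k) * r ^ k) sums (1 / (1 - r)\<^sup>2)"
    using geometric_deriv_sums[of r] assms by simp
  have S: "summable (\<lambda>k. (real (Suc k))\<^sup>2 * r ^ k)"
  proof (rule summable_comparison_test'[OF summable_cube_times_power[OF assms, of 1], of 0])
    fix k :: nat
    have "(real (Suc k))\<^sup>2 \<le> (real k + 1) ^ 3"
      using power_increasing[of 2 3 "real k + 1"] by (simp add: add.commute)
    then show "norm ((real (Suc k))\<^sup>2 * r ^ k) \<le> (real k + 1) ^ 3 * r ^ k"
      using assms by (simp add: mult_right_mono)
  qed
  define s where "s = (\<Sum>k. (real (Suc k))\<^sup>2 * r ^ k)"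
  have "(\<lambda>k. (real (Suc k))\<^sup>2 * r ^ k) sums s"
    unfolding s_def using S by (rule summable_sums)
  \<comment> \<open>Multiplication by \<open>r\<close> shifts the series by one index; differences
    of consecutive squares then reduce the second moment to the first.\<close>
  then have a: "(\<lambda>k. r * ((real (Suc k))\<^sup>2 * r ^ k)) sums (r * s)" by (rule sums_mult)
  have "(\<lambda>k. (real k)\<^sup>2 * r ^ k) sums (r * s)"
  proof -
    have "(\<lambda>k. (real (Suc k))\<^sup>2 * r ^ Suc k) sums (r * s)" using a by (simp add: mult_ac)
    then have "(\<lambda>k. (real k)\<^sup>2 * r ^ k) sums (r * s + (real 0)\<^sup>2 * r ^ 0)" by (rule sums_Suc)
    then show ?thesis by simp
  qed
  from sums_diff[OF \<open>(\<lambda>k. (real (Suc k))\<^sup>2 * r ^ k) sums s\<close> this]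
  have "(\<lambda>k. (real (Suc k))\<^sup>2 * r ^ k - (real k)\<^sup>2 * r ^ k) sums (s - r * s)" .
  moreover have "(\<lambda>k. 2 * (real (Suc k) * r ^ k) - r ^ k) sums (2 * (1 / (1 - r)\<^sup>2) - 1 / (1 - r))"
    using assms by (intro sums_diff sums_mult 1 geometric_sums) auto
  moreover have "(real (Suc k))\<^sup>2 * r ^ k - (real k)\<^sup>2 * r ^ k = 2 * (real (Suc k) * r ^ k) - r ^ k" for k
    by (simp add: power2_eq_square algebra_simps)
  ultimately have "s - r * s = 2 * (1 / (1 - r)\<^sup>2) - 1 / (1 - r)"
    by (simp add: sums_unique2)
  also have "\<dots> = (1 + r) / (1 - r)\<^sup>2"
    using assms by (simp add: divide_simps power2_eq_square) (simp add: algebra_simps)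
  finally have "(1 - r) * s = (1 + r) / (1 - r)\<^sup>2" by (simp add: algebra_simps)
  then have "s = (1 + r) / (1 - r) ^ 3"
    using assms by (simp add: divide_simps power2_eq_square power3_eq_cube mult_ac)
  then show "(\<lambda>k. (real (Suc k))\<^sup>2 * r ^ k) sums ((1 + r) / (1 - r) ^ 3)"
    using \<open>(\<lambda>k. (real (Suc k))\<^sup>2 * r ^ k) sums s\<close> by simp
qed

context
  fixes n i :: nat
  assumes i: "1 \<le> i" "i < n"
begin

lemma geo_ratio: "0 \<le> real i / real n" "real i / real n < 1"
  using i by auto

lemma geo_delay_integrable: "integrable (measure_pmf (geo_delay n i)) real"
  and geo_delay_mean: "measure_pmf.expectation (geo_delay n i) real = geo_mean n i"
proof -
  note s = power_series_moments(1)[OF geo_ratio]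
  have S: "summable (\<lambda>k. \<bar>real (Suc k)\<bar> * (real i / real n) ^ k)"
    using sums_summable[OF s] by simp
  show "integrable (measure_pmf (geo_delay n i)) real"
    by (rule geo_delay_expectation_sums(1)[OF i S])
  have "measure_pmf.expectation (geo_delay n i) real = (1 - real i / real n) * (1 / (1 - real i / real n)\<^sup>2)"
    unfolding geo_delay_expectation_sums(2)[OF i S] sums_unique[OF s, symmetric] ..
  then show "measure_pmf.expectation (geo_delay n i) real = geo_mean n i"
    by (simp add: geo_mean_def power2_eq_square)
qed

lemma geo_delay_integrable_sq: "integrable (measure_pmf (geo_delay n i)) (\<lambda>k. (real k)\<^sup>2)"
  and geo_delay_second_moment: "measure_pmf.expectation (geo_delay n i) (\<lambda>k. (real k)\<^sup>2) = geo_var n i + (geo_mean n i)\<^sup>2"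
proof -
  note s = power_series_moments(2)[OF geo_ratio]
  have S: "summable (\<lambda>k. \<bar>(real (Suc k))\<^sup>2\<bar> * (real i / real n) ^ k)"
    using sums_summable[OF s] by simp
  show "integrable (measure_pmf (geo_delay n i)) (\<lambda>k. (real k)\<^sup>2)"
    by (rule geo_delay_expectation_sums(1)[OF i S])
  have "measure_pmf.expectation (geo_delay n i) (\<lambda>k. (real k)\<^sup>2) =
      (1 - real i / real n) * ((1 + real i / real n) / (1 - real i / real n) ^ 3)"
    unfolding geo_delay_expectation_sums(2)[OF i S] sums_unique[OF s, symmetric] ..
  also have "\<dots> = geo_var n i + (geo_mean n i)\<^sup>2"
  proof -
    have "(1 - r) * ((1 + r) / (1 - r) ^ 3) = r / (1 - r)\<^sup>2 + (1 / (1 - r))\<^sup>2" if "r < 1" for r :: real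
      using that by (simp add: divide_simps power3_eq_cube power2_eq_square)
    from this[OF geo_ratio(2)] show ?thesis unfolding geo_var_def geo_mean_def .
  qed
  finally show "measure_pmf.expectation (geo_delay n i) (\<lambda>k. (real k)\<^sup>2) = geo_var n i + (geo_mean n i)\<^sup>2" .
qed

lemma geo_delay_centred:
  shows "integrable (measure_pmf (geo_delay n i)) (\<lambda>k. real k - geo_mean n i)"
    and "measure_pmf.expectation (geo_delay n i) (\<lambda>k. real k - geo_mean n i) = 0"
    and "integrable (measure_pmf (geo_delay n i)) (\<lambda>k. (real k - geo_mean n i)\<^sup>2)"
    and "measure_pmf.expectation (geo_delay n i) (\<lambda>k. (real k - geo_mean n i)\<^sup>2) = geo_var n i"
proof -
  show "integrable (measure_pmf (geo_delay n i)) (\<lambda>k. real k - geo_mean n i)"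
    using geo_delay_integrable by simp
  show "measure_pmf.expectation (geo_delay n i) (\<lambda>k. real k - geo_mean n i) = 0"
    using geo_delay_integrable geo_delay_mean by simp
  have eq: "(real k - geo_mean n i)\<^sup>2 = (real k)\<^sup>2 - 2 * geo_mean n i * real k + (geo_mean n i)\<^sup>2" for k
    by (simp add: power2_diff)
  show "integrable (measure_pmf (geo_delay n i)) (\<lambda>k. (real k - geo_mean n i)\<^sup>2)"
    unfolding eq using geo_delay_integrable geo_delay_integrable_sq by simp
  show "measure_pmf.expectation (geo_delay n i) (\<lambda>k. (real k - geo_mean n i)\<^sup>2) = geo_var n i"
    unfolding eq using geo_delay_integrable geo_delay_integrable_sq geo_delay_mean geo_delay_second_moment
    by (simp add: power2_eq_square)
qed

lemma geo_delay_third_moment: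
  assumes q: "real i / real n \<le> q" "q < 1"
  shows "integrable (measure_pmf (geo_delay n i)) (\<lambda>k. \<bar>real k - geo_mean n i\<bar> ^ 3)"
    and "measure_pmf.expectation (geo_delay n i) (\<lambda>k. \<bar>real k - geo_mean n i\<bar> ^ 3)
      \<le> (\<Sum>k. (real k + (1 + 1 / (1 - q))) ^ 3 * q ^ k)"
proof -
  let ?r = "real i / real n" and ?c = "1 + 1 / (1 - q)"
  have r: "0 \<le> ?r" "?r < 1" by (rule geo_ratio)+
  have q0: "0 \<le> q" using r q by linarith
  have m: "0 \<le> geo_mean n i" "geo_mean n i \<le> 1 / (1 - q)"
    unfolding geo_mean_def using r q by (auto intro!: divide_left_mono mult_pos_pos)
  have b: "\<bar>real (Suc k) - geo_mean n i\<bar> ^ 3 * ?r ^ k \<le> (real k + ?c) ^ 3 * q ^ k" for k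
    using m r q by (intro mult_mono power_mono) auto
  have Sq: "summable (\<lambda>k. (real k + ?c) ^ 3 * q ^ k)"
    using q0 q by (intro summable_cube_times_power)
  have S: "summable (\<lambda>k. \<bar>\<bar>real (Suc k) - geo_mean n i\<bar> ^ 3\<bar> * ?r ^ k)"
  proof (rule summable_comparison_test'[OF Sq, of 0])
    fix k :: nat
    show "norm (\<bar>\<bar>real (Suc k) - geo_mean n i\<bar> ^ 3\<bar> * ?r ^ k) \<le> (real k + ?c) ^ 3 * q ^ k"
      using b[of k] r by simp
  qed
  note E = geo_delay_expectation_sums[OF i S]
  show "integrable (measure_pmf (geo_delay n i)) (\<lambda>k. \<bar>real k - geo_mean n i\<bar> ^ 3)" by (rule E(1))
  have S': "summable (\<lambda>k. \<bar>real (Suc k) - geo_mean n i\<bar> ^ 3 * ?r ^ k)"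
    using S by simp
  have "measure_pmf.expectation (geo_delay n i) (\<lambda>k. \<bar>real k - geo_mean n i\<bar> ^ 3) =
      (1 - ?r) * (\<Sum>k. \<bar>real (Suc k) - geo_mean n i\<bar> ^ 3 * ?r ^ k)" by (rule E(2))
  also have "\<dots> \<le> 1 * (\<Sum>k. \<bar>real (Suc k) - geo_mean n i\<bar> ^ 3 * ?r ^ k)"
    using r S' by (intro mult_right_mono suminf_nonneg) auto
  also have "\<dots> \<le> (\<Sum>k. (real k + ?c) ^ 3 * q ^ k)"
    using suminf_le[OF b S' Sq] by simp
  finally show "measure_pmf.expectation (geo_delay n i) (\<lambda>k. \<bar>real k - geo_mean n i\<bar> ^ 3)
      \<le> (\<Sum>k. (real k + ?c) ^ 3 * q ^ k)" .
qed

end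

section \<open>Mean of the exploration walk\<close>

lemma is_theta_iff:
  assumes "0 < m"
  shows "is_theta m s \<longleftrightarrow> 0 < s \<and> m * (1 - exp (- s)) = s"
  using assms by (auto simp: is_theta_def field_simps)

text \<open>Rolle's theorem for \<open>m * (1 - exp (- s)) - s\<close>, of which 0 is always a root.
  It yields the uniqueness of \<theta> and, in \<open>EK_less\<close>, its position beyond the
  critical point.\<close>

lemma theta_critical_point:
  fixes m a b :: real
  assumes "a < b" "m * (1 - exp (- a)) = a" "m * (1 - exp (- b)) = b"
  shows "\<exists>z. a < z \<and> z < b \<and> m * exp (- z) = 1"
proof -
  have "\<exists>z>a. z < b \<and> (m * (1 - exp (- b)) - b) - (m * (1 - exp (- a)) - a) = (b - a) * (m * exp (- z) - 1)"
    using assms(1) by (rule MVT2) (auto intro!: derivative_eq_intros)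
  then obtain z where z: "a < z" "z < b"
    "(m * (1 - exp (- b)) - b) - (m * (1 - exp (- a)) - a) = (b - a) * (m * exp (- z) - 1)" by blast
  then have "(b - a) * (m * exp (- z) - 1) = 0" using assms by simp
  then have "m * exp (- z) = 1" using assms(1) by simp
  with z show ?thesis by blast
qed

lemma ln_less_minus_one:
  fixes m :: real
  assumes "1 < m"
  shows "ln m < m - 1"
proof (rule ccontr)
  assume "\<not> ln m < m - 1"
  then have "ln m = m - 1" using ln_le_minus_one[of m] assms by simp
  then have "m = 1" using ln_eq_minus_one[of m] assms by simp
  then show False using assms by simp
qed

lemma ex1_theta:
  assumes m: "1 < m"
  shows "\<exists>!s. is_theta m s"
proof -
  have m0: "0 < m" using m by simp
  let ?F = "\<lambda>s. m * (1 - exp (- s)) - s"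
  have ln: "0 < ln m" "ln m < m - 1"
    using m ln_less_minus_one[OF m] by simp_all
  \<comment> \<open>The point \<open>ln m\<close> maximises \<open>?F\<close>, with positive value
    \<open>m - 1 - ln m\<close>, while \<open>?F m\<close> is negative.\<close>
  have "\<exists>s. ln m \<le> s \<and> s \<le> m \<and> ?F s = 0"
  proof (rule IVT2)
    have "m * exp (- ln m) = 1" using m0 by (simp add: exp_minus)
    then show "0 \<le> ?F (ln m)" using ln by (simp add: right_diff_distrib)
    show "?F m \<le> 0" using m0 by (simp add: right_diff_distrib)
  qed (use ln in \<open>auto intro!: continuous_intros\<close>)
  then obtain s where s: "ln m \<le> s" "?F s = 0" by blast
  have "is_theta m s" using s ln by (simp add: is_theta_iff[OF m0])
  moreover have "a = b" if "is_theta m a" "is_theta m b" for a b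
  proof -
    \<comment> \<open>Two positive roots and the root 0 would enclose two distinct critical points,
      but \<open>exp\<close> is injective.\<close>
    have *: False if th: "is_theta m a" "is_theta m b" and less: "a < b" for a b
    proof -
      have ab: "0 < a" "m * (1 - exp (- a)) = a" "m * (1 - exp (- b)) = b"
        using th by (simp_all add: is_theta_iff[OF m0])
      obtain z1 where z1: "z1 < a" "m * exp (- z1) = 1"
        using theta_critical_point[of 0 a m] ab by auto
      obtain z2 where z2: "a < z2" "m * exp (- z2) = 1"
        using theta_critical_point[of a b m] ab less by auto
      have "exp (- z1) = exp (- z2)" using z1(2) z2(2) m0 by (metis mult_left_cancel less_irrefl)
      then show False using z1(1) z2(1) by simp
    qed
    show "a = b" using *[of a b] *[of b a] that by (cases a b rule: linorder_cases) auto
  qed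
  ultimately show ?thesis by blast
qed

section \<open>The mean of the walk: a concave function and its slope at the zero\<close>

locale drift =
  fixes EK \<theta> p :: real
  assumes EK_gt_1: "1 < EK" and theta: "is_theta EK \<theta>" and p_def: "p = 1 - exp (- \<theta>)"
begin

lemma theta_pos: "0 < \<theta>" and p_EK: "p * EK = \<theta>"
  using theta EK_gt_1 by (simp_all add: is_theta_iff p_def mult.commute)

lemma p_bounds: "0 < p" "p < 1"
  using theta_pos by (simp_all add: p_def)

lemma exp_theta: "exp (- \<theta>) = 1 - p" "exp \<theta> = 1 / (1 - p)" "ln (1 - p) = - \<theta>"
proof -
  show "exp (- \<theta>) = 1 - p" by (simp add: p_def)
  show "exp \<theta> = 1 / (1 - p)" by (simp add: p_def exp_minus inverse_eq_divide)
  show "ln (1 - p) = - \<theta>" by (simp add: p_def)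
qed

text \<open>Minus the derivative of \<open>drift_limit\<close> at \<open>p\<close>. Dividing by it
  converts a fluctuation of the walk into a shift of the passage index, which is the source of the
  prefactor of both variances; see \<open>slope_eq\<close>.\<close>

definition slope :: real where "slope = 1 / (1 - p) - EK"

text \<open>The positive root lies beyond the critical point \<open>z\<close>, where
  \<open>exp z = EK\<close>; so the mean walk crosses 0 at \<open>p\<close> with negative
  slope.\<close>

lemma EK_less: "EK < 1 / (1 - p)"
proof -
  obtain z where z: "z < \<theta>" "EK * exp (- z) = 1"
    using theta_critical_point[of 0 \<theta> EK] theta_pos p_EK by (auto simp: p_def mult.commute)
  have "EK = exp z" using z(2) by (simp add: exp_minus field_simps)
  also have "\<dots> < exp \<theta>" using z(1) by simp
  finally show ?thesis by (simp add: exp_theta)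
qed

lemma slope_pos: "0 < slope"
  using EK_less by (simp add: slope_def)

text \<open>Up to \<open>p_cap * n\<close>, a little beyond the expected end of the exploration, the moments of the waiting
  times are bounded. The term \<open>EK - 1 - ln EK\<close> is the maximum of the concave function \<open>drift_limit\<close> below.\<close>

definition p_cap :: real where "p_cap = (1 + p) / 2"
definition mean_cap :: real where "mean_cap = 1 / (1 - p_cap)"
definition rate :: real where "rate = min slope (EK - 1 - ln EK)"

lemma p_cap_bounds: "p < p_cap" "p_cap < 1" "0 < p_cap" and mean_cap_ge_1: "1 \<le> mean_cap"
  using p_bounds by (auto simp: p_cap_def mean_cap_def)

lemma rate_pos: "0 < rate" and rate_le: "rate \<le> slope" "rate \<le> EK - 1 - ln EK"
  using slope_pos ln_less_minus_one[OF EK_gt_1] by (simp_all add: rate_def)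

definition drift_limit :: "real \<Rightarrow> real" where "drift_limit x = x * EK + ln (1 - x)"

lemma drift_limit_0: "drift_limit 0 = 0" and drift_limit_p: "drift_limit p = 0"
  by (simp_all add: drift_limit_def exp_theta p_EK)

lemma drift_limit_concave: "concave_on {0..p} drift_limit"
proof (rule f''_le0_imp_concave)
  fix x assume "x \<in> {0..p}"
  then have x: "x < 1" using p_bounds by simp
  show "(drift_limit has_real_derivative (EK - 1 / (1 - x))) (at x)"
    unfolding drift_limit_def using x by (auto intro!: derivative_eq_intros)
  show "((\<lambda>x. EK - 1 / (1 - x)) has_real_derivative (- 1 / (1 - x)\<^sup>2)) (at x)"
    using x by (auto intro!: derivative_eq_intros simp: power2_eq_square)
  show "- 1 / (1 - x)\<^sup>2 \<le> 0" by simp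
qed simp

text \<open>A concave function lies above its chords, here those joining its maximum to its two
  zeros. Both chords have horizontal extent below 1, so in modulus their slopes exceed the maximal
  value, which is at least \<open>rate\<close>.\<close>

lemma drift_limit_lower:
  assumes x: "0 \<le> x" "x \<le> p"
  shows "rate * min x (p - x) \<le> drift_limit x"
proof -
  \<comment> \<open>The derivative \<open>EK - 1 / (1 - x)\<close> vanishes at \<open>h\<close>, and
    \<open>EK_less\<close> puts \<open>h\<close> to the left of \<open>p\<close>.\<close>
  define h where "h = 1 - 1 / EK"
  have h: "0 < h" "h < p" "h < 1"
    using EK_gt_1 EK_less p_bounds by (auto simp: h_def field_simps)
  have fh: "drift_limit h = EK - 1 - ln EK"
    using EK_gt_1 by (simp add: drift_limit_def h_def left_diff_distrib ln_div)
  have fh': "rate \<le> drift_limit h" "0 < drift_limit h" using rate_le rate_pos by (simp_all add: fh)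
  show ?thesis
  proof (cases "x \<le> h")
    case True
    define t where "t = x / h"
    have t: "0 \<le> t" "t \<le> 1" "x = (1 - t) *\<^sub>R 0 + t *\<^sub>R h" using h x True by (auto simp: t_def)
    have "(1 - t) * drift_limit 0 + t * drift_limit h \<le> drift_limit x"
      unfolding t(3) using drift_limit_concave t(1,2) h by (intro concave_onD) auto
    then have "t * drift_limit h \<le> drift_limit x" by (simp add: drift_limit_0)
    moreover have "x \<le> t" using mult_left_le[of h x] h x by (simp add: t_def le_divide_eq)
    moreover have "rate * x \<le> drift_limit h * t"
      using fh' rate_pos calculation(2) x by (intro mult_mono) auto
    moreover have "rate * min x (p - x) \<le> rate * x" using rate_pos by (intro mult_left_mono) auto
    ultimately show ?thesis by (simp add: mult.commute)
  next
    case False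
    define t where "t = (p - x) / (p - h)"
    have t: "0 \<le> t" "t \<le> 1" using h x False by (auto simp: t_def)
    have "t * (p - h) = p - x" using h by (simp add: t_def)
    then have t3: "x = (1 - t) *\<^sub>R p + t *\<^sub>R h" by (simp add: algebra_simps)
    have "(1 - t) * drift_limit p + t * drift_limit h \<le> drift_limit x"
      unfolding t3 using drift_limit_concave t(1,2) h by (intro concave_onD) auto
    then have "t * drift_limit h \<le> drift_limit x" by (simp add: drift_limit_p)
    moreover have "p - x \<le> t"
    proof -
      have "p - x = t * (p - h)" by (simp add: \<open>t * (p - h) = p - x\<close>)
      also have "\<dots> \<le> t * 1" using t h p_bounds by (intro mult_left_mono) auto
      finally show ?thesis by simp
    qed
    moreover have "rate * (p - x) \<le> drift_limit h * t"
      using fh' rate_pos calculation(2) x by (intro mult_mono) auto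
    moreover have "rate * min x (p - x) \<le> rate * (p - x)" using rate_pos by (intro mult_left_mono) auto
    ultimately show ?thesis by (simp add: mult.commute)
  qed
qed

text \<open>Used at the rounded zero, where it shows that replacing \<open>p * n\<close> by an
  integer costs a bounded amount.\<close>

lemma drift_limit_upper:
  assumes x: "x \<le> p"
  shows "drift_limit x \<le> (p - x) * mean_cap"
proof -
  have "drift_limit x = drift_limit x - drift_limit p" by (simp add: drift_limit_p)
  also have "\<dots> = (x - p) * EK + ln ((1 - x) / (1 - p))"
    using x p_bounds by (simp add: drift_limit_def ln_div algebra_simps)
  also have "ln ((1 - x) / (1 - p)) \<le> (1 - x) / (1 - p) - 1"
    using x p_bounds by (intro ln_le_minus_one) auto
  also have "\<dots> = (p - x) / (1 - p)" using p_bounds by (simp add: field_simps)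
  also have "\<dots> \<le> (p - x) * mean_cap"
  proof -
    have "1 / (1 - p) \<le> mean_cap" unfolding mean_cap_def using p_cap_bounds by (intro divide_left_mono) auto
    from mult_left_mono[OF this, of "p - x"] show ?thesis using x by simp
  qed
  also have "(x - p) * EK \<le> 0" using x EK_gt_1 by (intro mult_nonpos_nonneg) auto
  finally show ?thesis by simp
qed

definition drift_sum :: "nat \<Rightarrow> nat \<Rightarrow> real" where
  "drift_sum n j = (\<Sum>i\<in>{1..j}. EK - geo_mean n i)"

text \<open>The mean waiting time \<open>1 / (1 - x)\<close> has the antiderivative
  \<open>- ln (1 - x)\<close> and is increasing, so the error of the Riemann sum is at most its
  total increase; up to \<open>p_cap * n\<close> this is bounded uniformly in
  \<open>n\<close>.\<close>

lemma drift_sum_bounds: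
  assumes n: "0 < n" and j: "real j \<le> p_cap * n"
  shows "n * drift_limit (j / n) - mean_cap \<le> drift_sum n j" "drift_sum n j \<le> n * drift_limit (j / n)"
proof -
  have jq: "real j / n \<le> p_cap" using j n by (simp add: divide_le_eq)
  have d: "((\<lambda>x. - ln (1 - x)) has_real_derivative 1 / (1 - x)) (at x)" if "0 \<le> x" "x \<le> real j / n" for x
    using that jq p_cap_bounds by (auto intro!: derivative_eq_intros)
  have m: "1 / (1 - x) \<le> 1 / (1 - y)" if "0 \<le> x" "x \<le> y" "y \<le> real j / n" for x y :: real
    using that jq p_cap_bounds by (intro divide_left_mono) auto
  have eq: "drift_sum n j = j * EK - (\<Sum>i\<in>{1..j}. 1 / (1 - real i / real n))"
    by (simp add: drift_sum_def geo_mean_def sum_subtractf)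
  have feq: "n * drift_limit (j / n) = j * EK + n * ln (1 - j / n)"
    using n by (simp add: drift_limit_def algebra_simps)
  have "1 / (1 - real j / n) \<le> mean_cap"
    unfolding mean_cap_def using jq p_cap_bounds by (intro divide_left_mono) auto
  then show "n * drift_limit (j / n) - mean_cap \<le> drift_sum n j" "drift_sum n j \<le> n * drift_limit (j / n)"
    using riemann_sum_mono[where j = j, OF n d m] unfolding eq feq by simp_all
qed

lemma drift_sum_lower:
  assumes n: "0 < n" and j: "real j \<le> p * n"
  shows "rate * min (real j) (p * n - j) - mean_cap \<le> drift_sum n j"
proof -
  have jn: "real j / n \<le> p" using j n by (simp add: divide_le_eq)
  have "p * n \<le> p_cap * n" using p_cap_bounds by (intro mult_right_mono) auto
  then have "n * drift_limit (j / n) - mean_cap \<le> drift_sum n j" using j by (intro drift_sum_bounds n) simp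
  moreover have "rate * min (real j) (p * n - j) = n * (rate * min (j / n) (p - j / n))"
    using n by (simp add: min_def field_simps)
  moreover have "n * (rate * min (j / n) (p - j / n)) \<le> n * drift_limit (j / n)"
    using jn by (intro mult_left_mono drift_limit_lower) auto
  ultimately show ?thesis by linarith
qed

lemma drift_sum_at_zero:
  assumes n: "0 < n"
  shows "\<bar>drift_sum n (nat \<lfloor>p * n\<rfloor>)\<bar> \<le> mean_cap"
proof -
  define j where "j = nat \<lfloor>p * n\<rfloor>"
  have "0 \<le> p * n" using p_bounds by simp
  then have j: "real j \<le> p * n" "p * n < real j + 1" unfolding j_def by linarith+
  have "0 \<le> rate * min (real j) (p * n - j)" using rate_pos j by simp
  then have 1: "- mean_cap \<le> drift_sum n j" using drift_sum_lower[OF n j(1)] by simp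
  have jn: "real j / n \<le> p" using j n by (simp add: divide_le_eq)
  have "p * n \<le> p_cap * n" using p_cap_bounds by (intro mult_right_mono) auto
  then have "drift_sum n j \<le> n * drift_limit (j / n)" using j by (intro drift_sum_bounds n) simp
  also have "\<dots> \<le> n * ((p - j / n) * mean_cap)" using jn by (intro mult_left_mono drift_limit_upper) auto
  also have "\<dots> = (p * n - j) * mean_cap" using n by (simp add: field_simps)
  also have "\<dots> \<le> 1 * mean_cap" using j mean_cap_ge_1 by (intro mult_right_mono) auto
  finally show ?thesis using 1 by (simp add: j_def abs_le_iff)
qed

lemma geo_mean_near:
  assumes n: "0 < n" and i: "real i \<le> p_cap * n"
  shows "\<bar>1 / (1 - p) - geo_mean n i\<bar> \<le> mean_cap\<^sup>2 * \<bar>p * n - i\<bar> / n"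
proof -
  define x where "x = real i / n"
  have x: "x \<le> p_cap" using i n by (simp add: x_def divide_le_eq)
  have pos: "0 < 1 - p" "0 < 1 - x" using x p_bounds p_cap_bounds by auto
  have "1 / (1 - p) - 1 / (1 - x) = (p - x) * (1 / (1 - p) * (1 / (1 - x)))"
    using pos by (simp add: field_simps)
  then have "\<bar>1 / (1 - p) - 1 / (1 - x)\<bar> = \<bar>p - x\<bar> * (1 / (1 - p) * (1 / (1 - x)))"
    using pos by (simp add: abs_mult)
  also have "\<dots> \<le> \<bar>p - x\<bar> * (mean_cap * mean_cap)"
    unfolding mean_cap_def using pos x p_bounds p_cap_bounds
    by (intro mult_left_mono mult_mono divide_left_mono mult_pos_pos) auto
  also have "\<bar>p - x\<bar> = \<bar>p * n - i\<bar> / n"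
  proof -
    have "p - x = (p * n - i) / n" using n by (simp add: x_def field_simps)
    then show ?thesis by simp
  qed
  finally show ?thesis by (simp add: geo_mean_def x_def power2_eq_square mult.commute)
qed

lemma sum_diff_bound:
  fixes a :: "nat \<Rightarrow> real"
  assumes "\<And>k. min i j < k \<Longrightarrow> k \<le> max i j \<Longrightarrow> \<bar>a k\<bar> \<le> B"
  shows "\<bar>(\<Sum>k\<in>{1..i}. a k) - (\<Sum>k\<in>{1..j}. a k)\<bar> \<le> \<bar>real i - real j\<bar> * B"
proof -
  have *: "\<bar>(\<Sum>k\<in>{1..i}. a k) - (\<Sum>k\<in>{1..j}. a k)\<bar> \<le> \<bar>real i - real j\<bar> * B"
    if "i \<le> j" "\<And>k. i < k \<Longrightarrow> k \<le> j \<Longrightarrow> \<bar>a k\<bar> \<le> B" for i j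
  proof -
    have "{1..j} = {1..i} \<union> {i<..j}" using that by auto
    then have "(\<Sum>k\<in>{1..j}. a k) = (\<Sum>k\<in>{1..i}. a k) + (\<Sum>k\<in>{i<..j}. a k)"
      by (simp only:) (rule sum.union_disjoint, auto)
    then have "\<bar>(\<Sum>k\<in>{1..i}. a k) - (\<Sum>k\<in>{1..j}. a k)\<bar> = \<bar>\<Sum>k\<in>{i<..j}. a k\<bar>" by simp
    also have "\<dots> \<le> (\<Sum>k\<in>{i<..j}. \<bar>a k\<bar>)" by (rule sum_abs)
    also have "\<dots> \<le> card {i<..j} * B" using that(2) by (intro sum_bounded_above) auto
    finally show ?thesis using that(1) by (simp add: of_nat_diff)
  qed
  show ?thesis
    using *[of i j] *[of j i] assms by (cases "i \<le> j") (auto simp: abs_minus_commute)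
qed

text \<open>Within distance \<open>r\<close> of the zero the mean increments differ from
  \<open>- slope\<close> by order \<open>r / n\<close>. The accumulated error is of order
  \<open>r^2 / n\<close>, hence bounded when \<open>r\<close> is a multiple of
  \<open>sqrt n\<close>.\<close>

lemma drift_sum_linear:
  assumes n: "0 < n" and j: "\<bar>real j - p * n\<bar> \<le> 1" and i: "\<bar>real i - real j\<bar> \<le> r"
    and p_cap: "real j + r \<le> p_cap * n"
  shows "\<bar>drift_sum n i - drift_sum n j + slope * (real i - real j)\<bar> \<le> r * (mean_cap\<^sup>2 * (r + 1) / n)"
proof -
  let ?a = "\<lambda>k. 1 / (1 - p) - geo_mean n k"
  have eq: "(\<Sum>k\<in>{1..i}. ?a k) = drift_sum n i + slope * i" for i
    by (simp add: drift_sum_def slope_def sum_subtractf algebra_simps)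
  have "drift_sum n i - drift_sum n j + slope * (real i - real j) = (\<Sum>k\<in>{1..i}. ?a k) - (\<Sum>k\<in>{1..j}. ?a k)"
    unfolding eq by (simp add: algebra_simps)
  also have "\<bar>\<dots>\<bar> \<le> \<bar>real i - real j\<bar> * (mean_cap\<^sup>2 * (r + 1) / n)"
  proof (rule sum_diff_bound)
    fix k assume k: "min i j < k" "k \<le> max i j"
    have "\<bar>?a k\<bar> \<le> mean_cap\<^sup>2 * \<bar>p * n - k\<bar> / n"
      using n k i p_cap by (intro geo_mean_near) auto
    also have "\<dots> \<le> mean_cap\<^sup>2 * (r + 1) / n"
      using k i j by (intro divide_right_mono mult_left_mono) auto
    finally show "\<bar>?a k\<bar> \<le> mean_cap\<^sup>2 * (r + 1) / n" .
  qed
  also have "\<dots> \<le> r * (mean_cap\<^sup>2 * (r + 1) / n)"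
    using i by (intro mult_right_mono) auto
  finally show ?thesis .
qed

end

text \<open>Deterministic core of the argument. Up to \<open>j0 - r\<close> the drift
  \<open>m\<close> beats the noise \<open>X\<close>, at \<open>j0 + r\<close> the walk is already
  negative, and in between it is affine up to \<open>3 * e + C\<close>. The sign change from
  \<open>I - 1\<close> to \<open>I\<close> pins \<open>g * (I - j0)\<close> to \<open>X j0\<close>,
  with an extra \<open>g\<close> for the single step. The threshold in \<open>H2\<close> is capped
  at \<open>r\<close> because left of the window the drift bound guarantees only a multiple of
  \<open>min i r\<close>.\<close>

lemma first_passage_linearisation:
  fixes D X Y m S :: "nat \<Rightarrow> real" and A r j0 :: nat and c g C e a :: real
  assumes D: "\<And>i. D i = X i + m i" and S: "\<And>i. S i = Y i + a * i" and D0: "D 0 = 0"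
    and H1: "\<And>i. 1 \<le> i \<Longrightarrow> i \<le> A \<Longrightarrow> 0 \<le> D i"
    and H2: "\<And>i. 1 \<le> i \<Longrightarrow> i \<le> j0 \<Longrightarrow> \<bar>X i\<bar> < c / 2 * max (real A) (min (real i) (real r))"
    and H3: "\<And>i. j0 - r < i \<Longrightarrow> i \<le> j0 + r \<Longrightarrow> \<bar>X i - X (j0 - r)\<bar> < e"
    and H4: "\<And>i. j0 - r < i \<Longrightarrow> i \<le> j0 + r \<Longrightarrow> \<bar>Y i - Y (j0 - r)\<bar> < e"
    and m1: "\<And>i. i \<le> j0 \<Longrightarrow> c * min (real i) (real j0 - real i) - C \<le> m i"
    and m2: "\<bar>m j0\<bar> \<le> C"
    and m3: "\<And>i. j0 - r \<le> i \<Longrightarrow> i \<le> j0 + r \<Longrightarrow> \<bar>m i - m j0 + g * (real i - real j0)\<bar> \<le> e"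
    and r: "A \<le> r" "1 \<le> r" "r \<le> j0" and params: "0 < c" "c \<le> g" "0 < e" "C \<le> c / 2 * A" "3 * e + C < c / 2 * r"
  obtains I where "1 \<le> I" "I \<le> j0 + r" "\<And>i. 1 \<le> i \<Longrightarrow> i < I \<Longrightarrow> 0 \<le> D i" "D I < 0"
    "\<bar>g * (real I - real j0) - X j0\<bar> \<le> 3 * e + C + g" "\<bar>S I - a * I - Y j0\<bar> \<le> 2 * e"
proof -
  have C0: "0 \<le> C" using m2 by simp
  have early: "0 \<le> D i" if i: "i \<le> j0 - r" for i
  proof -
    consider "i = 0" | "1 \<le> i" "i \<le> A" | "A < i" by linarith
    then show ?thesis
    proof cases
      case 3
      have jr: "real r \<le> real j0 - real i" using i r(3) by linarith
      let ?k = "min (real i) (real r)"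
      have "real A \<le> ?k" using 3 r(1) by simp
      then have mx: "max (real A) ?k = ?k" by simp
      have X: "\<bar>X i\<bar> < c / 2 * ?k" using H2[of i] 3 i unfolding mx by simp
      \<comment> \<open>Half of the drift \<open>c * ?k\<close> absorbs the noise; the other half
        absorbs \<open>C\<close>, as \<open>?k\<close> is at least \<open>A\<close>.\<close>
      have "c * ?k \<le> c * min (real i) (real j0 - real i)"
        using jr params(1) by (intro mult_left_mono) auto
      also have "\<dots> - C \<le> m i" using m1[of i] i by simp
      finally have "c * ?k - C \<le> m i" by simp
      moreover have "c / 2 * A \<le> c / 2 * ?k" using \<open>real A \<le> ?k\<close> params(1) by (intro mult_left_mono) auto
      ultimately show ?thesis unfolding D using X params(4) by linarith
    qed (use D0 H1 in auto)
  qed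
  \<comment> \<open>The hypotheses control sums that start at the left end of the window, so values
    are compared through that point, which doubles \<open>e\<close>.\<close>
  have X0: "\<bar>X i - X j0\<bar> \<le> 2 * e" if "j0 - r \<le> i" "i \<le> j0 + r" for i
  proof (cases "i = j0 - r")
    case True
    then show ?thesis using H3[of j0] r by simp
  next
    case False
    then show ?thesis using H3[of i] H3[of j0] r that by simp
  qed
  have Y0: "\<bar>Y i - Y j0\<bar> \<le> 2 * e" if "j0 - r \<le> i" "i \<le> j0 + r" for i
  proof (cases "i = j0 - r")
    case True
    then show ?thesis using H4[of j0] r by simp
  next
    case False
    then show ?thesis using H4[of i] H4[of j0] r that by simp
  qed
  have lin: "\<bar>D i - (X j0 - g * (real i - real j0))\<bar> \<le> 3 * e + C" if "j0 - r \<le> i" "i \<le> j0 + r" for i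
    unfolding D using X0[OF that] m3[OF that] m2 by linarith
  \<comment> \<open>The noise at \<open>j0\<close> is below \<open>c / 2 * r\<close>, while the mean
    has dropped by about \<open>g * r\<close>, which is at least \<open>c * r\<close>. This use of
    \<open>c \<le> g\<close> is the reason why \<open>rate\<close> is a minimum with
    \<open>slope\<close>.\<close>
  have neg: "D (j0 + r) < 0"
  proof -
    have "max (real A) (min (real j0) (real r)) = real r" using r by simp
    then have "X j0 < c / 2 * r" using H2[of j0] r by simp
    moreover have "c * r \<le> g * r" using params by (intro mult_right_mono) auto
    moreover have "g * (real (j0 + r) - real j0) = g * r" by simp
    moreover have "j0 - r \<le> j0 + r" by linarith
    ultimately show ?thesis using lin[of "j0 + r"] params(5) by simp
  qed
  define I where "I = (LEAST i. D i < 0)"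
  have DI: "D I < 0" unfolding I_def using neg by (rule LeastI)
  have Iu: "I \<le> j0 + r" unfolding I_def using neg by (rule Least_le)
  have min: "0 \<le> D i" if "i < I" for i
    using that not_less_Least[of i "\<lambda>i. D i < 0"] unfolding I_def by simp
  have Il: "j0 - r < I" using early[of I] DI by linarith
  have I1: "1 \<le> I" using Il by simp
  have "0 \<le> D (I - 1)" using min[of "I - 1"] I1 by simp
  have "g * (real (I - 1) - real j0) \<le> X j0 + 3 * e + C"
  proof -
    have "j0 - r \<le> I - 1" "I - 1 \<le> j0 + r" using Il Iu by linarith+
    from lin[OF this] \<open>0 \<le> D (I - 1)\<close> show ?thesis by linarith
  qed
  moreover have "g * (real (I - 1) - real j0) = g * (real I - real j0) - g"
    using I1 by (simp add: of_nat_diff algebra_simps)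
  moreover have "g * (real I - real j0) \<ge> X j0 - 3 * e - C"
    using lin[of I] Il Iu DI by simp
  ultimately have "\<bar>g * (real I - real j0) - X j0\<bar> \<le> 3 * e + C + g"
    using params by (simp add: abs_le_iff)
  moreover have "\<bar>S I - a * I - Y j0\<bar> \<le> 2 * e"
    using Y0[of I] Il Iu by (simp add: S)
  ultimately show ?thesis using that I1 Iu min DI by blast
qed

section \<open>Fluctuations of the exploration walk\<close>

lemma indep_fst_snd_pair_pmf:
  fixes P :: "'x :: countable pmf" and Q :: "'y :: countable pmf" and f :: "'x \<Rightarrow> real" and g :: "'y \<Rightarrow> real"
  shows "prob_space.indep_var (measure_pmf (pair_pmf P Q)) borel (\<lambda>x. f (fst x)) borel (\<lambda>x. g (snd x))"
proof -
  let ?M = "pair_pmf P Q"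
  let ?F = "{(\<lambda>x. f (fst x)) -` A \<inter> space (measure_pmf ?M) |A. A \<in> sets (borel :: real measure)}"
  let ?S = "{(\<lambda>x. g (snd x)) -` A \<inter> space (measure_pmf ?M) |A. A \<in> sets (borel :: real measure)}"
  have P1: "measure_pmf.prob ?M (fst -` A) = measure_pmf.prob P A" for A
    using measure_map_pmf[of fst ?M A] by (simp add: map_fst_pair_pmf)
  have P2: "measure_pmf.prob ?M (snd -` A) = measure_pmf.prob Q A" for A
    using measure_map_pmf[of snd ?M A] by (simp add: map_snd_pair_pmf)
  have stable: "Int_stable {h -` A \<inter> space (measure_pmf ?M) |A. A \<in> sets (borel :: real measure)}" for h
  proof (rule Int_stableI)
    fix a b assume "a \<in> {h -` A \<inter> space (measure_pmf ?M) |A. A \<in> sets borel}"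
      "b \<in> {h -` A \<inter> space (measure_pmf ?M) |A. A \<in> sets borel}"
    then obtain A B where AB: "a = h -` A \<inter> space (measure_pmf ?M)" "b = h -` B \<inter> space (measure_pmf ?M)"
      "A \<in> sets borel" "B \<in> sets borel" by blast
    have "a \<inter> b = h -` (A \<inter> B) \<inter> space (measure_pmf ?M)" unfolding AB by auto
    then show "a \<inter> b \<in> {h -` A \<inter> space (measure_pmf ?M) |A. A \<in> sets borel}"
      using sets.Int[OF AB(3,4)] by blast
  qed
  have "prob_space.indep_set (measure_pmf ?M) ?F ?S"
    proof (rule prob_space.indep_setI[OF measure_pmf.prob_space_axioms])
      fix a b assume "a \<in> ?F" "b \<in> ?S"
      then obtain A B where ab: "a = fst -` (f -` A)" "b = snd -` (g -` B)" by auto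
      have "a \<inter> b = (f -` A) \<times> (g -` B)" by (auto simp: ab)
      then have "measure_pmf.prob ?M (a \<inter> b) = measure_pmf.prob P (f -` A) * measure_pmf.prob Q (g -` B)"
        by (simp add: measure_pmf_prob_product countableI_type)
      then show "measure_pmf.prob ?M (a \<inter> b) = measure_pmf.prob ?M a * measure_pmf.prob ?M b"
        by (simp add: ab P1 P2)
    qed auto
  from prob_space.indep_set_sigma_sets[OF measure_pmf.prob_space_axioms this stable stable]
  show ?thesis unfolding prob_space.indep_var_eq[OF measure_pmf.prob_space_axioms] by simp
qed

text \<open>The first \<open>A\<close> terms contribute \<open>1 / A\<close> together, and the tail
  telescopes to at most \<open>1 / A\<close>. With thresholds proportional to
  \<open>max A i\<close>, this bounds the probability of an early crossing uniformly in
  \<open>n\<close>.\<close>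

lemma sum_inverse_max_squares:
  assumes A: "1 \<le> (A :: nat)"
  shows "(\<Sum>i\<in>{0<..N}. 1 / (max (real A) (real i))\<^sup>2) \<le> 2 / A"
proof -
  have le: "(\<Sum>i\<in>{0<..N}. 1 / (max (real A) (real i))\<^sup>2) = N / (real A)\<^sup>2" if "N \<le> A" for N
  proof -
    have "(\<Sum>i\<in>{0<..N}. 1 / (max (real A) (real i))\<^sup>2) = (\<Sum>i\<in>{0<..N}. 1 / (real A)\<^sup>2)"
      using that by (intro sum.cong refl) simp
    then show ?thesis by simp
  qed
  have ge: "(\<Sum>i\<in>{0<..N}. 1 / (max (real A) (real i))\<^sup>2) \<le> 2 / A - 1 / N" if "A \<le> N" for N
    using that
  proof (induction N rule: dec_induct)
    case base
    then show ?case using A by (simp add: le power2_eq_square)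
  next
    case (step N)
    have N: "0 < N" using step A by simp
    have "1 / (real (Suc N))\<^sup>2 \<le> 1 / (real N * real (Suc N))"
      using N by (intro divide_left_mono) (auto simp: power2_eq_square mult_right_mono)
    also have "\<dots> = 1 / N - 1 / Suc N" using N by (simp add: divide_simps)
    finally have *: "1 / (real (Suc N))\<^sup>2 \<le> 1 / N - 1 / Suc N" .
    have "max (real A) (real (Suc N)) = real (Suc N)" using step by simp
    then show ?case using * step.IH by (simp add: greaterThanAtMost_Suc)
  qed
  show ?thesis
  proof (cases "N \<le> A")
    case True
    have "N / (real A)\<^sup>2 \<le> A / (real A)\<^sup>2" using True by (intro divide_right_mono) auto
    also have "\<dots> \<le> 2 / A" using A by (simp add: power2_eq_square divide_right_mono)
    finally show ?thesis using le[OF True] by simp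
  next
    case False
    have "0 \<le> 1 / real N" by simp
    moreover have "A \<le> N" using False by simp
    ultimately show ?thesis using ge[of N] by linarith
  qed
qed

locale walk_model = drift EK \<theta> p for EK \<theta> p :: real +
  fixes \<mu> :: "nat pmf" and VarK :: real
  assumes EK_def: "EK = measure_pmf.expectation \<mu> real"
    and EK_sq: "integrable (measure_pmf \<mu>) (\<lambda>k. (real k)\<^sup>2)"
    and VarK_def: "VarK = measure_pmf.variance \<mu> real"
begin

abbreviation walk_prob :: "nat \<Rightarrow> (nat \<Rightarrow> nat \<times> nat) set \<Rightarrow> real" where
  "walk_prob n \<equiv> measure_pmf.prob (walk_pmf \<mu> n)"

lemma offspring_centred:
  shows "integrable (measure_pmf \<mu>) real"
    and "integrable (measure_pmf \<mu>) (\<lambda>k. real k - EK)"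
    and "measure_pmf.expectation \<mu> (\<lambda>k. real k - EK) = 0"
    and "integrable (measure_pmf \<mu>) (\<lambda>k. (real k - EK)\<^sup>2)"
    and "measure_pmf.expectation \<mu> (\<lambda>k. (real k - EK)\<^sup>2) = VarK"
proof -
  show 1: "integrable (measure_pmf \<mu>) real"
    using EK_sq by (rule measure_pmf.square_integrable_imp_integrable[rotated]) simp
  show "integrable (measure_pmf \<mu>) (\<lambda>k. real k - EK)" using 1 by simp
  show "measure_pmf.expectation \<mu> (\<lambda>k. real k - EK) = 0" using 1 by (simp add: EK_def)
  have eq: "(real k - EK)\<^sup>2 = (real k)\<^sup>2 - 2 * EK * real k + EK\<^sup>2" for k by (simp add: power2_diff)
  show "integrable (measure_pmf \<mu>) (\<lambda>k. (real k - EK)\<^sup>2)"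
    unfolding eq using 1 EK_sq by simp
  show "measure_pmf.expectation \<mu> (\<lambda>k. (real k - EK)\<^sup>2) = VarK"
    by (simp add: VarK_def EK_def)
qed

lemma VarK_nonneg: "0 \<le> VarK"
  unfolding VarK_def by simp

lemma walk_component:
  assumes "1 \<le> i" "i < n"
  shows "map_pmf (\<lambda>\<omega>. \<omega> i) (walk_pmf \<mu> n) = pair_pmf \<mu> (geo_delay n i)"
  using assms by (simp add: walk_pmf_def Pi_pmf_component)

lemma walk_indep:
  "prob_space.indep_vars (measure_pmf (walk_pmf \<mu> n)) (\<lambda>_. count_space UNIV) (\<lambda>i \<omega>. \<omega> i) {1..<n}"
  unfolding walk_pmf_def by (rule indep_vars_Pi_pmf) simp

text \<open>One family for all sums: the coefficients \<open>(1, -1)\<close> give the centred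
  increment of the balance, \<open>(1, 0)\<close> that of the offspring sum, and both limit
  variables are further linear combinations.\<close>

definition incr :: "real \<Rightarrow> real \<Rightarrow> nat \<Rightarrow> nat \<Rightarrow> nat \<times> nat \<Rightarrow> real" where
  "incr a b n i x = a * (real (fst x) - EK) + b * (real (snd x) - geo_mean n i)"

lemma incr_indep:
  assumes "I \<subseteq> {1..<n}"
  shows "prob_space.indep_vars (measure_pmf (walk_pmf \<mu> n)) (\<lambda>_. borel) (\<lambda>i \<omega>. incr a b n i (\<omega> i)) I"
  by (rule prob_space.indep_vars_subset[OF measure_pmf.prob_space_axioms _ assms],
      rule prob_space.indep_vars_compose2[OF measure_pmf.prob_space_axioms walk_indep]) simp

definition incr_bound :: "real \<Rightarrow> real \<Rightarrow> real" where
  "incr_bound a b = 2 * a\<^sup>2 * VarK + 2 * b\<^sup>2 * mean_cap\<^sup>2"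

lemma incr_bound_nonneg: "0 \<le> incr_bound a b"
  using VarK_nonneg by (simp add: incr_bound_def)

lemma geo_var_le:
  assumes "0 < n" "real i \<le> p_cap * n"
  shows "geo_var n i \<le> mean_cap\<^sup>2"
proof -
  have x: "0 \<le> real i / n" "real i / n \<le> p_cap" using assms by (simp_all add: divide_le_eq)
  have "geo_var n i = real i / n * (1 / (1 - real i / n))\<^sup>2"
    by (simp add: geo_var_def power_divide)
  also have "\<dots> \<le> 1 * mean_cap\<^sup>2"
    using x p_cap_bounds unfolding mean_cap_def
    by (intro mult_mono power_mono divide_left_mono) auto
  finally show ?thesis by simp
qed

lemma incr_moments:
  assumes i: "1 \<le> i" "i < n"
  shows "measure_pmf.expectation (walk_pmf \<mu> n) (\<lambda>\<omega>. incr a b n i (\<omega> i)) = 0"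
    and "integrable (measure_pmf (walk_pmf \<mu> n)) (\<lambda>\<omega>. (incr a b n i (\<omega> i))\<^sup>2)"
    and "real i \<le> p_cap * n \<Longrightarrow>
      measure_pmf.expectation (walk_pmf \<mu> n) (\<lambda>\<omega>. (incr a b n i (\<omega> i))\<^sup>2) \<le> incr_bound a b"
proof -
  let ?P = "pair_pmf \<mu> (geo_delay n i)"
  have E: "measure_pmf.expectation (walk_pmf \<mu> n) (\<lambda>\<omega>. h (\<omega> i)) = measure_pmf.expectation ?P h" for h :: "nat \<times> nat \<Rightarrow> real"
    unfolding walk_component[OF i, symmetric] by simp
  have Int: "integrable (measure_pmf (walk_pmf \<mu> n)) (\<lambda>\<omega>. h (\<omega> i)) \<longleftrightarrow> integrable (measure_pmf ?P) h" for h :: "nat \<times> nat \<Rightarrow> real"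
    unfolding walk_component[OF i, symmetric] by simp
  have If: "integrable (measure_pmf ?P) (\<lambda>x. h (fst x)) \<longleftrightarrow> integrable (measure_pmf \<mu>) h" for h :: "nat \<Rightarrow> real"
    using integrable_map_pmf_eq[of fst ?P h] by (simp add: map_fst_pair_pmf)
  have Is: "integrable (measure_pmf ?P) (\<lambda>x. h (snd x)) \<longleftrightarrow> integrable (measure_pmf (geo_delay n i)) h" for h :: "nat \<Rightarrow> real"
    using integrable_map_pmf_eq[of snd ?P h] by (simp add: map_snd_pair_pmf)
  note o = offspring_centred and g = geo_delay_centred[OF i]
  have i1: "integrable (measure_pmf ?P) (\<lambda>x. real (fst x) - EK)" "integrable (measure_pmf ?P) (\<lambda>x. real (snd x) - geo_mean n i)"
    using o(2) g(1) If[of "\<lambda>k. real k - EK"] Is[of "\<lambda>k. real k - geo_mean n i"] by simp_all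
  have i2: "integrable (measure_pmf ?P) (\<lambda>x. (real (fst x) - EK)\<^sup>2)" "integrable (measure_pmf ?P) (\<lambda>x. (real (snd x) - geo_mean n i)\<^sup>2)"
    using o(4) g(3) If[of "\<lambda>k. (real k - EK)\<^sup>2"] Is[of "\<lambda>k. (real k - geo_mean n i)\<^sup>2"] by simp_all
  have e1: "measure_pmf.expectation ?P (\<lambda>x. real (fst x) - EK) = 0"
    using o(3) expectation_pair_pmf_fst[of \<mu> "geo_delay n i" "\<lambda>k. real k - EK"] by simp
  have e2: "measure_pmf.expectation ?P (\<lambda>x. real (snd x) - geo_mean n i) = 0"
    using g(2) expectation_pair_pmf_snd[of \<mu> "geo_delay n i" "\<lambda>k. real k - geo_mean n i"] by simp
  have e3: "measure_pmf.expectation ?P (\<lambda>x. (real (fst x) - EK)\<^sup>2) = VarK"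
    using o(5) expectation_pair_pmf_fst[of \<mu> "geo_delay n i" "\<lambda>k. (real k - EK)\<^sup>2"] by simp
  have e4: "measure_pmf.expectation ?P (\<lambda>x. (real (snd x) - geo_mean n i)\<^sup>2) = geo_var n i"
    using g(4) expectation_pair_pmf_snd[of \<mu> "geo_delay n i" "\<lambda>k. (real k - geo_mean n i)\<^sup>2"] by simp
  show "measure_pmf.expectation (walk_pmf \<mu> n) (\<lambda>\<omega>. incr a b n i (\<omega> i)) = 0"
    unfolding E[of "incr a b n i"] unfolding incr_def using i1 e1 e2 by simp
  let ?d = "\<lambda>x::nat\<times>nat. 2 * a\<^sup>2 * (real (fst x) - EK)\<^sup>2 + 2 * b\<^sup>2 * (real (snd x) - geo_mean n i)\<^sup>2"
  have d_int: "integrable (measure_pmf ?P) ?d" using i2 by simp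
  have d: "(incr a b n i x)\<^sup>2 \<le> ?d x" for x
  proof -
    have "(y + z)\<^sup>2 \<le> 2 * y\<^sup>2 + 2 * z\<^sup>2" for y z :: real
      using sum_squares_bound[of y z] by (simp add: power2_sum)
    from this[of "a * (real (fst x) - EK)" "b * (real (snd x) - geo_mean n i)"]
    show ?thesis by (simp add: incr_def power_mult_distrib mult_ac)
  qed
  have sq: "integrable (measure_pmf ?P) (\<lambda>x. (incr a b n i x)\<^sup>2)"
    using d_int by (rule Bochner_Integration.integrable_bound) (use d in \<open>auto intro!: always_eventually order_trans[OF d]\<close>)
  then show "integrable (measure_pmf (walk_pmf \<mu> n)) (\<lambda>\<omega>. (incr a b n i (\<omega> i))\<^sup>2)"
    using Int[of "\<lambda>x. (incr a b n i x)\<^sup>2"] by simp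
  assume p_cap: "real i \<le> p_cap * n"
  have "measure_pmf.expectation (walk_pmf \<mu> n) (\<lambda>\<omega>. (incr a b n i (\<omega> i))\<^sup>2) = measure_pmf.expectation ?P (\<lambda>x. (incr a b n i x)\<^sup>2)"
    by (rule E)
  also have "\<dots> \<le> measure_pmf.expectation ?P ?d"
    using sq d_int d by (rule integral_mono)
  also have "\<dots> = 2 * a\<^sup>2 * VarK + 2 * b\<^sup>2 * geo_var n i"
    using i2 e3 e4 by simp
  also have "\<dots> \<le> incr_bound a b"
    unfolding incr_bound_def using geo_var_le[of n i] i p_cap by (intro add_left_mono mult_left_mono) auto
  finally show "measure_pmf.expectation (walk_pmf \<mu> n) (\<lambda>\<omega>. (incr a b n i (\<omega> i))\<^sup>2) \<le> incr_bound a b" .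
qed

lemma walk_maximal:
  assumes "l \<le> u" "u < n" "real u \<le> p_cap * n"
    and "\<And>i. i \<in> {l<..u} \<Longrightarrow> 0 < c i" "\<And>i. l < i \<Longrightarrow> i < u \<Longrightarrow> c i \<le> c (Suc i)"
  shows "walk_prob n {\<omega>. \<exists>i\<in>{l<..u}. c i \<le> \<bar>\<Sum>j\<in>{l<..i}. incr a b n j (\<omega> j)\<bar>}
    \<le> (\<Sum>i\<in>{l<..u}. incr_bound a b / (c i)\<^sup>2)"
proof -
  have sub: "{l<..u} \<subseteq> {1..<n}" using assms by auto
  have "walk_prob n
      {\<omega>\<in>space (measure_pmf (walk_pmf \<mu> n)). \<exists>i\<in>{l<..u}. c i \<le> \<bar>\<Sum>j\<in>{l<..i}. incr a b n j (\<omega> j)\<bar>}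
    \<le> (\<Sum>i\<in>{l<..u}. incr_bound a b / (c i)\<^sup>2)"
  proof (rule prob_space.hajek_renyi[OF measure_pmf.prob_space_axioms incr_indep[OF sub] assms(1)])
    fix i assume i: "i \<in> {l<..u}"
    then have "1 \<le> i" "i < n" "real i \<le> p_cap * n" using assms by auto
    then show "integrable (measure_pmf (walk_pmf \<mu> n)) (\<lambda>\<omega>. (incr a b n i (\<omega> i))\<^sup>2)"
      "measure_pmf.expectation (walk_pmf \<mu> n) (\<lambda>\<omega>. incr a b n i (\<omega> i)) = 0"
      "measure_pmf.expectation (walk_pmf \<mu> n) (\<lambda>\<omega>. (incr a b n i (\<omega> i))\<^sup>2) \<le> incr_bound a b"
      by (auto intro: incr_moments)
  qed (use assms in auto)
  then show ?thesis by simp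
qed

lemma walk_maximal_const:
  assumes "l \<le> u" "u < n" "real u \<le> p_cap * n" "0 < c"
  shows "walk_prob n {\<omega>. \<exists>i\<in>{l<..u}. c \<le> \<bar>\<Sum>j\<in>{l<..i}. incr a b n j (\<omega> j)\<bar>}
    \<le> real (u - l) * incr_bound a b / c\<^sup>2"
  using walk_maximal[of l u n "\<lambda>_. c" a b] assms by simp

end

section \<open>The first passage in terms of centred sums\<close>

context walk_model
begin

definition balance :: "(nat \<Rightarrow> nat \<times> nat) \<Rightarrow> nat \<Rightarrow> real" where
  "balance \<omega> j = (\<Sum>i\<in>{1..j}. real (fst (\<omega> i)) - real (snd (\<omega> i)))"

definition offspring_sum :: "(nat \<Rightarrow> nat \<times> nat) \<Rightarrow> nat \<Rightarrow> real" where
  "offspring_sum \<omega> j = (\<Sum>i\<in>{1..j}. real (fst (\<omega> i)))"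

definition incr_sum :: "real \<Rightarrow> real \<Rightarrow> nat \<Rightarrow> (nat \<Rightarrow> nat \<times> nat) \<Rightarrow> nat \<Rightarrow> real" where
  "incr_sum a b n \<omega> j = (\<Sum>i\<in>{1..j}. incr a b n i (\<omega> i))"

definition pivot :: "nat \<Rightarrow> nat" where "pivot n = nat \<lfloor>p * n\<rfloor>"

text \<open>The sum starts after \<open>A\<close> to keep clear of the increments that decide
  survival.\<close>

definition window_sum :: "nat \<Rightarrow> real \<Rightarrow> real \<Rightarrow> nat \<Rightarrow> (nat \<Rightarrow> nat \<times> nat) \<Rightarrow> real" where
  "window_sum A a b n \<omega> = (\<Sum>i\<in>{A<..pivot n}. incr a b n i (\<omega> i)) / sqrt n"

lemma balance_eq: "balance \<omega> j = incr_sum 1 (- 1) n \<omega> j + drift_sum n j"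
  by (simp add: balance_def incr_sum_def incr_def drift_sum_def sum.distrib[symmetric] algebra_simps)

lemma offspring_sum_eq: "offspring_sum \<omega> j = incr_sum 1 0 n \<omega> j + EK * j"
  by (simp add: offspring_sum_def incr_sum_def incr_def sum_subtractf algebra_simps)

lemma incr_linear: "incr a b n i x = (a + b) * incr 1 0 n i x - b * incr 1 (- 1) n i x"
  by (simp add: incr_def algebra_simps)

lemma incr_sum_linear: "incr_sum a b n \<omega> j = (a + b) * incr_sum 1 0 n \<omega> j - b * incr_sum 1 (- 1) n \<omega> j"
  unfolding incr_sum_def sum_distrib_left sum_subtractf[symmetric] incr_linear[of a b] ..

lemma incr_sum_diff: "l \<le> i \<Longrightarrow> (\<Sum>j\<in>{l<..i}. incr a b n j (\<omega> j)) = incr_sum a b n \<omega> i - incr_sum a b n \<omega> l"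
proof -
  assume "l \<le> i"
  then have "{1..i} = {1..l} \<union> {l<..i}" by auto
  then have "incr_sum a b n \<omega> i = incr_sum a b n \<omega> l + (\<Sum>j\<in>{l<..i}. incr a b n j (\<omega> j))"
    unfolding incr_sum_def by (simp only:) (rule sum.union_disjoint, auto)
  then show ?thesis by simp
qed

lemma pivot_bounds: "real (pivot n) \<le> p * n" "p * n < real (pivot n) + 1"
proof -
  have "0 \<le> p * n" using p_bounds by simp
  then show "real (pivot n) \<le> p * n" "p * n < real (pivot n) + 1" unfolding pivot_def by linarith+
qed

text \<open>Origin of the coefficients: near the pivot the balance falls by \<open>slope\<close> per
  index, so the passage index is shifted by the \<open>(1, -1)\<close> sum divided by
  \<open>slope\<close>. The duration is the offspring sum at \<open>I\<close>, that is the
  \<open>(1, 0)\<close> sum plus \<open>EK * I\<close>, which leads to \<open>(1, 0)\<close> plus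
  \<open>EK / slope\<close> times \<open>(1, -1)\<close>.\<close>

definition near_passage :: "nat \<Rightarrow> nat \<Rightarrow> real \<Rightarrow> (nat \<Rightarrow> nat \<times> nat) \<Rightarrow> nat \<Rightarrow> bool" where
  "near_passage n A \<epsilon> \<omega> I \<longleftrightarrow> 1 \<le> I \<and> I < n \<and> (\<forall>i. 1 \<le> i \<and> i < I \<longrightarrow> 0 \<le> balance \<omega> i) \<and> balance \<omega> I < 0 \<and>
    \<bar>(real I - n * p) / sqrt n - window_sum A (1 / slope) (- 1 / slope) n \<omega>\<bar> \<le> \<epsilon> \<and>
    \<bar>(offspring_sum \<omega> I - n * \<theta>) / sqrt n - window_sum A (1 + EK / slope) (- EK / slope) n \<omega>\<bar> \<le> \<epsilon>"

text \<open>The numerical conditions on the window radius \<open>r\<close> and the error \<open>e\<close> hold for large \<open>n\<close> when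
  \<open>r\<close> is a large multiple of \<open>sqrt n\<close> and \<open>e\<close> a small one.\<close>

lemma near_passage_exists:
  fixes n A r :: nat and e \<epsilon> :: real and \<omega> :: "nat \<Rightarrow> nat \<times> nat"
  assumes n: "0 < n"
    and H1: "\<And>i. 1 \<le> i \<Longrightarrow> i \<le> A \<Longrightarrow> 0 \<le> balance \<omega> i"
    and H2: "\<not> (\<exists>i\<in>{0<..pivot n}. rate / 2 * max (real A) (min (real i) (real r)) \<le> \<bar>\<Sum>j\<in>{0<..i}. incr 1 (- 1) n j (\<omega> j)\<bar>)"
    and H3: "\<not> (\<exists>i\<in>{pivot n - r<..pivot n + r}. e \<le> \<bar>\<Sum>j\<in>{pivot n - r<..i}. incr 1 (- 1) n j (\<omega> j)\<bar>)"
    and H4: "\<not> (\<exists>i\<in>{pivot n - r<..pivot n + r}. e \<le> \<bar>\<Sum>j\<in>{pivot n - r<..i}. incr 1 0 n j (\<omega> j)\<bar>)"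
    and H5: "\<not> (\<exists>i\<in>{0<..A}. e \<le> \<bar>\<Sum>j\<in>{0<..i}. incr 1 (- 1) n j (\<omega> j)\<bar>)"
    and H6: "\<not> (\<exists>i\<in>{0<..A}. e \<le> \<bar>\<Sum>j\<in>{0<..i}. incr 1 0 n j (\<omega> j)\<bar>)"
    and r: "1 \<le> A" "A \<le> r" "r \<le> pivot n" "real (pivot n) + r \<le> p_cap * n"
    and lin: "real r * (mean_cap\<^sup>2 * (real r + 1) / n) \<le> e"
    and params: "0 < e" "mean_cap \<le> rate / 2 * A" "3 * e + mean_cap < rate / 2 * r"
    and err: "e * (4 + 4 * (EK + 1) / slope) + (EK + 1) * (mean_cap / slope + 2) \<le> \<epsilon> * sqrt n"
  shows "\<exists>I. near_passage n A \<epsilon> \<omega> I"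
proof -
  have s: "0 < slope" by (rule slope_pos)
  have K: "0 < EK" using EK_gt_1 by simp
  have Xi0: "(\<Sum>j\<in>{0<..i}. incr a b n j (\<omega> j)) = incr_sum a b n \<omega> i" for a b i
    using incr_sum_diff[of 0 i a b n \<omega>] by (simp add: incr_sum_def)
  have sq: "0 < sqrt n" using n by simp
  obtain I where I: "1 \<le> I" "I \<le> pivot n + r" "\<And>i. 1 \<le> i \<Longrightarrow> i < I \<Longrightarrow> 0 \<le> balance \<omega> i" "balance \<omega> I < 0"
    and I5: "\<bar>slope * (real I - real (pivot n)) - incr_sum 1 (- 1) n \<omega> (pivot n)\<bar> \<le> 3 * e + mean_cap + slope"
    and I6: "\<bar>offspring_sum \<omega> I - EK * I - incr_sum 1 0 n \<omega> (pivot n)\<bar> \<le> 2 * e"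
  proof (rule first_passage_linearisation[of "balance \<omega>" "incr_sum 1 (- 1) n \<omega>" "drift_sum n" "offspring_sum \<omega>" "incr_sum 1 0 n \<omega>" EK A
        "pivot n" rate r e mean_cap slope])
    show "balance \<omega> i = incr_sum 1 (- 1) n \<omega> i + drift_sum n i" for i by (rule balance_eq)
    show "offspring_sum \<omega> i = incr_sum 1 0 n \<omega> i + EK * i" for i by (rule offspring_sum_eq)
    show "balance \<omega> 0 = 0" by (simp add: balance_def)
    show "0 \<le> balance \<omega> i" if "1 \<le> i" "i \<le> A" for i using that by (rule H1)
    show "\<bar>incr_sum 1 (- 1) n \<omega> i\<bar> < rate / 2 * max (real A) (min (real i) (real r))" if "1 \<le> i" "i \<le> pivot n" for i
      using H2 that unfolding Xi0 by (auto simp: not_le)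
    show "\<bar>incr_sum 1 (- 1) n \<omega> i - incr_sum 1 (- 1) n \<omega> (pivot n - r)\<bar> < e"
      if "pivot n - r < i" "i \<le> pivot n + r" for i
    proof -
      have "i \<in> {pivot n - r<..pivot n + r}" using that by simp
      then have "\<not> e \<le> \<bar>\<Sum>j\<in>{pivot n - r<..i}. incr 1 (- 1) n j (\<omega> j)\<bar>" using H3 by blast
      then show ?thesis using incr_sum_diff[of "pivot n - r" i 1 "- 1" n \<omega>] that by simp
    qed
    show "\<bar>incr_sum 1 0 n \<omega> i - incr_sum 1 0 n \<omega> (pivot n - r)\<bar> < e"
      if "pivot n - r < i" "i \<le> pivot n + r" for i
    proof -
      have "i \<in> {pivot n - r<..pivot n + r}" using that by simp
      then have "\<not> e \<le> \<bar>\<Sum>j\<in>{pivot n - r<..i}. incr 1 0 n j (\<omega> j)\<bar>" using H4 by blast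
      then show ?thesis using incr_sum_diff[of "pivot n - r" i 1 0 n \<omega>] that by simp
    qed
    show "rate * min (real i) (real (pivot n) - real i) - mean_cap \<le> drift_sum n i" if "i \<le> pivot n" for i
    proof -
      have "rate * min (real i) (real (pivot n) - real i) \<le> rate * min (real i) (p * n - i)"
        using pivot_bounds(1)[of n] rate_pos by (intro mult_left_mono) auto
      moreover have "rate * min (real i) (p * n - i) - mean_cap \<le> drift_sum n i"
        using pivot_bounds(1)[of n] that by (intro drift_sum_lower n) linarith
      ultimately show ?thesis by linarith
    qed
    show "\<bar>drift_sum n (pivot n)\<bar> \<le> mean_cap" unfolding pivot_def using n by (rule drift_sum_at_zero)
    show "\<bar>drift_sum n i - drift_sum n (pivot n) + slope * (real i - real (pivot n))\<bar> \<le> e"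
      if "pivot n - r \<le> i" "i \<le> pivot n + r" for i
    proof -
      have "\<bar>drift_sum n i - drift_sum n (pivot n) + slope * (real i - real (pivot n))\<bar> \<le> real r * (mean_cap\<^sup>2 * (real r + 1) / n)"
        using that r pivot_bounds[of n] by (intro drift_sum_linear n) linarith+
      then show ?thesis using lin by linarith
    qed
  qed (use r params rate_pos rate_le in auto)
  define d where "d = incr_sum 1 (- 1) n \<omega> (pivot n)"
  define z where "z = incr_sum 1 0 n \<omega> (pivot n)"
  define d' where "d' = incr_sum 1 (- 1) n \<omega> A"
  define z' where "z' = incr_sum 1 0 n \<omega> A"
  have d': "\<bar>d'\<bar> \<le> e" and z': "\<bar>z'\<bar> \<le> e"
    using H5 H6 r(1) unfolding d'_def z'_def Xi0 by (auto simp: not_le intro: less_imp_le)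
  \<comment> \<open>Every pair of coefficients is decomposed along \<open>(1, 0)\<close> and
    \<open>(1, -1)\<close>; \<open>z'\<close> and \<open>d'\<close> are the omitted initial
    parts.\<close>
  have Wsum: "window_sum A a b n \<omega> * sqrt n = (a + b) * (z - z') - b * (d - d')" for a b
  proof -
    have "window_sum A a b n \<omega> * sqrt n = incr_sum a b n \<omega> (pivot n) - incr_sum a b n \<omega> A"
      using sq r by (simp add: window_sum_def incr_sum_diff)
    also have "\<dots> = (a + b) * (z - z') - b * (d - d')"
      unfolding incr_sum_linear[of a b] by (simp add: d_def z_def d'_def z'_def algebra_simps)
    finally show ?thesis .
  qed
  define x where "x = real I - real (pivot n) - d / slope"
  have x: "\<bar>x\<bar> \<le> (3 * e + mean_cap + slope) / slope"
  proof -
    have "x = (slope * (real I - real (pivot n)) - d) / slope" using s by (simp add: x_def field_simps)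
    then have "\<bar>x\<bar> = \<bar>slope * (real I - real (pivot n)) - d\<bar> / slope" using s by simp
    then show ?thesis using I5 s by (simp add: d_def divide_right_mono)
  qed
  define y where "y = real (pivot n) - p * n"
  have y: "\<bar>y\<bar> \<le> 1" using pivot_bounds[of n] by (simp add: y_def)
  have d's: "\<bar>d' / slope\<bar> \<le> e / slope" using d' s by (simp add: divide_right_mono)
  define B where "B = e * (4 + 4 * (EK + 1) / slope) + (EK + 1) * (mean_cap / slope + 2)"
  have 1: "\<bar>(real I - n * p) / sqrt n - window_sum A (1 / slope) (- 1 / slope) n \<omega>\<bar> \<le> \<epsilon>"
  proof -
    \<comment> \<open>Three errors: linearisation \<open>x\<close>, rounding \<open>y\<close> of
      \<open>p * n\<close>, and the omitted start \<open>d' / slope\<close>.\<close>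
    have "(real I - n * p) - window_sum A (1 / slope) (- 1 / slope) n \<omega> * sqrt n = x + y + d' / slope"
      unfolding Wsum using s by (simp add: x_def y_def field_simps)
    also have "\<bar>\<dots>\<bar> \<le> (3 * e + mean_cap + slope) / slope + 1 + e / slope"
      using x y d's by linarith
    also have "\<dots> = e * (4 * 1 / slope) + 1 * (mean_cap / slope + 2)"
      using s by (simp add: field_simps)
    also have "\<dots> \<le> B"
      unfolding B_def using params K s mean_cap_ge_1
      by (intro add_mono mult_mono divide_right_mono) (auto intro!: add_nonneg_nonneg divide_nonneg_pos add_increasing divide_right_mono)
    also have "\<dots> \<le> \<epsilon> * sqrt n" using err by (simp add: B_def)
    finally have *: "\<bar>(real I - n * p) - window_sum A (1 / slope) (- 1 / slope) n \<omega> * sqrt n\<bar> \<le> \<epsilon> * sqrt n" .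
    have "(real I - n * p) / sqrt n - window_sum A (1 / slope) (- 1 / slope) n \<omega> =
        ((real I - n * p) - window_sum A (1 / slope) (- 1 / slope) n \<omega> * sqrt n) / sqrt n"
      using sq by (simp add: field_simps)
    then show ?thesis using * sq by (simp add: divide_le_eq)
  qed
  have 2: "\<bar>(offspring_sum \<omega> I - n * \<theta>) / sqrt n - window_sum A (1 + EK / slope) (- EK / slope) n \<omega>\<bar> \<le> \<epsilon>"
  proof -
    define w where "w = offspring_sum \<omega> I - EK * I - z"
    have w: "\<bar>w\<bar> \<le> 2 * e" using I6 by (simp add: w_def z_def)
    have "(offspring_sum \<omega> I - n * \<theta>) - window_sum A (1 + EK / slope) (- EK / slope) n \<omega> * sqrt n = w + EK * (x + y + d' / slope) + z'"
      unfolding Wsum using s by (simp add: w_def x_def y_def p_EK[symmetric] field_simps)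
    also have "\<bar>\<dots>\<bar> \<le> \<bar>w\<bar> + \<bar>EK * (x + y + d' / slope)\<bar> + \<bar>z'\<bar>" by linarith
    also have "\<bar>EK * (x + y + d' / slope)\<bar> = EK * \<bar>x + y + d' / slope\<bar>" using K by (simp add: abs_mult)
    also have "\<dots> \<le> EK * ((3 * e + mean_cap + slope) / slope + 1 + e / slope)"
      using x y d's K by (intro mult_left_mono) linarith+
    also have "\<bar>w\<bar> + EK * ((3 * e + mean_cap + slope) / slope + 1 + e / slope) + \<bar>z'\<bar> \<le>
        3 * e + EK * ((3 * e + mean_cap + slope) / slope + 1 + e / slope)"
      using w z' by linarith
    also have "\<dots> = e * (3 + 4 * EK / slope) + EK * (mean_cap / slope + 2)"
      using s by (simp add: field_simps)
    also have "\<dots> \<le> B"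
      unfolding B_def using params K s mean_cap_ge_1
      by (intro add_mono mult_mono divide_right_mono) (auto intro!: add_nonneg_nonneg divide_nonneg_pos add_increasing divide_right_mono)
    also have "\<dots> \<le> \<epsilon> * sqrt n" using err by (simp add: B_def)
    finally have *: "\<bar>(offspring_sum \<omega> I - n * \<theta>) - window_sum A (1 + EK / slope) (- EK / slope) n \<omega> * sqrt n\<bar> \<le> \<epsilon> * sqrt n" 
      by simp
    have "(offspring_sum \<omega> I - n * \<theta>) / sqrt n - window_sum A (1 + EK / slope) (- EK / slope) n \<omega> =
        ((offspring_sum \<omega> I - n * \<theta>) - window_sum A (1 + EK / slope) (- EK / slope) n \<omega> * sqrt n) / sqrt n"
      using sq by (simp add: field_simps)
    then show ?thesis using * sq by (simp add: divide_le_eq)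
  qed
  have "I < n"
  proof -
    have "real I \<le> p_cap * n" using I(2) r(4) by linarith
    also have "\<dots> < 1 * real n" using p_cap_bounds n by (intro mult_strict_right_mono) auto
    finally show ?thesis by simp
  qed
  then have "near_passage n A \<epsilon> \<omega> I"
    unfolding near_passage_def using I 1 2 by blast
  then show ?thesis ..
qed

end

section \<open>Probability of the linearisation, and independence of the start\<close>

context walk_model
begin

text \<open>Constants are chosen in the order \<open>R\<close>, \<open>A0\<close>, \<delta>,
  \<open>n\<close>. Failure of the long-range bound costs two thirds of \<eta>: one from the
  thresholds \<open>max A i\<close>, one from their cap at about \<open>R * sqrt n\<close>. The four
  other failures compare variances of order at most \<open>sqrt n\<close> with squared thresholds of
  order \<open>n\<close>, so for large \<open>n\<close> they fit into the last third. As
  \<open>A0\<close> depends on \<eta> only, the accuracy \<epsilon> may be chosen after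
  \<open>A\<close>.\<close>

theorem near_passage_likely:
  assumes \<eta>: "0 < \<eta>"
  shows "\<exists>A0. \<forall>A\<ge>A0. \<forall>\<epsilon>>0. eventually (\<lambda>n. walk_prob n
    {\<omega>. (\<forall>i. 1 \<le> i \<and> i \<le> A \<longrightarrow> 0 \<le> balance \<omega> i) \<and> \<not> (\<exists>I. near_passage n A \<epsilon> \<omega> I)} \<le> \<eta>) sequentially"
proof -
  note c = rate_pos and s = slope_pos
  define V where "V = incr_bound 1 (- 1) + incr_bound 1 0"
  have V: "0 \<le> V" "incr_bound 1 (- 1) \<le> V" "incr_bound 1 0 \<le> V"
    using incr_bound_nonneg[of 1 "- 1"] incr_bound_nonneg[of 1 0] by (simp_all add: V_def)
  \<comment> \<open>With thresholds \<open>rate / 2 * x\<close> each term of the Hajek-Renyi bound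
    is at most \<open>C / x^2\<close>.\<close>
  define C where "C = 4 * V / rate\<^sup>2"
  have C: "0 \<le> C" using V by (simp add: C_def)
  define R where "R = 1 + 3 * C / \<eta>"
  have R: "1 \<le> R" using C \<eta> by (simp add: R_def)
  have CR: "C / R\<^sup>2 \<le> \<eta> / 3"
  proof -
    have "C \<le> \<eta> / 3 * R" using C \<eta> by (simp add: R_def field_simps)
    also have "\<dots> \<le> \<eta> / 3 * R\<^sup>2" using R \<eta> by (intro mult_left_mono) (auto simp: power2_eq_square)
    finally show ?thesis using R by (simp add: divide_le_eq)
  qed
  define A0 where "A0 = nat \<lceil>max 1 (max (6 * C / \<eta>) (2 * mean_cap / rate))\<rceil>"
  show ?thesis
  proof (intro exI[of _ A0] allI impI)
    fix A :: nat and \<epsilon> :: real assume A: "A0 \<le> A" and \<epsilon>: "0 < \<epsilon>"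
    have A0: "max 1 (max (6 * C / \<eta>) (2 * mean_cap / rate)) \<le> real A0"
      unfolding A0_def by (rule real_nat_ceiling_ge)
    have A_ge: "1 \<le> real A" "6 * C / \<eta> \<le> A" "2 * mean_cap / rate \<le> A"
      using A0 A by (simp_all)
    have A1: "1 \<le> A" using A_ge(1) by simp
    have CA: "C * (2 / A) \<le> \<eta> / 3" using A_ge(2) A1 \<eta> by (simp add: field_simps)
    have cA: "mean_cap \<le> rate / 2 * A" using A_ge(3) c by (simp add: field_simps)
    define L where "L = 4 + 4 * (EK + 1) / slope"
    have L: "0 < L" using s EK_gt_1 by (auto simp: L_def intro!: add_pos_nonneg)
    define B where "B = (EK + 1) * (mean_cap / slope + 2)"
    \<comment> \<open>The first bound brings the final error below \<epsilon>; the second keeps the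
      window wide enough for the walk to turn negative inside it.\<close>
    define \<delta> where "\<delta> = min (\<epsilon> / (2 * L)) (rate * R / 12)"
    have \<delta>: "0 < \<delta>" "\<delta> * L \<le> \<epsilon> / 2" "\<delta> * 12 \<le> rate * R"
    proof -
      show "0 < \<delta>" using \<epsilon> L c R by (simp add: \<delta>_def)
      have "\<delta> * L \<le> \<epsilon> / (2 * L) * L" using L by (intro mult_right_mono) (auto simp: \<delta>_def)
      then show "\<delta> * L \<le> \<epsilon> / 2" using L by simp
      show "\<delta> * 12 \<le> rate * R" by (simp add: \<delta>_def min_def)
    qed
    define w where "w = p_cap - p"
    have w: "0 < w" using p_cap_bounds by (simp add: w_def)
    have Rp: "0 < R" using R by simp
    have rR: "0 < rate * R / 4" using c R by simp
    have pp: "0 < p" by (rule p_bounds)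
    have cqp: "0 < mean_cap" using mean_cap_ge_1 by simp
    have e1: "eventually (\<lambda>n. A \<le> sqrt (real n)) sequentially" by real_asymp
    have e2: "eventually (\<lambda>n. R * sqrt (real n) + 2 \<le> p * real n) sequentially" using Rp pp by real_asymp
    have e3: "eventually (\<lambda>n. R * sqrt (real n) + 1 \<le> w * real n) sequentially" using Rp w by real_asymp
    have e4: "eventually (\<lambda>n. (R * sqrt (real n) + 1) * (mean_cap\<^sup>2 * (R * sqrt (real n) + 2) / real n) \<le> \<delta> * sqrt (real n)) sequentially"
      using Rp \<delta>(1) cqp by real_asymp
    have e5: "eventually (\<lambda>n. mean_cap < rate * R / 4 * sqrt (real n)) sequentially" using rR by real_asymp
    have e6: "eventually (\<lambda>n. B \<le> \<epsilon> / 2 * sqrt (real n)) sequentially" using \<epsilon> by real_asymp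
    have e7: "eventually (\<lambda>n. 4 * (R * sqrt (real n) + 1) * V / (\<delta> * sqrt (real n))\<^sup>2 + 2 * A * V / (\<delta> * sqrt (real n))\<^sup>2 < \<eta> / 3) sequentially"
    proof (rule order_tendstoD(2))
      show "(\<lambda>n. 4 * (R * sqrt (real n) + 1) * V / (\<delta> * sqrt (real n))\<^sup>2 + 2 * A * V / (\<delta> * sqrt (real n))\<^sup>2) \<longlonglongrightarrow> 0"
        using \<delta>(1) by real_asymp
    qed (use \<eta> in simp)
    from e1 e2 e3 e4 e5 e6 e7 eventually_gt_at_top[of 0]
    show "eventually (\<lambda>n. walk_prob n
      {\<omega>. (\<forall>i. 1 \<le> i \<and> i \<le> A \<longrightarrow> 0 \<le> balance \<omega> i) \<and> \<not> (\<exists>I. near_passage n A \<epsilon> \<omega> I)} \<le> \<eta>) sequentially"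
    proof eventually_elim
      case (elim n)
      define r where "r = nat \<lceil>R * sqrt n\<rceil>"
      define e where "e = \<delta> * sqrt n"
      have n: "0 < n" and sq: "0 < sqrt n" using elim by simp_all
      have "0 \<le> R * sqrt n" using R by simp
      then have r: "R * sqrt n \<le> real r" "real r \<le> R * sqrt n + 1" unfolding r_def by linarith+
      have e: "0 < e" using \<delta> sq by (simp add: e_def)
      have "sqrt n \<le> R * sqrt n" using R sq by simp
      then have Ar: "A \<le> r" using elim(1) r by linarith
      have rp: "r \<le> pivot n" using r elim(2) pivot_bounds[of n] by linarith
      have pq: "real (pivot n) + r \<le> p_cap * n"
      proof -
        have "p_cap * n = p * n + w * n" by (simp add: w_def algebra_simps)
        then show ?thesis using r elim(3) pivot_bounds[of n] by linarith
      qed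
      have un: "pivot n + r < n"
      proof -
        have "real (pivot n) + r < 1 * real n" using pq p_cap_bounds n
          by (intro order.strict_trans1[OF pq] mult_strict_right_mono) auto
        then show ?thesis by linarith
      qed
      have pn: "pivot n < n" "real (pivot n) \<le> p_cap * n" "A < n" "real A \<le> p_cap * n" "A \<le> pivot n"
        using un pq Ar rp by linarith+
      have lin: "real r * (mean_cap\<^sup>2 * (real r + 1) / n) \<le> e"
      proof -
        have "real r * (mean_cap\<^sup>2 * (real r + 1) / n) \<le> (R * sqrt n + 1) * (mean_cap\<^sup>2 * (R * sqrt n + 2) / n)"
          using r by (intro mult_mono divide_right_mono) auto
        then show ?thesis using elim(4) by (simp add: e_def)
      qed
      have small: "3 * e + mean_cap < rate / 2 * r"
      proof -
        have "\<delta> * 12 * sqrt n \<le> rate * R * sqrt n" using \<delta>(3) sq by (intro mult_right_mono) auto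
        then have "3 * e \<le> rate * R / 4 * sqrt n" by (simp add: e_def)
        moreover have "rate / 2 * (R * sqrt n) \<le> rate / 2 * r" using r c by (intro mult_left_mono) auto
        ultimately show ?thesis using elim(5) by (simp add: field_simps)
      qed
      have err: "e * (4 + 4 * (EK + 1) / slope) + (EK + 1) * (mean_cap / slope + 2) \<le> \<epsilon> * sqrt n"
      proof -
        have "\<delta> * L * sqrt n \<le> \<epsilon> / 2 * sqrt n" using \<delta>(2) sq by (intro mult_right_mono) auto
        then have "e * L + B \<le> \<epsilon> * sqrt n" using elim(6) by (simp add: e_def mult_ac)
        then show ?thesis by (simp add: L_def B_def)
      qed
      let ?P = "walk_prob n"
      let ?b = "\<lambda>i::nat. rate / 2 * max (real A) (min (real i) (real r))"
      let ?B2 = "{\<omega>. \<exists>i\<in>{0<..pivot n}. ?b i \<le> \<bar>\<Sum>j\<in>{0<..i}. incr 1 (- 1) n j (\<omega> j)\<bar>}"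
      let ?l = "pivot n - r" and ?u = "pivot n + r"
      let ?B3 = "{\<omega>. \<exists>i\<in>{?l<..?u}. e \<le> \<bar>\<Sum>j\<in>{?l<..i}. incr 1 (- 1) n j (\<omega> j)\<bar>}"
      let ?B4 = "{\<omega>. \<exists>i\<in>{?l<..?u}. e \<le> \<bar>\<Sum>j\<in>{?l<..i}. incr 1 0 n j (\<omega> j)\<bar>}"
      let ?B5 = "{\<omega>. \<exists>i\<in>{0<..A}. e \<le> \<bar>\<Sum>j\<in>{0<..i}. incr 1 (- 1) n j (\<omega> j)\<bar>}"
      let ?B6 = "{\<omega>. \<exists>i\<in>{0<..A}. e \<le> \<bar>\<Sum>j\<in>{0<..i}. incr 1 0 n j (\<omega> j)\<bar>}"
      have sub: "{\<omega>. (\<forall>i. 1 \<le> i \<and> i \<le> A \<longrightarrow> 0 \<le> balance \<omega> i) \<and> \<not> (\<exists>I. near_passage n A \<epsilon> \<omega> I)}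
        \<subseteq> ?B2 \<union> (?B3 \<union> ?B4) \<union> (?B5 \<union> ?B6)"
      proof (rule subsetI, rule ccontr)
        fix \<omega> assume 1: "\<omega> \<in> {\<omega>. (\<forall>i. 1 \<le> i \<and> i \<le> A \<longrightarrow> 0 \<le> balance \<omega> i) \<and> \<not> (\<exists>I. near_passage n A \<epsilon> \<omega> I)}"
          and 2: "\<omega> \<notin> ?B2 \<union> (?B3 \<union> ?B4) \<union> (?B5 \<union> ?B6)"
        have "\<exists>I. near_passage n A \<epsilon> \<omega> I"
          using 2 by (intro near_passage_exists[OF n _ _ _ _ _ _ A1 Ar rp pq lin e cA small err])
            (use 1 in \<open>simp_all only: Un_iff mem_Collect_eq de_Morgan_disj simp_thms\<close>)
        then show False using 1 by simp
      qed
      have p2: "?P ?B2 \<le> 2 * (\<eta> / 3)"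
      proof -
        have Ar': "real A \<le> real r" using Ar by simp
        have "?P ?B2 \<le> (\<Sum>i\<in>{0<..pivot n}. incr_bound 1 (- 1) / (?b i)\<^sup>2)"
        proof (rule walk_maximal)
          fix i :: nat assume "i \<in> {0<..pivot n}"
          then show "0 < ?b i" using c A1 by simp
        next
          fix i :: nat
          show "?b i \<le> ?b (Suc i)" using c by (intro mult_left_mono max.mono min.mono) auto
        qed (use pn in auto)
        also have "\<dots> \<le> (\<Sum>i\<in>{0<..pivot n}. C * (1 / (max (real A) (real i))\<^sup>2 + 1 / (real r)\<^sup>2))"
        proof (rule sum_mono)
          fix i assume i: "i \<in> {0<..pivot n}"
          \<comment> \<open>The capped threshold is either \<open>max A i\<close> or
            \<open>r\<close>, so its inverse square is at most the sum of the two inverse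
            squares.\<close>
          define x where "x = max (real A) (min (real i) (real r))"
          have x: "0 < x" using A1 by (simp add: x_def)
          have "1 / x\<^sup>2 \<le> 1 / (max (real A) (real i))\<^sup>2 + 1 / (real r)\<^sup>2"
          proof (cases "i \<le> r")
            case True
            then show ?thesis by (simp add: x_def)
          next
            case False
            then have "x = real r" using Ar' by (simp add: x_def)
            then show ?thesis by simp
          qed
          then have "C * (1 / x\<^sup>2) \<le> C * (1 / (max (real A) (real i))\<^sup>2 + 1 / (real r)\<^sup>2)"
            using C by (rule mult_left_mono)
          moreover have "incr_bound 1 (- 1) / (rate / 2 * x)\<^sup>2 \<le> V / (rate / 2 * x)\<^sup>2"
            using V by (intro divide_right_mono) auto
          moreover have "V / (rate / 2 * x)\<^sup>2 = C * (1 / x\<^sup>2)"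
            by (simp add: C_def power_mult_distrib power_divide)
          ultimately show "incr_bound 1 (- 1) / (rate / 2 * max (real A) (min (real i) (real r)))\<^sup>2
              \<le> C * (1 / (max (real A) (real i))\<^sup>2 + 1 / (real r)\<^sup>2)"
            unfolding x_def by linarith
        qed
        also have "\<dots> = C * (\<Sum>i\<in>{0<..pivot n}. 1 / (max (real A) (real i))\<^sup>2) + C * (pivot n / (real r)\<^sup>2)"
          by (simp add: sum_distrib_left sum.distrib distrib_left mult.commute)
        also have "\<dots> \<le> C * (2 / A) + C * (1 / R\<^sup>2)"
        proof (intro add_mono mult_left_mono C sum_inverse_max_squares A1)
          have "pivot n / (real r)\<^sup>2 \<le> n / (R * sqrt n)\<^sup>2"
            using pn r R sq by (intro frac_le power_mono) auto
          also have "\<dots> = 1 / R\<^sup>2" using n by (simp add: power_mult_distrib)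
          finally show "pivot n / (real r)\<^sup>2 \<le> 1 / R\<^sup>2" .
        qed
        also have "\<dots> \<le> 2 * (\<eta> / 3)" using CA CR by simp
        finally show ?thesis .
      qed
      have e2: "0 < e\<^sup>2" using e by simp
      have ul: "real (?u - ?l) = 2 * real r" using rp by simp
      have win: "?P {\<omega>. \<exists>i\<in>{?l<..?u}. e \<le> \<bar>\<Sum>j\<in>{?l<..i}. incr 1 b n j (\<omega> j)\<bar>} \<le> 2 * (R * sqrt n + 1) * V / e\<^sup>2"
        if "incr_bound 1 b \<le> V" for b
      proof -
        have "?P {\<omega>. \<exists>i\<in>{?l<..?u}. e \<le> \<bar>\<Sum>j\<in>{?l<..i}. incr 1 b n j (\<omega> j)\<bar>} \<le> real (?u - ?l) * incr_bound 1 b / e\<^sup>2"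
          using un pq e by (intro walk_maximal_const) auto
        also have "\<dots> \<le> 2 * (R * sqrt n + 1) * V / e\<^sup>2"
          unfolding ul using that r incr_bound_nonneg by (intro divide_right_mono mult_mono) auto
        finally show ?thesis .
      qed
      have ini: "?P {\<omega>. \<exists>i\<in>{0<..A}. e \<le> \<bar>\<Sum>j\<in>{0<..i}. incr 1 b n j (\<omega> j)\<bar>} \<le> A * V / e\<^sup>2"
        if "incr_bound 1 b \<le> V" for b
      proof -
        have "?P {\<omega>. \<exists>i\<in>{0<..A}. e \<le> \<bar>\<Sum>j\<in>{0<..i}. incr 1 b n j (\<omega> j)\<bar>} \<le> real (A - 0) * incr_bound 1 b / e\<^sup>2"
          using pn e by (intro walk_maximal_const) auto
        also have "\<dots> \<le> A * V / e\<^sup>2"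
          using that by (intro divide_right_mono mult_mono) (auto simp: incr_bound_nonneg)
        finally show ?thesis .
      qed
      have un2: "?P (X \<union> Y) \<le> ?P X + ?P Y" for X Y
        by (rule measure_Un_le) auto
      have "?P {\<omega>. (\<forall>i. 1 \<le> i \<and> i \<le> A \<longrightarrow> 0 \<le> balance \<omega> i) \<and> \<not> (\<exists>I. near_passage n A \<epsilon> \<omega> I)}
          \<le> ?P (?B2 \<union> (?B3 \<union> ?B4) \<union> (?B5 \<union> ?B6))"
        by (rule measure_pmf.finite_measure_mono[OF sub]) simp
      also have "\<dots> \<le> ?P ?B2 + (?P ?B3 + ?P ?B4) + (?P ?B5 + ?P ?B6)"
        using un2[of "?B2 \<union> (?B3 \<union> ?B4)" "?B5 \<union> ?B6"] un2[of ?B2 "?B3 \<union> ?B4"] un2[of ?B3 ?B4] un2[of ?B5 ?B6]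
        by linarith
      also have "\<dots> \<le> 2 * (\<eta> / 3) + (4 * (R * sqrt n + 1) * V / e\<^sup>2 + 2 * A * V / e\<^sup>2)"
      proof -
        have 1: "2 * (2 * (R * sqrt n + 1) * V / e\<^sup>2) = 4 * (R * sqrt n + 1) * V / e\<^sup>2" by simp
        have 2: "2 * (A * V / e\<^sup>2) = 2 * A * V / e\<^sup>2" by simp
        have add5: "x1 + (x2 + x3) + (x4 + x5) \<le> z + (2 * X + 2 * Y)"
          if "x1 \<le> z" "x2 \<le> X" "x3 \<le> X" "x4 \<le> Y" "x5 \<le> Y" for x1 x2 x3 x4 x5 z X Y :: real
          using that by linarith
        show ?thesis
          unfolding 1[symmetric] 2[symmetric]
          by (rule add5[OF p2 win[OF V(2)] win[OF V(3)] ini[OF V(2)] ini[OF V(3)]])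
      qed
      also have "\<dots> \<le> \<eta>" using elim(7) by (simp add: e_def)
      finally show ?case .
    qed
  qed
qed

lemma start_indep_window_sum:
  assumes "A \<le> pivot n" "pivot n < n"
  shows "walk_prob n {\<omega>. (\<forall>i. 1 \<le> i \<and> i \<le> A \<longrightarrow> 0 \<le> balance \<omega> i) \<and> window_sum A a b n \<omega> \<le> x} =
    walk_prob n {\<omega>. \<forall>i. 1 \<le> i \<and> i \<le> A \<longrightarrow> 0 \<le> balance \<omega> i} *
    walk_prob n {\<omega>. window_sum A a b n \<omega> \<le> x}"
proof -
  let ?Q = "walk_pmf \<mu> n"
  let ?c = "\<lambda>_ :: nat. count_space (UNIV :: (nat \<times> nat) set)"
  have comp: "(\<lambda>h. g (h i)) \<in> borel_measurable (PiM I ?c)" if "i \<in> I" for g :: "nat \<times> nat \<Rightarrow> real" and i I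
    using measurable_compose[OF measurable_component_singleton[OF that, of ?c], of g borel] by simp
  let ?F = "\<lambda>h. if \<forall>j\<in>{1..A}. 0 \<le> (\<Sum>i\<in>{1..j}. real (fst (h i)) - real (snd (h i))) then 1 else 0 :: real"
  let ?G = "\<lambda>h. (\<Sum>i\<in>{A<..pivot n}. incr a b n i (h i)) / sqrt n"
  have F: "?F \<in> borel_measurable (PiM {1..A} ?c)"
  proof -
    have [measurable]: "(\<lambda>h. \<Sum>i\<in>{1..j}. real (fst (h i)) - real (snd (h i))) \<in> borel_measurable (PiM {1..A} ?c)"
      if "j \<in> {1..A}" for j
      using that by (intro borel_measurable_sum comp[where g = "\<lambda>x. real (fst x) - real (snd x)"]) auto
    show ?thesis by measurable
  qed
  have G: "?G \<in> borel_measurable (PiM {A<..pivot n} ?c)"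
  proof -
    have "(\<lambda>h. \<Sum>i\<in>{A<..pivot n}. incr a b n i (h i)) \<in> borel_measurable (PiM {A<..pivot n} ?c)"
      by (intro borel_measurable_sum comp)
    then show ?thesis by measurable
  qed
  have sub: "{A<..pivot n} \<subseteq> {1..<n}" "{1..A} \<subseteq> {1..<n}" "{1..A} \<inter> {A<..pivot n} = {}"
    using assms by (auto simp only: subset_iff greaterThanAtMost_iff atLeastLessThan_iff atLeastAtMost_iff)
  have "prob_space.indep_var (measure_pmf ?Q) (PiM {1..A} ?c) (\<lambda>\<omega>. restrict (\<lambda>i. \<omega> i) {1..A})
      (PiM {A<..pivot n} ?c) (\<lambda>\<omega>. restrict (\<lambda>i. \<omega> i) {A<..pivot n})"
    using sub by (intro prob_space.indep_var_restrict[OF measure_pmf.prob_space_axioms walk_indep])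
  from prob_space.indep_var_compose[OF measure_pmf.prob_space_axioms this F G]
  have ind: "prob_space.indep_var (measure_pmf ?Q) borel (?F \<circ> (\<lambda>\<omega>. restrict (\<lambda>i. \<omega> i) {1..A}))
      borel (?G \<circ> (\<lambda>\<omega>. restrict (\<lambda>i. \<omega> i) {A<..pivot n}))" .
  have FE: "(?F \<circ> (\<lambda>\<omega>. restrict (\<lambda>i. \<omega> i) {1..A})) \<omega> \<in> {1..} \<longleftrightarrow> (\<forall>i. 1 \<le> i \<and> i \<le> A \<longrightarrow> 0 \<le> balance \<omega> i)" for \<omega>
  proof -
    have "(\<Sum>i\<in>{1..j}. real (fst (restrict (\<lambda>i. \<omega> i) {1..A} i)) - real (snd (restrict (\<lambda>i. \<omega> i) {1..A} i))) = balance \<omega> j"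
      if "j \<in> {1..A}" for j
      unfolding balance_def using that by (intro sum.cong) auto
    then have "(\<forall>j\<in>{1..A}. 0 \<le> (\<Sum>i\<in>{1..j}. real (fst (restrict (\<lambda>i. \<omega> i) {1..A} i)) - real (snd (restrict (\<lambda>i. \<omega> i) {1..A} i))))
      \<longleftrightarrow> (\<forall>j\<in>{1..A}. 0 \<le> balance \<omega> j)" by (intro ball_cong) (simp_all only:)
    then show ?thesis unfolding comp_def by (simp only: split: if_split) auto
  qed
  have GE: "(?G \<circ> (\<lambda>\<omega>. restrict (\<lambda>i. \<omega> i) {A<..pivot n})) \<omega> = window_sum A a b n \<omega>" for \<omega>
    by (simp add: window_sum_def comp_def)
  from prob_space.indep_varD[OF measure_pmf.prob_space_axioms ind, of "{1..}" "{..x}"]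
  show ?thesis
    by (simp only: vimage_def mem_Times_iff fst_conv snd_conv FE GE atMost_iff) simp
qed

end

section \<open>Central limit theorem for the window sums\<close>

context walk_model
begin

text \<open>The integral of \<open>x / (1 - x)^2\<close> over the interval from 0 to
  \<open>p\<close>, with \<open>ln (1 - p)\<close> replaced by \<open>- \<theta>\<close>: the limit
  of the variance of the coupon time at the pivot, divided by \<open>n\<close>.\<close>

definition delay_var :: real where "delay_var = 1 / (1 - p) - \<theta> - 1"

lemma pivot_ratio: "(\<lambda>n. real (pivot n) / n) \<longlonglongrightarrow> p"
proof (rule tendsto_sandwich)
  show "eventually (\<lambda>n. p - 1 / real n \<le> real (pivot n) / n) sequentially"
    using eventually_gt_at_top[of 0]
  proof eventually_elim
    case (elim n)
    have "(p * n - 1) / n \<le> real (pivot n) / n" using pivot_bounds[of n] by (intro divide_right_mono) auto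
    then show ?case using elim by (simp add: diff_divide_distrib)
  qed
  show "eventually (\<lambda>n. real (pivot n) / n \<le> p) sequentially"
    using eventually_gt_at_top[of 0]
    by eventually_elim (use pivot_bounds in \<open>auto simp: divide_le_eq\<close>)
  show "(\<lambda>n. p - 1 / real n) \<longlonglongrightarrow> p" by real_asymp
qed simp

lemma pivot_at_top: "eventually (\<lambda>n. A \<le> pivot n) sequentially"
proof -
  have "eventually (\<lambda>n. real A + 1 \<le> p * real n) sequentially" using p_bounds(1) by real_asymp
  then show ?thesis
  proof eventually_elim
    case (elim n)
    then show ?case using pivot_bounds[of n] by linarith
  qed
qed

lemma pivot_less: "0 < n \<Longrightarrow> pivot n < n" "real (pivot n) \<le> p_cap * n"
proof -
  assume "0 < n"
  then have "p * n < 1 * real n" using p_bounds by (intro mult_strict_right_mono) auto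
  then show "pivot n < n" using pivot_bounds[of n] by linarith
next
  have "p * n \<le> p_cap * n" using p_cap_bounds by (intro mult_right_mono) auto
  then show "real (pivot n) \<le> p_cap * n" using pivot_bounds[of n] by linarith
qed

lemma window_index:
  assumes "i \<in> {A<..pivot n}"
  shows "1 \<le> i" "i < n" "real i \<le> p_cap * n" "real i / n \<le> p_cap"
proof -
  have n: "0 < n" using assms by (cases "n = 0") (auto simp: pivot_def)
  show "1 \<le> i" "i < n" using assms pivot_less(1)[OF n] by auto
  show *: "real i \<le> p_cap * n" using assms pivot_less(2)[of n] by auto
  then show "real i / n \<le> p_cap" using n by (simp add: divide_le_eq)
qed

lemma card_window: "card {A<..pivot n} \<le> n"
  using pivot_less(1)[of n] by (cases "n = 0") (auto simp: pivot_def)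

lemma card_window_ratio: "(\<lambda>n. real (card {A<..pivot n}) / n) \<longlonglongrightarrow> p"
proof -
  have "(\<lambda>n. real (pivot n) / n - real A / n) \<longlonglongrightarrow> p - 0"
    by (intro tendsto_diff pivot_ratio lim_const_over_n)
  moreover have "eventually (\<lambda>n. real (pivot n) / n - real A / n = real (card {A<..pivot n}) / n) sequentially"
    using pivot_at_top[of A] by eventually_elim (simp add: of_nat_diff diff_divide_distrib)
  ultimately show ?thesis by (simp add: tendsto_cong)
qed

lemma geo_var_window: "(\<lambda>n. (\<Sum>i\<in>{A<..pivot n}. geo_var n i) / n) \<longlonglongrightarrow> delay_var"
proof -
  define G where "G x = 1 / (1 - x) + ln (1 - x)" for x :: real
  define g where "g x = x / (1 - x)\<^sup>2" for x :: real
  have deriv: "(G has_real_derivative g x) (at x)" if "x < 1" for x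
  proof -
    have "(G has_real_derivative (1 / (1 - x)\<^sup>2 - 1 / (1 - x))) (at x)"
      unfolding G_def using that by (auto intro!: derivative_eq_intros simp: power2_eq_square)
    moreover have "1 / (1 - x)\<^sup>2 - 1 / (1 - x) = g x"
      using that by (simp add: g_def power2_eq_square divide_simps)
    ultimately show ?thesis by simp
  qed
  have mono: "g x \<le> g y" if "0 \<le> x" "x \<le> y" "y < 1" for x y
    unfolding g_def using that by (intro frac_le power_mono) auto
  \<comment> \<open>The error of the Riemann sum stays bounded, so it vanishes after division by
    \<open>n\<close>, as do the first \<open>A\<close> terms.\<close>
  define err where "err n = (\<Sum>i\<in>{1..pivot n}. geo_var n i) - n * (G (pivot n / n) - G 0)" for n :: nat
  have err: "0 \<le> err n" "err n \<le> g p" if n: "0 < n" for n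
  proof -
    have jp: "real (pivot n) / n \<le> p" using pivot_bounds[of n] n by (simp add: divide_le_eq)
    have "n * (G (pivot n / n) - G 0) \<le> (\<Sum>i\<in>{1..pivot n}. g (real i / real n))"
      "(\<Sum>i\<in>{1..pivot n}. g (real i / real n)) \<le> n * (G (pivot n / n) - G 0) + (g (pivot n / n) - g 0)"
      using n jp p_bounds by (intro riemann_sum_mono deriv mono; linarith)+
    moreover have "g (pivot n / n) \<le> g p" using jp p_bounds by (intro mono) auto
    moreover have "(\<Sum>i\<in>{1..pivot n}. g (real i / real n)) = (\<Sum>i\<in>{1..pivot n}. geo_var n i)"
      by (simp add: g_def geo_var_def)
    moreover have "g 0 = 0" by (simp add: g_def)
    ultimately show "0 \<le> err n" "err n \<le> g p" unfolding err_def by linarith+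
  qed
  have err_lim: "(\<lambda>n. err n / n) \<longlonglongrightarrow> 0"
  proof (rule Lim_null_comparison)
    show "eventually (\<lambda>n. norm (err n / n) \<le> g p / n) sequentially"
      using eventually_gt_at_top[of 0]
    proof eventually_elim
      case (elim n)
      show ?case using err[OF elim] by (simp add: divide_right_mono)
    qed
  qed (rule lim_const_over_n)
  have A_lim: "(\<lambda>n. (\<Sum>i\<in>{1..A}. geo_var n i) / n) \<longlonglongrightarrow> 0"
  proof (rule Lim_null_comparison)
    show "eventually (\<lambda>n. norm ((\<Sum>i\<in>{1..A}. geo_var n i) / n) \<le> A * mean_cap\<^sup>2 / n) sequentially"
      using pivot_at_top[of A] eventually_gt_at_top[of 0]
    proof eventually_elim
      case (elim n)
      have "geo_var n i \<le> mean_cap\<^sup>2" if "i \<in> {1..A}" for i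
        using that elim pivot_less(2)[of n] by (intro geo_var_le) auto
      then have "(\<Sum>i\<in>{1..A}. geo_var n i) \<le> real (card {1..A}) * mean_cap\<^sup>2" by (rule sum_bounded_above)
      moreover have "0 \<le> (\<Sum>i\<in>{1..A}. geo_var n i)" by (intro sum_nonneg) (simp add: geo_var_def)
      ultimately show ?case by (simp add: divide_right_mono)
    qed
  qed (rule lim_const_over_n)
  have G_lim: "(\<lambda>n. G (pivot n / n)) \<longlonglongrightarrow> G p"
    using pivot_ratio deriv[of p] p_bounds DERIV_isCont isCont_tendsto_compose by blast
  have "(\<lambda>n. err n / n + (G (pivot n / n) - G 0) - (\<Sum>i\<in>{1..A}. geo_var n i) / n) \<longlonglongrightarrow> 0 + (G p - G 0) - 0"
    by (intro tendsto_intros err_lim A_lim G_lim)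
  moreover have "eventually (\<lambda>n. err n / n + (G (pivot n / n) - G 0) - (\<Sum>i\<in>{1..A}. geo_var n i) / n =
      (\<Sum>i\<in>{A<..pivot n}. geo_var n i) / n) sequentially"
    using pivot_at_top[of A] eventually_gt_at_top[of 0]
  proof eventually_elim
    case (elim n)
    have "{1..pivot n} = {1..A} \<union> {A<..pivot n}" using elim by auto
    then have split: "(\<Sum>i\<in>{1..pivot n}. geo_var n i) = (\<Sum>i\<in>{1..A}. geo_var n i) + (\<Sum>i\<in>{A<..pivot n}. geo_var n i)"
      by (simp only:) (rule sum.union_disjoint, auto)
    have "err n / n + (G (pivot n / n) - G 0) = (\<Sum>i\<in>{1..pivot n}. geo_var n i) / n"
      using elim by (simp add: err_def diff_divide_distrib)
    then show ?case unfolding split by (simp add: add_divide_distrib)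
  qed
  ultimately have "(\<lambda>n. (\<Sum>i\<in>{A<..pivot n}. geo_var n i) / n) \<longlonglongrightarrow> G p - G 0"
    by (simp add: tendsto_cong)
  moreover have "G p - G 0 = delay_var" by (simp add: G_def delay_var_def exp_theta)
  ultimately show ?thesis by simp
qed

lemma char_scaled:
  "char (distr (measure_pmf P) borel (\<lambda>x. c * h x)) t = char (distr (measure_pmf P) borel h) (c * t)"
  unfolding char_def by (simp add: integral_distr mult_ac)

lemma char_incr:
  assumes i: "1 \<le> i" "i < n"
  shows "char (distr (walk_pmf \<mu> n) borel (\<lambda>\<omega>. incr a b n i (\<omega> i) / sqrt n)) t =
    char (distr (measure_pmf \<mu>) borel (\<lambda>k. real k - EK)) (t * a / sqrt n) *
    char (distr (measure_pmf (geo_delay n i)) borel (\<lambda>k. real k - geo_mean n i)) (t * b / sqrt n)"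
proof -
  let ?P = "pair_pmf \<mu> (geo_delay n i)"
  let ?f = "\<lambda>k. a / sqrt n * (real k - EK)" and ?g = "\<lambda>k. b / sqrt n * (real k - geo_mean n i)"
  have "char (distr (walk_pmf \<mu> n) borel (\<lambda>\<omega>. incr a b n i (\<omega> i) / sqrt n)) t =
      char (distr (map_pmf (\<lambda>\<omega>. \<omega> i) (walk_pmf \<mu> n)) borel (\<lambda>x. incr a b n i x / sqrt n)) t"
    by (simp add: char_def integral_distr)
  also have "\<dots> = char (distr ?P borel (\<lambda>x. ?f (fst x) + ?g (snd x))) t"
    unfolding walk_component[OF i] by (simp add: incr_def add_divide_distrib)
  also have "\<dots> = char (distr ?P borel (\<lambda>x. ?f (fst x))) t * char (distr ?P borel (\<lambda>x. ?g (snd x))) t"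
    by (rule prob_space.char_distr_add[OF measure_pmf.prob_space_axioms indep_fst_snd_pair_pmf])
  also have "char (distr ?P borel (\<lambda>x. ?f (fst x))) t = char (distr (map_pmf fst ?P) borel ?f) t"
    by (simp add: char_def integral_distr)
  also have "char (distr ?P borel (\<lambda>x. ?g (snd x))) t = char (distr (map_pmf snd ?P) borel ?g) t"
    by (simp add: char_def integral_distr)
  finally show ?thesis
    unfolding map_fst_pair_pmf map_snd_pair_pmf char_scaled by (simp add: mult_ac)
qed

text \<open>The two coordinates of each pair are independent, so the product splits into an
  offspring part and a waiting time part. The limit theorem is applied to each separately, since
  their remainders vanish for different reasons.\<close>

lemma window_sum_char_limit:
  "(\<lambda>n. char (distr (walk_pmf \<mu> n) borel (window_sum A a b n)) t) \<longlonglongrightarrow>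
    complex_of_real (exp (- (t\<^sup>2 * (a\<^sup>2 * (p * VarK) + b\<^sup>2 * delay_var) / 2)))"
proof -
  let ?I = "\<lambda>n. {A<..pivot n}"
  have 1: "(\<lambda>n. \<Prod>i\<in>?I n. char (distr (measure_pmf \<mu>) borel (\<lambda>k. real k - EK)) (t * a / sqrt n))
      \<longlonglongrightarrow> complex_of_real (exp (- ((t * a)\<^sup>2 * (p * VarK) / 2)))"
  proof (rule char_triangular_array[where \<nu> = "\<lambda>_ _. \<mu>" and h = "\<lambda>_ _ k. real k - EK" and v = "\<lambda>_ _. VarK" and V = VarK])
    have "(\<lambda>n. real (card (?I n)) / n * VarK) \<longlonglongrightarrow> p * VarK"
      by (intro tendsto_mult_right card_window_ratio)
    then show "(\<lambda>n. (\<Sum>i\<in>?I n. VarK) / n) \<longlonglongrightarrow> p * VarK" by simp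
    show "(\<lambda>n. (\<Sum>i\<in>?I n. measure_pmf.expectation \<mu> (\<lambda>x. min (6 * (real x - EK)\<^sup>2)
        (\<bar>t * a / sqrt n\<bar> * \<bar>real x - EK\<bar> ^ 3))) / n) \<longlonglongrightarrow> 0"
      by (rule lindeberg_identical) (use card_window offspring_centred in auto)
  qed (use card_window offspring_centred in auto)
  have 2: "(\<lambda>n. \<Prod>i\<in>?I n. char (distr (measure_pmf (geo_delay n i)) borel (\<lambda>k. real k - geo_mean n i)) (t * b / sqrt n))
      \<longlonglongrightarrow> complex_of_real (exp (- ((t * b)\<^sup>2 * delay_var / 2)))"
  proof (rule char_triangular_array[where h = "\<lambda>n i k. real k - geo_mean n i" and v = geo_var and V = "mean_cap\<^sup>2" and I = ?I])
    show "(\<lambda>n. (\<Sum>i\<in>?I n. measure_pmf.expectation (geo_delay n i) (\<lambda>x. min (6 * (real x - geo_mean n i)\<^sup>2)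
        (\<bar>t * b / sqrt n\<bar> * \<bar>real x - geo_mean n i\<bar> ^ 3))) / n) \<longlonglongrightarrow> 0"
    proof (rule lindeberg_third_moment)
      fix n i assume i: "i \<in> ?I n"
      show "integrable (measure_pmf (geo_delay n i)) (\<lambda>x. \<bar>real x - geo_mean n i\<bar> ^ 3)"
        by (rule geo_delay_third_moment(1)[OF window_index(1,2,4)[OF i] p_cap_bounds(2)])
      show "measure_pmf.expectation (geo_delay n i) (\<lambda>x. \<bar>real x - geo_mean n i\<bar> ^ 3)
          \<le> (\<Sum>k. (real k + (1 + 1 / (1 - p_cap))) ^ 3 * p_cap ^ k)"
        by (rule geo_delay_third_moment(2)[OF window_index(1,2,4)[OF i] p_cap_bounds(2)])
    qed (use card_window in auto)
    fix n i assume i: "i \<in> ?I n"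
    note m = geo_delay_centred[OF window_index(1,2)[OF i]]
    show "integrable (measure_pmf (geo_delay n i)) (\<lambda>x. (real x - geo_mean n i)\<^sup>2)" by (rule m)
    show "measure_pmf.expectation (geo_delay n i) (\<lambda>x. real x - geo_mean n i) = 0" by (rule m)
    show "measure_pmf.expectation (geo_delay n i) (\<lambda>x. (real x - geo_mean n i)\<^sup>2) = geo_var n i" by (rule m)
    show "geo_var n i \<le> mean_cap\<^sup>2" using window_index[OF i] by (intro geo_var_le) auto
  qed (use card_window geo_var_window in auto)
  have "char (distr (walk_pmf \<mu> n) borel (window_sum A a b n)) t =
      (\<Prod>i\<in>?I n. char (distr (measure_pmf \<mu>) borel (\<lambda>k. real k - EK)) (t * a / sqrt n)) *
      (\<Prod>i\<in>?I n. char (distr (measure_pmf (geo_delay n i)) borel (\<lambda>k. real k - geo_mean n i)) (t * b / sqrt n))" for n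
  proof -
    have sub: "?I n \<subseteq> {1..<n}" using window_index[of _ A n] by (auto simp only: subset_iff atLeastLessThan_iff)
    have "char (distr (walk_pmf \<mu> n) borel (window_sum A a b n)) t =
        char (distr (walk_pmf \<mu> n) borel (\<lambda>\<omega>. \<Sum>i\<in>?I n. incr a b n i (\<omega> i) / sqrt n)) t"
      unfolding window_sum_def by (simp add: sum_divide_distrib)
    also have "\<dots> = (\<Prod>i\<in>?I n. char (distr (walk_pmf \<mu> n) borel (\<lambda>\<omega>. incr a b n i (\<omega> i) / sqrt n)) t)"
      by (intro prob_space.char_distr_sum[OF measure_pmf.prob_space_axioms]
          prob_space.indep_vars_compose2[OF measure_pmf.prob_space_axioms incr_indep[OF sub]]) simp
    also have "\<dots> = (\<Prod>i\<in>?I n. char (distr (measure_pmf \<mu>) borel (\<lambda>k. real k - EK)) (t * a / sqrt n) *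
      char (distr (measure_pmf (geo_delay n i)) borel (\<lambda>k. real k - geo_mean n i)) (t * b / sqrt n))"
      using window_index by (intro prod.cong refl char_incr) auto
    finally show ?thesis by (simp only: prod.distrib)
  qed
  then have "(\<lambda>n. char (distr (walk_pmf \<mu> n) borel (window_sum A a b n)) t) \<longlonglongrightarrow>
      complex_of_real (exp (- ((t * a)\<^sup>2 * (p * VarK) / 2))) * complex_of_real (exp (- ((t * b)\<^sup>2 * delay_var / 2)))"
    using tendsto_mult[OF 1 2] by simp
  moreover have "exp (- ((t * a)\<^sup>2 * (p * VarK) / 2)) * exp (- ((t * b)\<^sup>2 * delay_var / 2)) =
      exp (- (t\<^sup>2 * (a\<^sup>2 * (p * VarK) + b\<^sup>2 * delay_var) / 2))"
    unfolding exp_add[symmetric] by (simp add: power_mult_distrib algebra_simps add_divide_distrib)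
  ultimately show ?thesis by (simp only: of_real_mult[symmetric])
qed

end

text \<open>Reduction to the standard normal law, whose characteristic function is known. Continuity
  of its distribution function turns weak convergence into convergence at every point.\<close>

lemma centred_gaussian_cdf:
  assumes v: "0 < v"
  shows "cdf (centred_gaussian v) x = cdf std_normal_distribution (x / sqrt v)"
    and "isCont (cdf std_normal_distribution) y"
proof -
  interpret real_distribution std_normal_distribution by (rule real_dist_normal_dist)
  have "emeasure std_normal_distribution {y} = 0"
    by (subst emeasure_density) (auto intro!: nn_integral_0_iff_AE[THEN iffD2] AE_I[where N = "{y}"] split: split_indicator)
  then have "measure std_normal_distribution {y} = 0" by (simp add: measure_def)
  then show "isCont (cdf std_normal_distribution) y" by (simp add: isCont_cdf)
  define s where "s = sqrt v"
  have s: "0 < s" using v by (simp add: s_def)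
  have prob: "prob_space (centred_gaussian v)"
    unfolding centred_gaussian_def s_def[symmetric] by (rule prob_space_normal_density[OF s])
  have "distributed (centred_gaussian v) lborel (\<lambda>x. x) (normal_density 0 s)"
    unfolding distributed_def centred_gaussian_def s_def[symmetric] by (auto intro!: distr_id2)
  then have "distributed (centred_gaussian v) lborel (\<lambda>x. (x - 0) / s) std_normal_density"
    using prob_space.normal_standard_normal_convert[OF prob s, of "\<lambda>x. x" 0] by simp
  then have d: "distr (centred_gaussian v) lborel (\<lambda>x. x / s) = std_normal_distribution"
    by (simp add: distributed_def)
  have "cdf std_normal_distribution (x / s) = measure (distr (centred_gaussian v) lborel (\<lambda>x. x / s)) {..x / s}"
    unfolding d cdf_def ..
  also have "\<dots> = measure (centred_gaussian v) ((\<lambda>x. x / s) -` {..x / s} \<inter> space (centred_gaussian v))"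
    by (rule measure_distr) (auto simp: centred_gaussian_def)
  also have "(\<lambda>x. x / s) -` {..x / s} \<inter> space (centred_gaussian v) = {..x}"
    using s by (auto simp: centred_gaussian_def divide_le_cancel)
  finally show "cdf (centred_gaussian v) x = cdf std_normal_distribution (x / sqrt v)"
    by (simp add: cdf_def s_def)
qed

context walk_model
begin

lemma window_sum_clt:
  assumes v: "0 < a\<^sup>2 * (p * VarK) + b\<^sup>2 * delay_var" (is "0 < ?v")
  shows "(\<lambda>n. walk_prob n {\<omega>. window_sum A a b n \<omega> \<le> x}) \<longlonglongrightarrow> cdf (centred_gaussian ?v) x"
proof -
  \<comment> \<open>Dividing the coefficients by the standard deviation makes the limit exactly
    standard normal.\<close>
  define s where "s = sqrt ?v"
  have s: "0 < s" "s\<^sup>2 = ?v" using v by (simp_all add: s_def)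
  have Ws: "window_sum A (a / s) (b / s) n \<omega> = window_sum A a b n \<omega> / s" for n \<omega>
    using s by (simp add: window_sum_def incr_def sum_divide_distrib add_divide_distrib mult.commute)
  have one: "(a / s)\<^sup>2 * (p * VarK) + (b / s)\<^sup>2 * delay_var = 1"
  proof -
    have "(a / s)\<^sup>2 * (p * VarK) + (b / s)\<^sup>2 * delay_var = ?v / s\<^sup>2"
      by (simp add: power_divide add_divide_distrib)
    then show ?thesis using s v by simp
  qed
  have "weak_conv_m (\<lambda>n. distr (walk_pmf \<mu> n) borel (window_sum A (a / s) (b / s) n)) std_normal_distribution"
  proof (rule levy_continuity)
    show "real_distribution (distr (walk_pmf \<mu> n) borel (window_sum A (a / s) (b / s) n))" for n
      by (rule prob_space.real_distribution_distr[OF measure_pmf.prob_space_axioms]) simp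
    show "(\<lambda>n. char (distr (walk_pmf \<mu> n) borel (window_sum A (a / s) (b / s) n)) t) \<longlonglongrightarrow> char std_normal_distribution t" for t
      using window_sum_char_limit[of A "a / s" "b / s" t] unfolding one char_std_normal_distribution by simp
  qed (rule real_dist_normal_dist)
  then have "(\<lambda>n. cdf (distr (walk_pmf \<mu> n) borel (window_sum A (a / s) (b / s) n)) (x / s)) \<longlonglongrightarrow> cdf std_normal_distribution (x / s)"
    unfolding weak_conv_m_def weak_conv_def using centred_gaussian_cdf(2)[OF v] by blast
  moreover have "cdf (distr (walk_pmf \<mu> n) borel (window_sum A (a / s) (b / s) n)) (x / s) =
      walk_prob n {\<omega>. window_sum A a b n \<omega> \<le> x}" for n
  proof -
    have "window_sum A (a / s) (b / s) n -` {..x / s} = {\<omega>. window_sum A a b n \<omega> \<le> x}"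
      using s by (auto simp: Ws divide_le_cancel)
    then show ?thesis by (simp add: cdf_def measure_distr)
  qed
  ultimately show ?thesis unfolding centred_gaussian_cdf(1)[OF v] s_def by simp
qed

end

section \<open>Survival and measurability\<close>

lemma gw_tree_take: "w \<in> gw_tree k \<Longrightarrow> take l w \<in> gw_tree k"
  using set_take_subset[of l w] by (auto simp: gw_tree_def words_def min_def)

lemma finite_generation: "finite {w \<in> gw_tree k. length w = l}"
proof (induction l)
  case (Suc l)
  have "{w \<in> gw_tree k. length w = Suc l} \<subseteq> (\<Union>v\<in>{w \<in> gw_tree k. length w = l}. children k v)"
  proof
    fix w assume w: "w \<in> {w \<in> gw_tree k. length w = Suc l}"
    then have "w \<noteq> []" by auto
    then obtain v j where vj: "w = v @ [j]" by (cases w rule: rev_cases) auto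
    then have "v \<in> gw_tree k" "1 \<le> j" "j \<le> k v" "length v = l" using w by (auto simp: gw_tree_snoc)
    then show "w \<in> (\<Union>v\<in>{w \<in> gw_tree k. length w = l}. children k v)"
      unfolding vj by blast
  qed
  moreover have "finite (\<Union>v\<in>{w \<in> gw_tree k. length w = l}. children k v)"
    using Suc children_finite by (intro finite_UN_I) auto
  ultimately show ?case by (rule finite_subset)
qed simp

text \<open>Each generation is finite, and since the tree is closed under prefixes an empty
  generation bounds the length of all its words.\<close>

lemma survival_iff_infinite: "(\<forall>l. 1 \<le> gw_generation k l) \<longleftrightarrow> infinite (gw_tree k)"
proof
  assume *: "\<forall>l. 1 \<le> gw_generation k l"
  show "infinite (gw_tree k)"
  proof
    assume "finite (gw_tree k)"
    then have "finite (length ` gw_tree k)" by simp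
    then obtain b where b: "\<And>w. w \<in> gw_tree k \<Longrightarrow> length w < b"
      using finite_nat_set_iff_bounded[of "length ` gw_tree k"] by auto
    then have "{w \<in> gw_tree k. length w = b} = {}" by fastforce
    then have "gw_generation k b = 0" unfolding gw_generation_def by (simp only: card.empty)
    with * show False by (metis not_one_le_zero)
  qed
next
  assume inf: "infinite (gw_tree k)"
  show "\<forall>l. 1 \<le> gw_generation k l"
  proof (rule ccontr)
    assume "\<not> (\<forall>l. 1 \<le> gw_generation k l)"
    then obtain l where l: "gw_generation k l = 0" by (auto simp: not_le)
    then have e: "{w \<in> gw_tree k. length w = l} = {}"
      using finite_generation[of k l] by (simp add: gw_generation_def)
    have "gw_tree k \<subseteq> (\<Union>j\<in>{..<l}. {w \<in> gw_tree k. length w = j})"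
    proof
      fix w assume w: "w \<in> gw_tree k"
      have "length w < l"
      proof (rule ccontr)
        assume "\<not> length w < l"
        then have "take l w \<in> {w \<in> gw_tree k. length w = l}" using gw_tree_take[OF w] by (simp add: min_def)
        with e show False by blast
      qed
      with w show "w \<in> (\<Union>j\<in>{..<l}. {w \<in> gw_tree k. length w = j})" by simp
    qed
    moreover have "finite (\<Union>j\<in>{..<l}. {w \<in> gw_tree k. length w = j})"
      using finite_generation by simp
    ultimately show False using inf finite_subset by blast
  qed
qed

text \<open>Negated form because \<open>card\<close> of an infinite set is 0.\<close>

definition large_tree :: "nat \<Rightarrow> (nat list \<Rightarrow> nat) \<Rightarrow> bool" where
  "large_tree A k \<longleftrightarrow> \<not> (finite (gw_tree k) \<and> card (gw_tree k) \<le> A)"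

text \<open>There are only countably many finite sets of words, which is what makes the size of the
  tree, and with it survival, measurable.\<close>

lemma large_tree_iff:
  "large_tree A k \<longleftrightarrow> (\<exists>V\<in>{V. finite V \<and> V \<subseteq> words \<and> card V = Suc A}. \<forall>w\<in>V. w \<in> gw_tree k)"
proof
  assume "large_tree A k"
  then have "\<exists>V. finite V \<and> card V = Suc A \<and> V \<subseteq> gw_tree k"
    unfolding large_tree_def
    using infinite_arbitrarily_large[of "gw_tree k" "Suc A"] obtain_subset_with_card_n[of "Suc A" "gw_tree k"]
    by (metis not_less_eq_eq)
  then show "\<exists>V\<in>{V. finite V \<and> V \<subseteq> words \<and> card V = Suc A}. \<forall>w\<in>V. w \<in> gw_tree k"
    using gw_tree_words[of k] by blast
next
  assume "\<exists>V\<in>{V. finite V \<and> V \<subseteq> words \<and> card V = Suc A}. \<forall>w\<in>V. w \<in> gw_tree k"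
  then obtain V where V: "card V = Suc A" "V \<subseteq> gw_tree k" by blast
  show "large_tree A k"
    unfolding large_tree_def
  proof
    assume "finite (gw_tree k) \<and> card (gw_tree k) \<le> A"
    then show False using card_mono[of "gw_tree k" V] V by simp
  qed
qed

lemma survival_iff_large: "(\<forall>l. 1 \<le> gw_generation k l) \<longleftrightarrow> (\<forall>A. large_tree A k)"
  unfolding survival_iff_infinite large_tree_def by auto

section \<open>Measurability of survival, duration and number of informed servers\<close>

context transmission_model
begin

lemma gw_tree_meas: "Measurable.pred M (\<lambda>\<omega>. w \<in> gw_tree (\<lambda>v. K v \<omega>))"
proof (cases "w \<in> words")
  case True
  have "take i w \<in> words" for i
    using True set_take_subset[of i w] by (auto simp: words_def)
  then have [measurable]: "K (take i w) \<in> measurable M (count_space UNIV)" for i by (rule K_meas)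
  show ?thesis unfolding gw_tree_def using True by simp
next
  case False
  then show ?thesis by (simp add: gw_tree_def)
qed

lemma large_tree_meas [measurable]: "Measurable.pred M (\<lambda>\<omega>. large_tree A (\<lambda>v. K v \<omega>))"
proof -
  let ?V = "{V :: nat list set. finite V \<and> V \<subseteq> words \<and> card V = Suc A}"
  have c: "countable ?V"
    by (rule countable_subset[OF _ countable_Collect_finite]) auto
  have "Measurable.pred M (\<lambda>\<omega>. \<forall>w\<in>V. w \<in> gw_tree (\<lambda>v. K v \<omega>))" if "V \<in> ?V" for V
    using that gw_tree_meas by (intro pred_intros_finite(3)) auto
  then have "(\<Union>V\<in>?V. {\<omega>\<in>space M. \<forall>w\<in>V. w \<in> gw_tree (\<lambda>v. K v \<omega>)}) \<in> events"
    unfolding pred_def by (intro sets.countable_UN''[OF c])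
  moreover have "(\<Union>V\<in>?V. {\<omega>\<in>space M. \<forall>w\<in>V. w \<in> gw_tree (\<lambda>v. K v \<omega>)}) =
      {\<omega>\<in>space M. large_tree A (\<lambda>v. K v \<omega>)}"
    unfolding large_tree_iff by blast
  ultimately show ?thesis unfolding pred_def by (simp only:)
qed

definition large :: "nat \<Rightarrow> 'a set" where
  "large A = {\<omega>\<in>space M. large_tree A (\<lambda>v. K v \<omega>)}"

lemma large_sets [measurable]: "large A \<in> events"
  unfolding large_def by measurable

lemma surv_eq: "surv M K = (\<Inter>A. large A)"
  unfolding surv_def large_def survival_iff_large by auto

lemma surv_sets [measurable]: "surv M K \<in> events"
  unfolding surv_eq by measurable

lemma surv_subset_large: "surv M K \<subseteq> large A"
  unfolding surv_eq by blast

lemma large_tendsto: "(\<lambda>A. prob (large A)) \<longlonglongrightarrow> prob (surv M K)"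
proof -
  have "decseq large" by (auto simp: decseq_def large_def large_tree_def)
  then show ?thesis
    unfolding surv_eq by (intro finite_Lim_measure_decseq) auto
qed

lemma coupon_count_meas: 
  assumes "1 \<le> n"
  shows "(\<lambda>\<omega>. coupon_count n (\<lambda>i. \<Delta> i n \<omega>) t) \<in> measurable M (count_space UNIV)"
proof -
  have [measurable]: "(\<lambda>\<omega>. coupon_time (\<lambda>i. \<Delta> i n \<omega>) i) \<in> measurable M (count_space UNIV)" if "i \<in> {1..n}" for i
    unfolding coupon_time_def using that by (intro measurable_sum_nat Delta_meas) auto
  show ?thesis unfolding coupon_count_def by measurable
qed

text \<open>The state is a pair of finite sets of words and so takes countably many values. For each
  value of the previous state, the next one depends on two counts and on one offspring number at a
  fixed word.\<close>

lemma transmission_meas: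
  assumes n: "1 \<le> n"
  shows "{\<omega>\<in>space M. transmission (\<lambda>w. K w \<omega>) (coupon_count n (\<lambda>i. \<Delta> i n \<omega>)) t = s} \<in> events"
proof (induction t arbitrary: s)
  case 0
  have [measurable]: "K [] \<in> measurable M (count_space UNIV)" by (rule K_meas) (simp add: words_def)
  have eq: "transmission k N 0 = s \<longleftrightarrow> (\<exists>x. k [] = x \<and> ({[]}, {[] @ [j] |j. 1 \<le> j \<and> j \<le> x}) = s)" for k N
    unfolding transmission.simps(1) gw_tree_generation_1 by simp
  show ?case unfolding eq by measurable
next
  case (Suc t)
  let ?k = "\<lambda>\<omega> w. K w \<omega>" and ?N = "\<lambda>\<omega>. coupon_count n (\<lambda>i. \<Delta> i n \<omega>)"
  let ?S = "{C :: nat list set. finite C \<and> C \<subseteq> words} \<times> {B :: nat list set. finite B \<and> B \<subseteq> words}"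
  have "countable {C :: nat list set. finite C \<and> C \<subseteq> words}"
    by (rule countable_subset[OF _ countable_Collect_finite]) auto
  then have cS: "countable ?S" by (intro countable_SIGMA)
  have inS: "transmission k N t \<in> ?S" for k N t
    using transmission_invariant[of k N t] gw_tree_words[of k]
    by (cases "transmission k N t") (auto simp: transmission_inv_def)
  define step where "step C B a b x = (if B = {} then (C, B)
      else if b = a + 1 then (C \<union> {smallest_word B}, (B - {smallest_word B}) \<union> {smallest_word B @ [j] |j. 1 \<le> j \<and> j \<le> x})
      else (C, B - {smallest_word B}))" for C B :: "nat list set" and a b x :: nat
  have step: "transmission k N (Suc t) = step C B (N t) (N (Suc t)) (k (smallest_word B))"
    if "transmission k N t = (C, B)" for k N C B
    unfolding transmission.simps(2) that step_def by (simp add: Let_def)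
  have meas: "{\<omega>\<in>space M. step C B (?N \<omega> t) (?N \<omega> (Suc t)) (K (smallest_word B) \<omega>) = s} \<in> events"
    if CB: "(C, B) \<in> ?S" for C B
  proof (cases "B = {}")
    case True
    then show ?thesis by (simp add: step_def)
  next
    case False
    have "smallest_word B \<in> words" using smallest_word_in[of B] False CB by auto
    then have [measurable]: "K (smallest_word B) \<in> measurable M (count_space UNIV)" by (rule K_meas)
    note coupon_count_meas[OF n, measurable]
    have "(step C B (?N \<omega> t) (?N \<omega> (Suc t)) (K (smallest_word B) \<omega>) = s) \<longleftrightarrow>
      (\<exists>a b x. ?N \<omega> t = a \<and> ?N \<omega> (Suc t) = b \<and> K (smallest_word B) \<omega> = x \<and> step C B a b x = s)" for \<omega>
      by simp
    then show ?thesis by (simp only:) measurable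
  qed
  have "{\<omega>\<in>space M. transmission (?k \<omega>) (?N \<omega>) (Suc t) = s} =
    (\<Union>r\<in>?S. {\<omega>\<in>space M. transmission (?k \<omega>) (?N \<omega>) t = r} \<inter>
      {\<omega>\<in>space M. step (fst r) (snd r) (?N \<omega> t) (?N \<omega> (Suc t)) (K (smallest_word (snd r)) \<omega>) = s})"
  proof (intro equalityI subsetI)
    fix \<omega> assume w: "\<omega> \<in> {\<omega>\<in>space M. transmission (?k \<omega>) (?N \<omega>) (Suc t) = s}"
    obtain C B where CB: "transmission (?k \<omega>) (?N \<omega>) t = (C, B)" by (cases "transmission (?k \<omega>) (?N \<omega>) t") auto
    have "(C, B) \<in> ?S" using inS[of "?k \<omega>" "?N \<omega>" t] unfolding CB .
    then show "\<omega> \<in> (\<Union>r\<in>?S. {\<omega>\<in>space M. transmission (?k \<omega>) (?N \<omega>) t = r} \<inter>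
      {\<omega>\<in>space M. step (fst r) (snd r) (?N \<omega> t) (?N \<omega> (Suc t)) (K (smallest_word (snd r)) \<omega>) = s})"
      using w CB step[OF CB] by (intro UN_I[of "(C, B)"]) auto
  next
    fix \<omega> assume "\<omega> \<in> (\<Union>r\<in>?S. {\<omega>\<in>space M. transmission (?k \<omega>) (?N \<omega>) t = r} \<inter>
      {\<omega>\<in>space M. step (fst r) (snd r) (?N \<omega> t) (?N \<omega> (Suc t)) (K (smallest_word (snd r)) \<omega>) = s})"
    then obtain r where r: "\<omega> \<in> space M" "transmission (?k \<omega>) (?N \<omega>) t = r"
      "step (fst r) (snd r) (?N \<omega> t) (?N \<omega> (Suc t)) (K (smallest_word (snd r)) \<omega>) = s" by blast
    then show "\<omega> \<in> {\<omega>\<in>space M. transmission (?k \<omega>) (?N \<omega>) (Suc t) = s}"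
      using step[of "?k \<omega>" "?N \<omega>" "fst r" "snd r"] by simp
  qed
  also have "\<dots> \<in> events"
  proof (rule sets.countable_UN''[OF cS])
    fix r assume "r \<in> ?S"
    then show "{\<omega>\<in>space M. transmission (?k \<omega>) (?N \<omega>) t = r} \<inter>
      {\<omega>\<in>space M. step (fst r) (snd r) (?N \<omega> t) (?N \<omega> (Suc t)) (K (smallest_word (snd r)) \<omega>) = s} \<in> events"
      using Suc.IH[of r] meas[of "fst r" "snd r"] by (intro sets.Int) auto
  qed
  finally show ?case .
qed

lemma tau_meas:
  assumes n: "1 \<le> n"
  shows "tau K \<Delta> n \<in> measurable M (count_space UNIV)"
proof -
  let ?tr = "\<lambda>\<omega> t. transmission (\<lambda>w. K w \<omega>) (coupon_count n (\<lambda>i. \<Delta> i n \<omega>)) t"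
  have "Measurable.pred M (\<lambda>\<omega>. snd (?tr \<omega> t) = {})" for t
  proof -
    let ?S = "{C :: nat list set. finite C}"
    have "(snd (?tr \<omega> t) = {}) \<longleftrightarrow> (\<exists>C\<in>?S. ?tr \<omega> t = (C, {}))" for \<omega>
      using transmission_invariant[of "\<lambda>w. K w \<omega>" "coupon_count n (\<lambda>i. \<Delta> i n \<omega>)" t]
      by (cases "?tr \<omega> t") (auto simp: transmission_inv_def)
    then have "{\<omega>\<in>space M. snd (?tr \<omega> t) = {}} = (\<Union>C\<in>?S. {\<omega>\<in>space M. ?tr \<omega> t = (C, {})})" by auto
    also have "\<dots> \<in> events"
      by (intro sets.countable_UN'' countable_Collect_finite transmission_meas[OF n])
    finally show ?thesis by (simp add: pred_def)
  qed
  then show ?thesis unfolding tau_def[abs_def] duration_def by measurable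
qed

lemma informed_meas:
  assumes n: "1 \<le> n"
  shows "informed K \<Delta> n \<in> measurable M (count_space UNIV)"
  unfolding informed_def[abs_def]
  by (rule measurable_compose_countable[OF coupon_count_meas[OF n] tau_meas[OF n]])

end

section \<open>Positive probability of a long exploration\<close>

context walk_model
begin

definition alive :: "nat \<Rightarrow> (nat \<Rightarrow> nat \<times> nat) \<Rightarrow> bool" where
  "alive A \<omega> \<longleftrightarrow> (\<forall>i. 1 \<le> i \<and> i \<le> A \<longrightarrow> 0 \<le> balance \<omega> i)"

definition no_delay :: "nat \<Rightarrow> (nat \<Rightarrow> nat \<times> nat) \<Rightarrow> bool" where
  "no_delay A \<omega> \<longleftrightarrow> (\<forall>i. 1 \<le> i \<and> i \<le> A \<longrightarrow> snd (\<omega> i) = 1)"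

lemma prob_component:
  assumes "1 \<le> i" "i < n"
  shows "walk_prob n {\<omega>. \<omega> i \<in> B} = measure_pmf.prob (pair_pmf \<mu> (geo_delay n i)) B"
  unfolding walk_component[OF assms, symmetric] by (simp add: vimage_def)

lemma prob_snd_component:
  assumes "1 \<le> i" "i < n"
  shows "walk_prob n {\<omega>. snd (\<omega> i) \<in> B} = measure_pmf.prob (geo_delay n i) B"
proof -
  have "walk_prob n {\<omega>. \<omega> i \<in> snd -` B} = measure_pmf.prob (map_pmf snd (pair_pmf \<mu> (geo_delay n i))) B"
    unfolding prob_component[OF assms] by simp
  then show ?thesis by (simp add: map_snd_pair_pmf)
qed

lemma prob_fst_component:
  assumes "1 \<le> i" "i < n"
  shows "walk_prob n {\<omega>. fst (\<omega> i) \<in> B} = measure_pmf.prob \<mu> B"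
proof -
  have "walk_prob n {\<omega>. \<omega> i \<in> fst -` B} = measure_pmf.prob (map_pmf fst (pair_pmf \<mu> (geo_delay n i))) B"
    unfolding prob_component[OF assms] by simp
  then show ?thesis by (simp add: map_fst_pair_pmf)
qed

text \<open>Union bound: the waiting time with index \<open>i\<close> differs from 1 with
  probability \<open>i / n\<close>.\<close>

lemma prob_delay:
  assumes "A < n"
  shows "walk_prob n {\<omega>. \<not> no_delay A \<omega>} \<le> (real A)\<^sup>2 / n"
proof -
  have "{\<omega>. \<not> no_delay A \<omega>} = (\<Union>i\<in>{1..A}. {\<omega>. snd (\<omega> i) \<in> - {1}})"
    by (auto simp: no_delay_def)
  also have "walk_prob n \<dots> \<le> (\<Sum>i\<in>{1..A}. walk_prob n {\<omega>. snd (\<omega> i) \<in> - {1}})"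
    by (rule measure_UNION_le) auto
  also have "\<dots> \<le> (\<Sum>i\<in>{1..A}. real A / n)"
  proof (rule sum_mono)
    fix i assume i: "i \<in> {1..A}"
    then have i': "1 \<le> i" "i < n" using assms by auto
    have "measure_pmf.prob (geo_delay n i) (- {1}) = 1 - pmf (geo_delay n i) 1"
      using measure_pmf.prob_compl[of "{1}" "geo_delay n i"] by (simp add: Compl_eq_Diff_UNIV pmf.rep_eq)
    also have "pmf (geo_delay n i) 1 = 1 - real i / n"
      unfolding geo_delay_def using pmf_map_inj'[of Suc "geometric_pmf (1 - real i / n)" 0] i' by simp
    also have "1 - (1 - real i / n) \<le> real A / n" using i by (simp add: divide_right_mono)
    finally show "walk_prob n {\<omega>. snd (\<omega> i) \<in> - {1}} \<le> real A / n"
      unfolding prob_snd_component[OF i'] .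
  qed
  also have "\<dots> = (real A)\<^sup>2 / n" by (simp add: power2_eq_square)
  finally show ?thesis .
qed

lemma prob_degenerate: "walk_prob n {\<omega>. \<exists>i\<in>{1..<n}. snd (\<omega> i) = 0} = 0"
proof -
  have "{\<omega>. \<exists>i\<in>{1..<n}. snd (\<omega> i) = 0} = (\<Union>i\<in>{1..<n}. {\<omega>. snd (\<omega> i) \<in> {0}})" by auto
  also have "walk_prob n \<dots> \<le> (\<Sum>i\<in>{1..<n}. walk_prob n {\<omega>. snd (\<omega> i) \<in> {0}})"
    by (rule measure_UNION_le) auto
  also have "\<dots> = (\<Sum>i\<in>{1..<n}. 0)"
  proof (rule sum.cong[OF refl])
    fix i assume "i \<in> {1..<n}"
    then have i: "1 \<le> i" "i < n" by auto
    have "measure_pmf.prob (geo_delay n i) {0} = 0"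
      unfolding geo_delay_def by (simp add: vimage_def)
    then show "walk_prob n {\<omega>. snd (\<omega> i) \<in> {0}} = 0"
      unfolding prob_snd_component[OF i] .
  qed
  finally show ?thesis by (simp add: measure_le_0_iff)
qed

text \<open>Otherwise the mean would be at most 1.\<close>

lemma offspring_ge_2: "0 < measure_pmf.prob \<mu> {2..}"
proof (rule ccontr)
  assume "\<not> 0 < measure_pmf.prob \<mu> {2..}"
  then have "measure_pmf.prob \<mu> {2..} = 0" using measure_nonneg[of "measure_pmf \<mu>" "{2..}"] by linarith
  then have "set_pmf \<mu> \<inter> {2..} = {}" by (simp add: measure_pmf_zero_iff)
  then have "AE k in measure_pmf \<mu>. real k \<le> 1" by (force simp: AE_measure_pmf_iff disjoint_iff)
  then have "measure_pmf.expectation \<mu> real \<le> measure_pmf.expectation \<mu> (\<lambda>_. 1)"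
    using offspring_centred(1) by (intro integral_mono_AE) auto
  then show False using EK_gt_1 by (simp add: EK_def)
qed

lemma prob_first_large:
  assumes "m < n"
  shows "walk_prob n {\<omega>. \<forall>i\<in>{1..m}. 2 \<le> fst (\<omega> i)} = measure_pmf.prob \<mu> {2..} ^ m"
proof (cases "m = 0")
  case False
  have "{\<omega>. \<forall>i\<in>{1..m}. 2 \<le> fst (\<omega> i)} =
      (\<Inter>i\<in>{1..m}. (\<lambda>\<omega>. \<omega> i) -` {x. fst x \<in> {2..}} \<inter> space (measure_pmf (walk_pmf \<mu> n)))"
    using False by auto
  also have "walk_prob n \<dots> =
      (\<Prod>i\<in>{1..m}. walk_prob n ((\<lambda>\<omega>. \<omega> i) -` {x. fst x \<in> {2..}} \<inter> space (measure_pmf (walk_pmf \<mu> n))))"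
    using assms False by (intro prob_space.indep_varsD[OF measure_pmf.prob_space_axioms walk_indep[of n]]) auto
  also have "\<dots> = (\<Prod>i\<in>{1..m}. measure_pmf.prob \<mu> {2..})"
  proof (rule prod.cong[OF refl])
    fix i assume "i \<in> {1..m}"
    then have i: "1 \<le> i" "i < n" using assms by auto
    show "walk_prob n ((\<lambda>\<omega>. \<omega> i) -` {x. fst x \<in> {2..}} \<inter> space (measure_pmf (walk_pmf \<mu> n))) =
        measure_pmf.prob \<mu> {2..}"
      using prob_fst_component[OF i, of "{2..}"] by (simp add: vimage_def)
  qed
  finally show ?thesis by simp
qed simp

lemma prob_first_large_then:
  assumes "m < n" "A < n"
  shows "walk_prob n {\<omega>. (\<forall>i\<in>{1..m}. 2 \<le> fst (\<omega> i)) \<and>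
      \<not> (\<exists>i\<in>{m<..A}. c i \<le> \<bar>\<Sum>j\<in>{m<..i}. incr a b n j (\<omega> j)\<bar>)} =
    walk_prob n {\<omega>. \<forall>i\<in>{1..m}. 2 \<le> fst (\<omega> i)} *
    walk_prob n {\<omega>. \<not> (\<exists>i\<in>{m<..A}. c i \<le> \<bar>\<Sum>j\<in>{m<..i}. incr a b n j (\<omega> j)\<bar>)}"
proof -
  let ?Q = "walk_pmf \<mu> n"
  let ?c = "\<lambda>_ :: nat. count_space (UNIV :: (nat \<times> nat) set)"
  let ?F = "\<lambda>h. if \<forall>i\<in>{1..m}. 2 \<le> fst (h i) then 1 else 0 :: real"
  let ?G = "\<lambda>h. if \<exists>i\<in>{m<..A}. c i \<le> \<bar>\<Sum>j\<in>{m<..i}. incr a b n j (h j)\<bar> then 0 else 1 :: real"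
  have PiM: "PiM I ?c = count_space (PiE I (\<lambda>_. UNIV))" if "finite I" for I
    using that by (intro count_space_PiM_finite) auto
  have F: "?F \<in> borel_measurable (PiM {1..m} ?c)" and G: "?G \<in> borel_measurable (PiM {m<..A} ?c)"
    by (simp_all only: PiM finite_atLeastAtMost finite_greaterThanAtMost measurable_count_space_eq1) auto
  have sub: "{m<..A} \<subseteq> {1..<n}" "{1..m} \<subseteq> {1..<n}" "{1..m} \<inter> {m<..A} = {}"
    using assms by (auto simp only: subset_iff greaterThanAtMost_iff atLeastLessThan_iff atLeastAtMost_iff)
  have "prob_space.indep_var (measure_pmf ?Q) (PiM {1..m} ?c) (\<lambda>\<omega>. restrict (\<lambda>i. \<omega> i) {1..m})
      (PiM {m<..A} ?c) (\<lambda>\<omega>. restrict (\<lambda>i. \<omega> i) {m<..A})"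
    using sub by (intro prob_space.indep_var_restrict[OF measure_pmf.prob_space_axioms walk_indep])
  from prob_space.indep_var_compose[OF measure_pmf.prob_space_axioms this F G]
  have ind: "prob_space.indep_var (measure_pmf ?Q) borel (?F \<circ> (\<lambda>\<omega>. restrict (\<lambda>i. \<omega> i) {1..m}))
      borel (?G \<circ> (\<lambda>\<omega>. restrict (\<lambda>i. \<omega> i) {m<..A}))" .
  have FE: "(?F \<circ> (\<lambda>\<omega>. restrict (\<lambda>i. \<omega> i) {1..m})) \<omega> \<in> {1..} \<longleftrightarrow> (\<forall>i\<in>{1..m}. 2 \<le> fst (\<omega> i))" for \<omega>
    by simp
  have GE: "(?G \<circ> (\<lambda>\<omega>. restrict (\<lambda>i. \<omega> i) {m<..A})) \<omega> \<in> {1..} \<longleftrightarrow>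
      \<not> (\<exists>i\<in>{m<..A}. c i \<le> \<bar>\<Sum>j\<in>{m<..i}. incr a b n j (\<omega> j)\<bar>)" for \<omega>
  proof -
    have "(\<Sum>j\<in>{m<..i}. incr a b n j (restrict (\<lambda>i. \<omega> i) {m<..A} j)) = (\<Sum>j\<in>{m<..i}. incr a b n j (\<omega> j))"
      if "i \<in> {m<..A}" for i
      using that by (intro sum.cong) auto
    then have "(\<exists>i\<in>{m<..A}. c i \<le> \<bar>\<Sum>j\<in>{m<..i}. incr a b n j (restrict (\<lambda>i. \<omega> i) {m<..A} j)\<bar>) \<longleftrightarrow>
      (\<exists>i\<in>{m<..A}. c i \<le> \<bar>\<Sum>j\<in>{m<..i}. incr a b n j (\<omega> j)\<bar>)" by (intro bex_cong) (simp_all only:)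
    then show ?thesis unfolding comp_def by (simp only: split: if_split) auto
  qed
  from prob_space.indep_varD[OF measure_pmf.prob_space_axioms ind, of "{1..}" "{1..}"]
  show ?thesis
    by (simp only: vimage_def mem_Times_iff fst_conv snd_conv FE GE) simp
qed

text \<open>If each of the first \<open>m\<close> vertices has at least two children, the exploration starts with a
  reserve of \<open>m\<close> vertices, which the positive drift then preserves.\<close>

lemma alive_lower_bound:
  "\<exists>\<rho>>0. \<forall>A. eventually (\<lambda>n. \<rho> \<le> walk_prob n {\<omega>. alive A \<omega>} + (real A)\<^sup>2 / n) sequentially"
proof -
  \<comment> \<open>With \<open>h \<le> 1\<close> the reserve of \<open>m\<close> vertices covers
    the tolerated deviation \<open>h * m\<close>, and with \<open>h \<le> EK - 1\<close> the drift
    covers its growth beyond \<open>m\<close>.\<close>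
  define h where "h = min 1 (EK - 1)"
  have h: "0 < h" "h \<le> 1" "h \<le> EK - 1" using EK_gt_1 by (auto simp: h_def)
  define V where "V = incr_bound 1 0 / h\<^sup>2"
  have V: "0 \<le> V" using incr_bound_nonneg by (simp add: V_def)
  \<comment> \<open>The probability of a large deviation is at most \<open>V * (2 / m)\<close>,
    which this choice makes at most \<open>1 / 2\<close>.\<close>
  define m where "m = Suc (nat \<lceil>4 * V\<rceil>)"
  have m: "1 \<le> m" "4 * V \<le> m" using real_nat_ceiling_ge[of "4 * V"] by (simp_all add: m_def)
  define r where "r = measure_pmf.prob \<mu> {2..}"
  have r: "0 < r" unfolding r_def by (rule offspring_ge_2)
  show ?thesis
  proof (intro exI[of _ "r ^ m / 2"] conjI allI)
    show "0 < r ^ m / 2" using r by simp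
    fix A :: nat
    define A' where "A' = max A m"
    show "eventually (\<lambda>n. r ^ m / 2 \<le> walk_prob n {\<omega>. alive A \<omega>} + (real A)\<^sup>2 / n) sequentially"
      using pivot_at_top[of A'] eventually_gt_at_top[of 0]
    proof eventually_elim
      case (elim n)
      let ?P = "walk_prob n"
      have A: "A' < n" "real A' \<le> p_cap * n" "A < n" "m < n" "m \<le> A'" "A \<le> A'"
        using elim pivot_less[of n] by (auto simp: A'_def)
      let ?bad = "\<lambda>\<omega>. \<exists>i\<in>{m<..A'}. h * max (real m) (real i) \<le> \<bar>\<Sum>j\<in>{m<..i}. incr 1 0 n j (\<omega> j)\<bar>"
      let ?big = "\<lambda>\<omega>. \<forall>i\<in>{1..m}. 2 \<le> fst (\<omega> i)"
      have "?P {\<omega>. ?bad \<omega>} \<le> (\<Sum>i\<in>{m<..A'}. incr_bound 1 0 / (h * max (real m) (real i))\<^sup>2)"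
      proof (rule walk_maximal)
        fix i :: nat assume "i \<in> {m<..A'}"
        then show "0 < h * max (real m) (real i)" using h m by simp
      next
        fix i :: nat
        show "h * max (real m) (real i) \<le> h * max (real m) (real (Suc i))"
          using h by (intro mult_left_mono max.mono) auto
      qed (use A in auto)
      also have "\<dots> = V * (\<Sum>i\<in>{m<..A'}. 1 / (max (real m) (real i))\<^sup>2)"
        by (simp add: V_def sum_distrib_left power_mult_distrib)
      also have "(\<Sum>i\<in>{m<..A'}. 1 / (max (real m) (real i))\<^sup>2) \<le> (\<Sum>i\<in>{0<..A'}. 1 / (max (real m) (real i))\<^sup>2)"
        by (intro sum_mono2) auto
      also have "\<dots> \<le> 2 / m" by (rule sum_inverse_max_squares[OF m(1)])
      finally have "?P {\<omega>. ?bad \<omega>} \<le> V * (2 / m)" using V by (simp add: mult_left_mono)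
      also have "\<dots> \<le> 1 / 2" using m by (simp add: field_simps)
      finally have bad: "?P {\<omega>. ?bad \<omega>} \<le> 1 / 2" .
      have "1 / 2 \<le> 1 - ?P {\<omega>. ?bad \<omega>}" using bad by simp
      also have "\<dots> = ?P {\<omega>. \<not> ?bad \<omega>}"
        using measure_pmf.prob_compl[of "{\<omega>. ?bad \<omega>}" "walk_pmf \<mu> n"]
        by (simp add: Compl_eq_Diff_UNIV[symmetric] Collect_neg_eq[symmetric])
      finally have "r ^ m * (1 / 2) \<le> r ^ m * ?P {\<omega>. \<not> ?bad \<omega>}" using r by (intro mult_left_mono) auto
      also have "\<dots> = ?P {\<omega>. ?big \<omega> \<and> \<not> ?bad \<omega>}"
        unfolding prob_first_large_then[OF A(4,1)] prob_first_large[OF A(4)] r_def ..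
      \<comment> \<open>Without delays the balance is a sum of offspring numbers minus 1, so only
        these matter; the event of a delay is paid for by \<open>A^2 / n\<close>.\<close>
      also have "\<dots> \<le> ?P ({\<omega>. alive A \<omega>} \<union> {\<omega>. \<not> no_delay A \<omega>})"
      proof (rule measure_pmf.finite_measure_mono)
        show "{\<omega>. ?big \<omega> \<and> \<not> ?bad \<omega>} \<subseteq> {\<omega>. alive A \<omega>} \<union> {\<omega>. \<not> no_delay A \<omega>}"
        proof (intro subsetI, rule ccontr)
          fix \<omega> assume 1: "\<omega> \<in> {\<omega>. ?big \<omega> \<and> \<not> ?bad \<omega>}" and 2: "\<omega> \<notin> {\<omega>. alive A \<omega>} \<union> {\<omega>. \<not> no_delay A \<omega>}"
          then have big: "?big \<omega>" and nb: "\<not> ?bad \<omega>" and nd: "no_delay A \<omega>" by auto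
          have "0 \<le> balance \<omega> i" if i: "1 \<le> i" "i \<le> A" for i
          proof -
            have balance_eq1: "balance \<omega> i = (\<Sum>j\<in>{1..i}. real (fst (\<omega> j)) - 1)"
              unfolding balance_def using nd i by (intro sum.cong) (auto simp: no_delay_def)
            have large: "1 \<le> real (fst (\<omega> j)) - 1" if "j \<in> {1..m}" for j
            proof -
              have "2 \<le> fst (\<omega> j)" using big that by blast
              then show ?thesis by simp
            qed
            show ?thesis
            proof (cases "i \<le> m")
              case True
              show ?thesis unfolding balance_eq1
              proof (rule sum_nonneg)
                fix j assume "j \<in> {1..i}"
                then show "0 \<le> real (fst (\<omega> j)) - 1" using large[of j] True by simp
              qed
            next
              case False
              then have mi: "m < i" "i \<in> {m<..A'}" using i A by auto
              have "{1..i} = {1..m} \<union> {m<..i}" using mi by auto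
              then have "balance \<omega> i = (\<Sum>j\<in>{1..m}. real (fst (\<omega> j)) - 1) + (\<Sum>j\<in>{m<..i}. real (fst (\<omega> j)) - 1)"
                unfolding balance_eq1 by (simp only:) (rule sum.union_disjoint, auto)
              moreover have "real m \<le> (\<Sum>j\<in>{1..m}. real (fst (\<omega> j)) - 1)"
                using sum_mono[of "{1..m}" "\<lambda>_. 1", OF large] by simp
              moreover have "(\<Sum>j\<in>{m<..i}. real (fst (\<omega> j)) - 1) = (\<Sum>j\<in>{m<..i}. incr 1 0 n j (\<omega> j)) + (EK - 1) * (real i - real m)"
                using mi by (simp add: incr_def sum_subtractf of_nat_diff algebra_simps)
              moreover have "\<bar>\<Sum>j\<in>{m<..i}. incr 1 0 n j (\<omega> j)\<bar> < h * i"
              proof -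
                have "\<not> h * max (real m) (real i) \<le> \<bar>\<Sum>j\<in>{m<..i}. incr 1 0 n j (\<omega> j)\<bar>"
                  using nb mi(2) by blast
                moreover have "max (real m) (real i) = real i" using mi(1) by simp
                ultimately show ?thesis by simp
              qed
              moreover have "h * i \<le> m + (EK - 1) * (real i - real m)"
              proof -
                have "h * m \<le> 1 * real m" using h by (intro mult_right_mono) auto
                moreover have "h * (real i - real m) \<le> (EK - 1) * (real i - real m)"
                  using h mi by (intro mult_right_mono) auto
                ultimately show ?thesis by (simp add: algebra_simps)
              qed
              ultimately show ?thesis by linarith
            qed
          qed
          then have "alive A \<omega>" by (simp add: alive_def)
          with 2 show False by simp
        qed
      qed simp
      also have "\<dots> \<le> ?P {\<omega>. alive A \<omega>} + ?P {\<omega>. \<not> no_delay A \<omega>}" by (rule measure_Un_le) auto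
      also have "\<dots> \<le> ?P {\<omega>. alive A \<omega>} + (real A)\<^sup>2 / n" using prob_delay[OF A(3)] by simp
      finally show ?case by simp
    qed
  qed
qed

end

section \<open>Conditioning on survival\<close>

text \<open>To be read with \<open>S\<close> survival, \<open>F\<close> the tree having more than
  \<open>A\<close> vertices, \<open>E\<close> the walk being nonnegative up to \<open>A\<close>,
  \<open>Y\<close> the event that the studied quantity is at most \<open>x\<close>, and
  \<open>Wp\<close>, \<open>Wm\<close> the events that the window sum is at most
  \<open>x + \<epsilon>\<close>, respectively \<open>x - \<epsilon>\<close>. Independence is
  available for \<open>E\<close> only, so \<open>S\<close> is exchanged for \<open>E\<close> through
  \<open>F\<close>, and on \<open>E\<close> the event \<open>Y\<close> is enclosed between
  \<open>Wm\<close> and \<open>Wp\<close> up to small probability.\<close>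

lemma (in prob_space) conditional_slutsky_bound:
  fixes G \<delta> wp wm :: real
  assumes ev: "S \<in> events" "F \<in> events" "E \<in> events" "Y \<in> events" "Wp \<in> events" "Wm \<in> events"
    and SF: "S \<subseteq> F" "prob F \<le> prob S + \<delta>" and EF: "prob (E - F) \<le> \<delta>" "prob (F - E) \<le> \<delta>"
    and close: "prob (E \<inter> Y - Wp) \<le> \<delta>" "prob (E \<inter> Wm - Y) \<le> \<delta>"
    and ind: "prob (E \<inter> Wp) = prob E * wp" "prob (E \<inter> Wm) = prob E * wm"
    and lim: "wp \<le> G + 2 * \<delta>" "G - 2 * \<delta> \<le> wm" and G: "0 \<le> G" "G \<le> 1" and \<delta>: "0 \<le> \<delta>"
  shows "\<bar>prob (S \<inter> Y) - prob S * G\<bar> \<le> 6 * \<delta>"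
proof -
  note [measurable] = ev
  have un: "prob (A \<union> B) \<le> prob A + prob B" if "A \<in> events" "B \<in> events" for A B
    using that by (rule measure_Un_le)
  have "prob E \<le> prob (F \<union> (E - F))" by (rule finite_measure_mono) auto
  also have "\<dots> \<le> prob F + prob (E - F)" by (rule un) auto
  finally have E1: "prob E \<le> prob S + 2 * \<delta>" using SF EF by simp
  have "prob S \<le> prob (E \<union> (F - E))" using SF by (intro finite_measure_mono) auto
  also have "\<dots> \<le> prob E + prob (F - E)" by (rule un) auto
  finally have E2: "prob S \<le> prob E + \<delta>" using EF by simp
  have "prob (S \<inter> Y) \<le> prob ((E \<inter> Wp) \<union> ((E \<inter> Y - Wp) \<union> (F - E)))"
    using SF by (intro finite_measure_mono) auto
  also have "\<dots> \<le> prob (E \<inter> Wp) + prob ((E \<inter> Y - Wp) \<union> (F - E))" by (rule un) auto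
  also have "\<dots> \<le> prob (E \<inter> Wp) + (prob (E \<inter> Y - Wp) + prob (F - E))" by (intro add_left_mono un) auto
  also have "\<dots> \<le> prob E * wp + 2 * \<delta>" using close EF ind by simp
  also have "prob E * wp \<le> prob E * (G + 2 * \<delta>)" using lim by (intro mult_left_mono) auto
  also have "prob E * (G + 2 * \<delta>) \<le> prob E * G + 2 * \<delta>"
    using mult_right_mono[of "prob E" 1 "2 * \<delta>"] \<delta> by (simp add: distrib_left)
  also have "prob E * G \<le> prob S * G + 2 * \<delta>"
  proof -
    have "prob E * G \<le> (prob S + 2 * \<delta>) * G" using E1 G by (intro mult_right_mono)
    also have "\<dots> \<le> prob S * G + 2 * \<delta> * 1"
      unfolding distrib_right using G \<delta> by (intro add_left_mono mult_left_mono) auto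
    finally show ?thesis by simp
  qed
  finally have upper: "prob (S \<inter> Y) \<le> prob S * G + 6 * \<delta>" by simp
  have "prob E * wm \<le> prob ((S \<inter> Y) \<union> ((F - S) \<union> ((E - F) \<union> (E \<inter> Wm - Y))))"
    unfolding ind(2)[symmetric] by (intro finite_measure_mono) auto
  also have "\<dots> \<le> prob (S \<inter> Y) + prob ((F - S) \<union> ((E - F) \<union> (E \<inter> Wm - Y)))" by (rule un) auto
  also have "\<dots> \<le> prob (S \<inter> Y) + (prob (F - S) + prob ((E - F) \<union> (E \<inter> Wm - Y)))"
    by (intro add_left_mono un) auto
  also have "\<dots> \<le> prob (S \<inter> Y) + (prob (F - S) + (prob (E - F) + prob (E \<inter> Wm - Y)))"
    by (intro add_left_mono un) auto
  also have "prob (F - S) = prob F - prob S" using SF by (intro finite_measure_Diff) auto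
  finally have "prob E * wm \<le> prob (S \<inter> Y) + 3 * \<delta>" using SF EF close by simp
  moreover have "prob E * (G - 2 * \<delta>) \<le> prob E * wm" using lim by (intro mult_left_mono) auto
  moreover have "prob E * G - 2 * \<delta> \<le> prob E * (G - 2 * \<delta>)"
    using mult_right_mono[of "prob E" 1 "2 * \<delta>"] \<delta> by (simp add: right_diff_distrib)
  moreover have "prob S * G - \<delta> \<le> prob E * G"
  proof -
    have "prob S * G \<le> (prob E + \<delta>) * G" using E2 G by (intro mult_right_mono)
    also have "\<dots> \<le> prob E * G + \<delta> * 1"
      unfolding distrib_right using G \<delta> by (intro add_left_mono mult_left_mono) auto
    finally show ?thesis by simp
  qed
  ultimately have "prob S * G - 6 * \<delta> \<le> prob (S \<inter> Y)" by simp
  with upper show ?thesis by (simp add: abs_le_iff)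
qed

section \<open>From the walk back to the transmission\<close>

locale transmission_walk = transmission_model M \<mu> K \<Delta> + walk_model EK \<theta> p \<mu> VarK
  for M :: "'a measure" and \<mu> :: "nat pmf" and K :: "nat list \<Rightarrow> 'a \<Rightarrow> nat" and \<Delta> :: "nat \<Rightarrow> nat \<Rightarrow> 'a \<Rightarrow> nat"
    and EK \<theta> p VarK :: real
begin

text \<open>The law makes the waiting times positive almost surely only; the path arguments of
  \<open>waiting_times\<close> are applied off this null event.\<close>

definition degenerate :: "nat \<Rightarrow> (nat \<Rightarrow> nat \<times> nat) \<Rightarrow> bool" where
  "degenerate n h \<longleftrightarrow> (\<exists>i\<in>{1..<n}. snd (h i) = 0)"

context
  fixes n :: nat and \<omega> :: 'a
  assumes n: "1 \<le> n" and nondeg: "\<not> degenerate n (obs n \<omega>)"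
begin

interpretation waiting_times n "\<lambda>i. \<Delta> i n \<omega>"
proof
  fix i assume "1 \<le> i" "i < n"
  then have "snd (obs n \<omega> i) \<noteq> 0" using nondeg by (auto simp: degenerate_def)
  then show "1 \<le> \<Delta> i n \<omega>" using \<open>1 \<le> i\<close> \<open>i < n\<close> by (simp add: obs_def walk_obs_def)
qed (rule n)

lemma offspring_sum_obs:
  assumes "j < n"
  shows "offspring_sum (obs n \<omega>) j = real (\<Sum>l\<in>{1..j}. K (query n (\<lambda>i. \<Delta> i n \<omega>) (\<lambda>w. K w \<omega>) l) \<omega>)"
  unfolding offspring_sum_def of_nat_sum using assms by (intro sum.cong) (auto simp: obs_def walk_obs_def)

lemma balance_obs:
  assumes "j < n"
  shows "balance (obs n \<omega>) j = real (\<Sum>l\<in>{1..j}. K (query n (\<lambda>i. \<Delta> i n \<omega>) (\<lambda>w. K w \<omega>) l) \<omega>) - real (coupon_time (\<lambda>i. \<Delta> i n \<omega>) (Suc j))"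
proof -
  have "balance (obs n \<omega>) j = offspring_sum (obs n \<omega>) j - (\<Sum>i\<in>{1..j}. real (snd (obs n \<omega> i)))"
    by (simp add: balance_def offspring_sum_def sum_subtractf)
  also have "(\<Sum>i\<in>{1..j}. real (snd (obs n \<omega> i))) = (\<Sum>i\<in>{1..j}. real (\<Delta> i n \<omega>))"
    using assms by (intro sum.cong) (auto simp: obs_def walk_obs_def)
  also have "\<dots> = real (coupon_time (\<lambda>i. \<Delta> i n \<omega>) (Suc j))"
    unfolding coupon_time_def of_nat_sum by (simp add: atLeastLessThanSuc_atLeastAtMost)
  finally show ?thesis by (simp only: offspring_sum_obs[OF assms])
qed

lemma balance_nonneg_iff:
  assumes "j < n"
  shows "0 \<le> balance (obs n \<omega>) j \<longleftrightarrow>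
    coupon_time (\<lambda>i. \<Delta> i n \<omega>) (Suc j) \<le> (\<Sum>l\<in>{1..j}. K (query n (\<lambda>i. \<Delta> i n \<omega>) (\<lambda>w. K w \<omega>) l) \<omega>)"
  unfolding balance_obs[OF assms] by (simp del: of_nat_sum)

lemma first_passage:
  assumes "near_passage n A \<epsilon> (obs n \<omega>) I"
  shows "real (tau K \<Delta> n \<omega>) = offspring_sum (obs n \<omega>) I" "informed K \<Delta> n \<omega> = I"
proof -
  have I: "1 \<le> I" "I < n" and pos: "\<And>i. 1 \<le> i \<Longrightarrow> i < I \<Longrightarrow> 0 \<le> balance (obs n \<omega>) i" and neg: "balance (obs n \<omega>) I < 0"
    using assms unfolding near_passage_def by blast+
  let ?k = "\<lambda>w. K w \<omega>" and ?d = "\<lambda>i. \<Delta> i n \<omega>"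
  have *: "coupon_time ?d (Suc i) \<le> (\<Sum>l\<in>{1..i}. ?k (query n ?d ?k l))" if "1 \<le> i" "i < I" for i
    using pos[OF that] balance_nonneg_iff[of i] that I by simp
  have **: "(\<Sum>l\<in>{1..I}. ?k (query n ?d ?k l)) < coupon_time ?d (Suc I)"
    using neg balance_nonneg_iff[of I] I by simp
  note dies = exploration_dies[of I ?k, OF I * **]
  have tau: "tau K \<Delta> n \<omega> = (\<Sum>l\<in>{1..I}. ?k (query n ?d ?k l))"
    unfolding tau_def by (rule dies(1))
  then show "real (tau K \<Delta> n \<omega>) = offspring_sum (obs n \<omega>) I" by (simp only: offspring_sum_obs[OF I(2)])
  show "informed K \<Delta> n \<omega> = I" unfolding informed_def tau by (rule dies(2))
qed

lemma alive_iff_large_tree: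
  assumes "A < n" "no_delay A (obs n \<omega>)"
  shows "alive A (obs n \<omega>) \<longleftrightarrow> large_tree A (\<lambda>w. K w \<omega>)"
proof -
  have d: "\<Delta> i n \<omega> = 1" if "1 \<le> i" "i \<le> A" for i
    using assms that by (auto simp: no_delay_def obs_def walk_obs_def)
  have "alive A (obs n \<omega>) \<longleftrightarrow> (\<forall>j\<in>{1..A}. coupon_time (\<lambda>i. \<Delta> i n \<omega>) (Suc j) \<le> (\<Sum>l\<in>{1..j}. K (query n (\<lambda>i. \<Delta> i n \<omega>) (\<lambda>w. K w \<omega>) l) \<omega>))"
    unfolding alive_def using balance_nonneg_iff assms(1) by auto
  also have "\<dots> \<longleftrightarrow> large_tree A (\<lambda>w. K w \<omega>)"
    unfolding large_tree_def using survives_iff_large_tree[of A "\<lambda>w. K w \<omega>"] assms(1) d by blast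
  finally show ?thesis .
qed

end

lemma prob_degenerate_obs:
  assumes "1 \<le> n"
  shows "prob {\<omega>\<in>space M. degenerate n (obs n \<omega>)} = 0"
  using prob_obs[OF assms, of "degenerate n"] prob_degenerate[of n] by (simp add: degenerate_def)

lemma obs_pred: "1 \<le> n \<Longrightarrow> {\<omega>\<in>space M. P (obs n \<omega>)} \<in> events"
  using measurable_sets[OF obs_meas, of n "{f. P f}"] by (simp add: vimage_def Int_def conj_commute)

lemma alive_large_close:
  assumes "A < n"
  shows "prob ({\<omega>\<in>space M. alive A (obs n \<omega>)} - large A) \<le> (real A)\<^sup>2 / n"
    and "prob (large A - {\<omega>\<in>space M. alive A (obs n \<omega>)}) \<le> (real A)\<^sup>2 / n"
proof -
  have n: "1 \<le> n" using assms by simp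
  let ?B = "{\<omega>\<in>space M. \<not> no_delay A (obs n \<omega>)} \<union> {\<omega>\<in>space M. degenerate n (obs n \<omega>)}"
  have "prob ?B \<le> prob {\<omega>\<in>space M. \<not> no_delay A (obs n \<omega>)} + prob {\<omega>\<in>space M. degenerate n (obs n \<omega>)}"
    by (intro measure_Un_le obs_pred n)
  also have "\<dots> \<le> (real A)\<^sup>2 / n"
    using prob_delay[OF assms] prob_obs[OF n, of "\<lambda>f. \<not> no_delay A f"] prob_degenerate_obs[OF n] by simp
  finally have B: "prob ?B \<le> (real A)\<^sup>2 / n" .
  have ev: "?B \<in> events" by (intro sets.Un obs_pred n)
  have iff: "alive A (obs n \<omega>) \<longleftrightarrow> \<omega> \<in> large A" if "\<omega> \<in> space M" "\<omega> \<notin> ?B" for \<omega>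
  proof -
    have "\<not> degenerate n (obs n \<omega>)" "no_delay A (obs n \<omega>)" using that by auto
    then show ?thesis using alive_iff_large_tree[OF n _ assms] that(1) by (simp add: large_def)
  qed
  have "{\<omega>\<in>space M. alive A (obs n \<omega>)} - large A \<subseteq> ?B" using iff by blast
  then show "prob ({\<omega>\<in>space M. alive A (obs n \<omega>)} - large A) \<le> (real A)\<^sup>2 / n"
    using finite_measure_mono[OF _ ev] B order_trans by blast
  have "large A \<subseteq> space M" by (auto simp: large_def)
  then have "large A - {\<omega>\<in>space M. alive A (obs n \<omega>)} \<subseteq> ?B" using iff by blast
  then show "prob (large A - {\<omega>\<in>space M. alive A (obs n \<omega>)}) \<le> (real A)\<^sup>2 / n"
    using finite_measure_mono[OF _ ev] B order_trans by blast
qed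

text \<open>The bound of \<open>alive_lower_bound\<close> is uniform in \<open>A\<close>: letting
  \<open>n\<close> tend to infinity removes the errors \<open>A^2 / n\<close>, and letting
  \<open>A\<close> grow afterwards leads to survival.\<close>

lemma prob_surv_pos: "0 < prob (surv M K)"
proof -
  obtain \<rho> where \<rho>: "0 < \<rho>"
    "\<And>A. eventually (\<lambda>n. \<rho> \<le> walk_prob n {\<omega>. alive A \<omega>} + (real A)\<^sup>2 / n) sequentially"
    using alive_lower_bound by blast
  have "\<rho> \<le> prob (large A)" for A
  proof (rule tendsto_lowerbound)
    have "(\<lambda>n. prob (large A) + 2 * ((real A)\<^sup>2 / real n)) \<longlonglongrightarrow> prob (large A) + 2 * 0"
      by (intro tendsto_intros lim_const_over_n)
    then show "(\<lambda>n. prob (large A) + 2 * ((real A)\<^sup>2 / real n)) \<longlonglongrightarrow> prob (large A)" by simp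
    show "eventually (\<lambda>n. \<rho> \<le> prob (large A) + 2 * ((real A)\<^sup>2 / real n)) sequentially"
      using \<rho>(2)[of A] eventually_gt_at_top[of A]
    proof eventually_elim
      case (elim n)
      then have n: "1 \<le> n" by simp
      let ?E = "{\<omega>\<in>space M. alive A (obs n \<omega>)}"
      have "prob ?E \<le> prob (large A \<union> (?E - large A))"
        using obs_pred[OF n] by (intro finite_measure_mono) auto
      also have "\<dots> \<le> prob (large A) + prob (?E - large A)"
        using obs_pred[OF n] by (intro measure_Un_le) auto
      also have "\<dots> \<le> prob (large A) + (real A)\<^sup>2 / n"
        using alive_large_close(1)[OF elim(2)] by simp
      finally show ?case using elim(1) prob_obs[OF n, of "alive A"] by simp
    qed
  qed simp
  then have "\<rho> \<le> prob (surv M K)"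
    using large_tendsto by (intro LIMSEQ_le_const) auto
  with \<rho>(1) show ?thesis by simp
qed

text \<open>Strict inequality in \<open>1 + \<theta> \<le> exp \<theta>\<close>.\<close>

lemma delay_var_pos: "0 < delay_var"
proof -
  have "\<theta> + 1 < exp \<theta>" using exp_minus_greater[of "- \<theta>"] theta_pos by simp
  then show ?thesis unfolding delay_var_def exp_theta(2)[symmetric] by simp
qed

text \<open>Serves the duration and the number of informed servers alike, since \<open>Y\<close>
  enters only through its distance to a window sum. A nonzero \<open>b\<close> makes the variance
  positive even when the offspring number is deterministic.\<close>

theorem conditional_clt:
  fixes Y :: "nat \<Rightarrow> 'a \<Rightarrow> real"
  assumes Y: "\<And>n. 1 \<le> n \<Longrightarrow> random_variable borel (Y n)"
    and near: "\<And>n A \<epsilon> \<omega> I. 1 \<le> n \<Longrightarrow> \<not> degenerate n (obs n \<omega>) \<Longrightarrow> near_passage n A \<epsilon> (obs n \<omega>) I \<Longrightarrow>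
      \<bar>Y n \<omega> - window_sum A a b n (obs n \<omega>)\<bar> \<le> \<epsilon>"
    and b: "b \<noteq> 0"
  shows "weak_conv_m (\<lambda>n. cond_law M (surv M K) (Y n)) (centred_gaussian (a\<^sup>2 * (p * VarK) + b\<^sup>2 * delay_var))"
proof -
  define v where "v = a\<^sup>2 * (p * VarK) + b\<^sup>2 * delay_var"
  have v: "0 < v"
    unfolding v_def using b delay_var_pos VarK_nonneg p_bounds by (intro add_nonneg_pos) auto
  define G where "G = cdf (centred_gaussian v)"
  interpret N: real_distribution std_normal_distribution by (rule real_dist_normal_dist)
  have G_eq: "G x = cdf std_normal_distribution (x / sqrt v)" for x
    unfolding G_def by (rule centred_gaussian_cdf(1)[OF v])
  have G01: "0 \<le> G x" "G x \<le> 1" for x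
    unfolding G_eq by (simp_all add: N.cdf_nonneg N.cdf_bounded_prob)
  have G_cont: "isCont G x" for x
  proof -
    have "isCont (\<lambda>x. x / sqrt v) x" using v by (intro continuous_intros) auto
    from isCont_o2[OF this centred_gaussian_cdf(2)[OF v]] show ?thesis unfolding G_eq[abs_def] .
  qed
  have main: "(\<lambda>n. prob (surv M K \<inter> {\<omega>\<in>space M. Y n \<omega> \<le> x})) \<longlonglongrightarrow> prob (surv M K) * G x" for x
  proof (rule LIMSEQ_I)
    fix r :: real assume r: "0 < r"
    \<comment> \<open>Leaves room for the total error \<open>6 * \<delta>\<close>.\<close>
    define \<delta> where "\<delta> = r / 12"
    have \<delta>: "0 < \<delta>" using r by (simp add: \<delta>_def)
    have "\<exists>e>0. \<forall>y. \<bar>y - x\<bar> < e \<longrightarrow> \<bar>G y - G x\<bar> < \<delta>"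
      using G_cont[of x] \<delta> unfolding continuous_at_eps_delta dist_real_def by simp
    then obtain e where e: "0 < e" "\<And>y. \<bar>y - x\<bar> < e \<Longrightarrow> \<bar>G y - G x\<bar> < \<delta>"
      by (elim exE conjE) simp
    define \<epsilon> where "\<epsilon> = e / 2"
    have \<epsilon>: "0 < \<epsilon>" "\<bar>G (x + \<epsilon>) - G x\<bar> < \<delta>" "\<bar>G (x - \<epsilon>) - G x\<bar> < \<delta>"
      using e(1) by (auto simp: \<epsilon>_def intro!: e(2))
    obtain A0 where A0: "\<And>A \<epsilon>. A0 \<le> A \<Longrightarrow> 0 < \<epsilon> \<Longrightarrow> eventually (\<lambda>n. walk_prob n
        {\<omega>. (\<forall>i. 1 \<le> i \<and> i \<le> A \<longrightarrow> 0 \<le> balance \<omega> i) \<and> \<not> (\<exists>I. near_passage n A \<epsilon> \<omega> I)} \<le> \<delta>) sequentially"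
      using near_passage_likely[OF \<delta>] by blast
    have "eventually (\<lambda>A. prob (large A) < prob (surv M K) + \<delta>) sequentially"
      using large_tendsto \<delta> by (intro order_tendstoD(2)) auto
    then have "eventually (\<lambda>A. prob (large A) < prob (surv M K) + \<delta> \<and> A0 \<le> A) sequentially"
      using eventually_ge_at_top[of A0] by (rule eventually_conj)
    \<comment> \<open>\<open>A\<close> is fixed here, before \<open>n\<close>: large enough for the
      size of the tree to approximate survival and for \<open>near_passage_likely\<close> to
      apply.\<close>
    then obtain A where A: "prob (large A) < prob (surv M K) + \<delta>" "A0 \<le> A"
      by (auto simp: eventually_sequentially)
    have lim: "eventually (\<lambda>n. \<bar>walk_prob n {\<omega>. window_sum A a b n \<omega> \<le> y} - G y\<bar> < \<delta>) sequentially" for y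
    proof -
      have "(\<lambda>n. walk_prob n {\<omega>. window_sum A a b n \<omega> \<le> y}) \<longlonglongrightarrow> G y"
        using window_sum_clt[of a b A y] v unfolding G_def v_def by blast
      from tendstoD[OF this \<delta>] show ?thesis by (simp add: dist_real_def)
    qed
    have small: "eventually (\<lambda>n. (real A)\<^sup>2 / real n < \<delta>) sequentially"
      using \<delta> by (intro order_tendstoD(2)[OF lim_const_over_n])
    have "eventually (\<lambda>n. \<bar>prob (surv M K \<inter> {\<omega>\<in>space M. Y n \<omega> \<le> x}) - prob (surv M K) * G x\<bar> \<le> 6 * \<delta>) sequentially"
      using A0[OF A(2) \<epsilon>(1)] lim[of "x + \<epsilon>"] lim[of "x - \<epsilon>"] small eventually_gt_at_top[of A] pivot_at_top[of A]
    proof eventually_elim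
      case (elim n)
      have n: "1 \<le> n" using elim by simp
      have pn: "pivot n < n" using n by (intro pivot_less) simp
      let ?E = "{\<omega>\<in>space M. alive A (obs n \<omega>)}" and ?Y = "{\<omega>\<in>space M. Y n \<omega> \<le> x}"
      let ?W = "\<lambda>y. {\<omega>\<in>space M. window_sum A a b n (obs n \<omega>) \<le> y}"
      let ?w = "\<lambda>y. walk_prob n {\<omega>. window_sum A a b n \<omega> \<le> y}"
      let ?far = "{\<omega>\<in>space M. alive A (obs n \<omega>) \<and> \<not> (\<exists>I. near_passage n A \<epsilon> (obs n \<omega>) I)} \<union>
        {\<omega>\<in>space M. degenerate n (obs n \<omega>)}"
      have evY: "?Y \<in> events" using Y[OF n] by measurable
      have far_ev: "?far \<in> events"
        using obs_pred[OF n, of "\<lambda>f. alive A f \<and> \<not> (\<exists>I. near_passage n A \<epsilon> f I)"] obs_pred[OF n, of "degenerate n"]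
        by (intro sets.Un)
      have "prob ?far \<le> prob {\<omega>\<in>space M. alive A (obs n \<omega>) \<and> \<not> (\<exists>I. near_passage n A \<epsilon> (obs n \<omega>) I)} +
          prob {\<omega>\<in>space M. degenerate n (obs n \<omega>)}"
        using obs_pred[OF n, of "\<lambda>f. alive A f \<and> \<not> (\<exists>I. near_passage n A \<epsilon> f I)"] obs_pred[OF n, of "degenerate n"]
        by (intro measure_Un_le)
      also have "\<dots> \<le> \<delta>"
        using prob_obs[OF n, of "\<lambda>f. alive A f \<and> \<not> (\<exists>I. near_passage n A \<epsilon> f I)"] elim(1)
          prob_degenerate_obs[OF n] by (simp add: alive_def)
      finally have far: "prob ?far \<le> \<delta>" .
      have close: "\<bar>Y n \<omega> - window_sum A a b n (obs n \<omega>)\<bar> \<le> \<epsilon>" if "\<omega> \<in> ?E" "\<omega> \<notin> ?far" for \<omega>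
      proof -
        have "\<not> degenerate n (obs n \<omega>)" "\<exists>I. near_passage n A \<epsilon> (obs n \<omega>) I" using that by auto
        then show ?thesis using near[OF n] by blast
      qed
      have ind: "prob (?E \<inter> ?W y) = prob ?E * ?w y" for y
      proof -
        have "?E \<inter> ?W y = {\<omega>\<in>space M. alive A (obs n \<omega>) \<and> window_sum A a b n (obs n \<omega>) \<le> y}" by auto
        then show ?thesis
          using prob_obs[OF n, of "\<lambda>f. alive A f \<and> window_sum A a b n f \<le> y"] prob_obs[OF n, of "alive A"]
            start_indep_window_sum[OF elim(6) pn, of a b y] by (simp add: alive_def)
      qed
      show ?case
      proof (rule conditional_slutsky_bound)
        show "surv M K \<in> events" "large A \<in> events" by measurable
        show "?E \<in> events" "?W (x + \<epsilon>) \<in> events" "?W (x - \<epsilon>) \<in> events" by (intro obs_pred n)+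
        show "?Y \<in> events" by (rule evY)
        show "surv M K \<subseteq> large A" by (rule surv_subset_large)
        show "prob (large A) \<le> prob (surv M K) + \<delta>" using A by simp
        show "prob (?E - large A) \<le> \<delta>" "prob (large A - ?E) \<le> \<delta>"
          using alive_large_close[OF elim(5)] elim(4) by simp_all
        have "?E \<inter> ?Y - ?W (x + \<epsilon>) \<subseteq> ?far"
        proof (rule subsetI, rule ccontr)
          fix \<omega> assume w: "\<omega> \<in> ?E \<inter> ?Y - ?W (x + \<epsilon>)" "\<omega> \<notin> ?far"
          then show False using close[of \<omega>] by auto
        qed
        then show "prob (?E \<inter> ?Y - ?W (x + \<epsilon>)) \<le> \<delta>"
          using finite_measure_mono[OF _ far_ev] far order_trans by blast
        have "?E \<inter> ?W (x - \<epsilon>) - ?Y \<subseteq> ?far"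
        proof (rule subsetI, rule ccontr)
          fix \<omega> assume w: "\<omega> \<in> ?E \<inter> ?W (x - \<epsilon>) - ?Y" "\<omega> \<notin> ?far"
          then show False using close[of \<omega>] by auto
        qed
        then show "prob (?E \<inter> ?W (x - \<epsilon>) - ?Y) \<le> \<delta>"
          using finite_measure_mono[OF _ far_ev] far order_trans by blast
        show "prob (?E \<inter> ?W (x + \<epsilon>)) = prob ?E * ?w (x + \<epsilon>)" "prob (?E \<inter> ?W (x - \<epsilon>)) = prob ?E * ?w (x - \<epsilon>)"
          by (rule ind)+
        show "?w (x + \<epsilon>) \<le> G x + 2 * \<delta>" using elim(2) \<epsilon>(2) by linarith
        show "G x - 2 * \<delta> \<le> ?w (x - \<epsilon>)" using elim(3) \<epsilon>(3) by linarith
      qed (use G01 \<delta> in auto)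
    qed
    then obtain N0 where N0: "\<And>n. N0 \<le> n \<Longrightarrow>
        \<bar>prob (surv M K \<inter> {\<omega>\<in>space M. Y n \<omega> \<le> x}) - prob (surv M K) * G x\<bar> \<le> 6 * \<delta>"
      unfolding eventually_sequentially by blast
    have "6 * \<delta> < r" using r by (simp add: \<delta>_def)
    then show "\<exists>N0. \<forall>n\<ge>N0. norm (prob (surv M K \<inter> {\<omega>\<in>space M. Y n \<omega> \<le> x}) - prob (surv M K) * G x) < r"
      using N0 by (intro exI[of _ N0]) (auto intro: order.strict_trans1)
  qed
  have em: "emeasure M (surv M K) \<noteq> 0" "emeasure M (surv M K) \<noteq> \<infinity>"
    using prob_surv_pos by (simp_all add: emeasure_eq_measure)
  have cdf: "cdf (cond_law M (surv M K) (Y n)) x =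
      prob (surv M K \<inter> {\<omega>\<in>space M. Y n \<omega> \<le> x}) / prob (surv M K)" if n: "1 \<le> n" for n x
  proof -
    have "Y n -` {..x} \<inter> space M = {\<omega>\<in>space M. Y n \<omega> \<le> x}" by auto
    moreover have "{\<omega>\<in>space M. Y n \<omega> \<le> x} \<in> events" using Y[OF n] by measurable
    ultimately show ?thesis
      unfolding cdf_def cond_law_def using Y[OF n] em by (subst measure_distr) auto
  qed
  show ?thesis
    unfolding weak_conv_m_def weak_conv_def v_def[symmetric] G_def[symmetric]
  proof (intro allI impI)
    fix x
    have "(\<lambda>n. prob (surv M K \<inter> {\<omega>\<in>space M. Y n \<omega> \<le> x}) / prob (surv M K))
        \<longlonglongrightarrow> prob (surv M K) * G x / prob (surv M K)"
      using prob_surv_pos by (intro tendsto_divide main tendsto_const) auto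
    then have "(\<lambda>n. prob (surv M K \<inter> {\<omega>\<in>space M. Y n \<omega> \<le> x}) / prob (surv M K)) \<longlonglongrightarrow> G x"
      using prob_surv_pos by simp
    moreover have "eventually (\<lambda>n. cdf (cond_law M (surv M K) (Y n)) x =
        prob (surv M K \<inter> {\<omega>\<in>space M. Y n \<omega> \<le> x}) / prob (surv M K)) sequentially"
      using eventually_ge_at_top[of 1] by eventually_elim (rule cdf)
    ultimately show "(\<lambda>n. cdf (cond_law M (surv M K) (Y n)) x) \<longlonglongrightarrow> G x"
      by (simp add: tendsto_cong)
  qed
qed

lemma tau_clt:
  "weak_conv_m (\<lambda>n. cond_law M (surv M K) (\<lambda>\<omega>. (real (tau K \<Delta> n \<omega>) - real n * \<theta>) / sqrt (real n)))
    (centred_gaussian ((1 + EK / slope)\<^sup>2 * (p * VarK) + (- EK / slope)\<^sup>2 * delay_var))"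
proof (rule conditional_clt)
  fix n :: nat assume n: "1 \<le> n"
  have [measurable]: "tau K \<Delta> n \<in> measurable M (count_space UNIV)" by (rule tau_meas[OF n])
  show "random_variable borel (\<lambda>\<omega>. (real (tau K \<Delta> n \<omega>) - real n * \<theta>) / sqrt (real n))" by measurable
next
  fix n A \<epsilon> \<omega> I assume "1 \<le> n" "\<not> degenerate n (obs n \<omega>)" "near_passage n A \<epsilon> (obs n \<omega>) I"
  then show "\<bar>(real (tau K \<Delta> n \<omega>) - real n * \<theta>) / sqrt (real n) - window_sum A (1 + EK / slope) (- EK / slope) n (obs n \<omega>)\<bar> \<le> \<epsilon>"
    using first_passage(1)[of n \<omega> A \<epsilon> I] unfolding near_passage_def by simp
qed (use EK_gt_1 slope_pos in simp)

lemma informed_clt: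
  "weak_conv_m (\<lambda>n. cond_law M (surv M K) (\<lambda>\<omega>. (real (informed K \<Delta> n \<omega>) - real n * p) / sqrt (real n)))
    (centred_gaussian ((1 / slope)\<^sup>2 * (p * VarK) + (- 1 / slope)\<^sup>2 * delay_var))"
proof (rule conditional_clt)
  fix n :: nat assume n: "1 \<le> n"
  have [measurable]: "informed K \<Delta> n \<in> measurable M (count_space UNIV)" by (rule informed_meas[OF n])
  show "random_variable borel (\<lambda>\<omega>. (real (informed K \<Delta> n \<omega>) - real n * p) / sqrt (real n))" by measurable
next
  fix n A \<epsilon> \<omega> I assume "1 \<le> n" "\<not> degenerate n (obs n \<omega>)" "near_passage n A \<epsilon> (obs n \<omega>) I"
  then show "\<bar>(real (informed K \<Delta> n \<omega>) - real n * p) / sqrt (real n) - window_sum A (1 / slope) (- 1 / slope) n (obs n \<omega>)\<bar> \<le> \<epsilon>"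
    using first_passage(2)[of n \<omega> A \<epsilon> I] unfolding near_passage_def by simp
qed (use slope_pos in simp)

section \<open>The limit variances in the form of the theorem\<close>

lemma slope_eq: "slope = (1 - (1 - p) * EK) / (1 - p)"
  using p_bounds by (simp add: slope_def field_simps)

text \<open>The passage from coupon times to the coupon count: near index \<open>p * n\<close> a
  delay of the coupon time lowers the count by \<open>1 - p\<close> times as much, the mean waiting
  time there being \<open>1 / (1 - p)\<close>. Squaring gives the factor.\<close>

lemma delay_var_eq: "(1 - p)\<^sup>2 * delay_var = sigma_N_sq \<theta>"
proof -
  have "exp (- 2 * \<theta>) = (1 - p)\<^sup>2"
    using exp_double[of "- \<theta>"] by (simp add: exp_theta power2_eq_square)
  then have "sigma_N_sq \<theta> = (1 - p) * p - \<theta> * (1 - p)\<^sup>2"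
    by (simp add: sigma_N_sq_def exp_theta)
  also have "\<dots> = (1 - p)\<^sup>2 * delay_var"
    using p_bounds by (simp add: delay_var_def power2_eq_square field_simps)
  finally show ?thesis by simp
qed

lemma tau_variance:
  "(1 + EK / slope)\<^sup>2 * (p * VarK) + (- EK / slope)\<^sup>2 * delay_var =
    (p * VarK + EK\<^sup>2 * sigma_N_sq \<theta>) / ((1 - p) * EK - 1)\<^sup>2"
proof -
  define d where "d = 1 - (1 - p) * EK"
  have d: "0 < d" using slope_pos p_bounds unfolding slope_eq d_def by (simp add: zero_less_divide_iff)
  have s: "EK / slope = EK * (1 - p) / d" unfolding slope_eq d_def by simp
  have 1: "1 + EK / slope = 1 / d" unfolding s using d by (simp add: d_def field_simps)
  have 2: "- EK / slope = - (EK * (1 - p) / d)" using s by simp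
  have 3: "((1 - p) * EK - 1)\<^sup>2 = d\<^sup>2" by (simp add: d_def power2_commute)
  show ?thesis unfolding 1 2 3 delay_var_eq[symmetric] using d
    by (simp add: power_divide power_mult_distrib add_divide_distrib)
qed

lemma informed_variance:
  "(1 / slope)\<^sup>2 * (p * VarK) + (- 1 / slope)\<^sup>2 * delay_var =
    (p * VarK * exp (- 2 * \<theta>) + sigma_N_sq \<theta>) / ((1 - p) * EK - 1)\<^sup>2"
proof -
  define d where "d = 1 - (1 - p) * EK"
  have 1: "1 / slope = (1 - p) / d" unfolding slope_eq d_def by simp
  then have 2: "- 1 / slope = - ((1 - p) / d)" by simp
  have 3: "((1 - p) * EK - 1)\<^sup>2 = d\<^sup>2" by (simp add: d_def power2_commute)
  have 4: "exp (- 2 * \<theta>) = (1 - p)\<^sup>2"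
    using exp_double[of "- \<theta>"] by (simp add: exp_theta power2_eq_square)
  show ?thesis unfolding 1 2 3 4 delay_var_eq[symmetric]
    by (simp add: power_divide power_mult_distrib add_divide_distrib mult_ac)
qed

end

theorem theorem2p3:
  fixes M :: "'a measure"
    and \<mu> :: "nat pmf"
    and K :: "nat list \<Rightarrow> 'a \<Rightarrow> nat"
    and \<Delta> :: "nat \<Rightarrow> nat \<Rightarrow> 'a \<Rightarrow> nat"
    and EK VarK \<theta> p :: real
  assumes prob: "prob_space M"
    and K_indep: "prob_space.indep_vars M (\<lambda>_. count_space UNIV) K words"
    and K_law: "\<And>w. w \<in> words \<Longrightarrow> distr M (count_space UNIV) (K w) = measure_pmf \<mu>"
    and Delta_indep: "\<And>n. 1 \<le> n \<Longrightarrow>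
          prob_space.indep_vars M (\<lambda>_. count_space UNIV) (\<lambda>i. \<Delta> i n) {1..<n}"
    and Delta_law: "\<And>n i. 1 \<le> i \<Longrightarrow> i < n \<Longrightarrow>
          distr M (count_space UNIV) (\<Delta> i n)
            = measure_pmf (map_pmf Suc (geometric_pmf (1 - real i / real n)))"
    and K_Delta_indep: "\<And>n. 1 \<le> n \<Longrightarrow>
          prob_space.indep_set M
            (sets (vimage_algebra (space M) (\<lambda>\<omega>. \<lambda>w\<in>words. K w \<omega>)
              (PiM words (\<lambda>_. count_space UNIV))))
            (sets (vimage_algebra (space M) (\<lambda>\<omega>. \<lambda>i\<in>{1..<n}. \<Delta> i n \<omega>)
              (PiM {1..<n} (\<lambda>_. count_space UNIV))))"
    and EK_def: "EK = measure_pmf.expectation \<mu> real"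
    and EK_gt_1: "1 < EK"
    and EK_sq: "integrable (measure_pmf \<mu>) (\<lambda>k. (real k)\<^sup>2)"
    and VarK_def: "VarK = measure_pmf.variance \<mu> real"
    and theta_def: "\<theta> = (THE s. is_theta EK s)"
    and p_def: "p = 1 - exp (- \<theta>)"
  shows "(\<exists>!s. is_theta EK s)
    \<and> weak_conv_m
        (\<lambda>n. cond_law M (surv M K)
               (\<lambda>\<omega>. (real (tau K \<Delta> n \<omega>) - real n * \<theta>) / sqrt (real n)))
        (centred_gaussian
          ((p * VarK + EK\<^sup>2 * sigma_N_sq \<theta>) / ((1 - p) * EK - 1)\<^sup>2))
    \<and> weak_conv_m
        (\<lambda>n. cond_law M (surv M K)
               (\<lambda>\<omega>. (real (informed K \<Delta> n \<omega>) - real n * p) / sqrt (real n)))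
        (centred_gaussian
          ((p * VarK * exp (- 2 * \<theta>) + sigma_N_sq \<theta>) / ((1 - p) * EK - 1)\<^sup>2))"
proof -
  have ex: "\<exists>!s. is_theta EK s" by (rule ex1_theta[OF EK_gt_1])
  have th: "is_theta EK \<theta>" unfolding theta_def by (rule theI'[OF ex])
  interpret prob_space M by (rule prob)
  interpret transmission_model M \<mu> K \<Delta>
    by unfold_locales (use assms in \<open>simp_all add: geo_delay_def\<close>)
  interpret walk_model EK \<theta> p \<mu> VarK
    by unfold_locales (use EK_gt_1 th p_def EK_def EK_sq VarK_def in auto)
  interpret transmission_walk M \<mu> K \<Delta> EK \<theta> p VarK ..
  show ?thesis
    using ex tau_clt informed_clt unfolding tau_variance informed_variance by blast
qed

end
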